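(* Let $A(z)\in\mathcal P(S^1)^{n\times n}$ be a para-Hermitian matrix. Then there exists an eigendecomposition $A(z)=U(z)D(z)U(z)^P$, where $D(z)\in\mathcal P(S^1)^{n\times n}$ is diagonal and real for all $z\in S^1$ and $U(z)\in\mathcal P(S^1)^{n\times n}$ is para-unitary.
   Context: $S^1=\{z\in\mathbb C:|z|=1\}$. $\mathcal H(S^1)$ is the ring of functions holomorphic on $S^1$, i.e. admitting a holomorphic extension to some open neighbourhood of $S^1$ (equivalently, Laurent series $\sum_{k\in\mathbb Z}a_kz^k$ converging in an open annulus containing $S^1$). For a positive integer $N$ and $z\neq0$, $z^{1/N}:=|z|^{1/N}\exp(\mathrm i\arg(z)/N)$ with $\arg(z)\in(-\pi,\pi]$. $\mathcal H_N(S^1)$ is the space of convergent Laurent series in the variable $z^{1/N}$, i.e. of functions $f(z)=g(z^{1/N})$ with $g\in\mathcal H(S^1)$, and $\mathcal P(S^1):=\bigcup_{N>0}\mathcal H_N(S^1)$. For $A(z)=[a_{i,j}(z)]\in\mathcal P(S^1)^{m\times n}$, the para-Hermitian conjugate $A(z)^P\in\mathcal P(S^1)^{n\times m}$ is the matrix whose $(i,j)$ entry is $\overline{a_{j,i}(\overline z^{-1})}$; on $S^1$ it coincides with the conjugate transpose $A(z)^*$. A square matrix $A(z)$ over $\mathcal P(S^1)$ is para-Hermitian if $A(z)=A(z)^P$, and $U(z)\in\mathcal P(S^1)^{n\times n}$ is para-unitary if $U(z)U(z)^P=U(z)^PU(z)=I$. *)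

theory Defs
  imports "HOL-Analysis.Analysis"
begin

text \<open>
  The entries are germs of functions at the unit circle. They are represented by total functions
  whose values away from the circle are irrelevant, so identities between them are only required
  on some open neighbourhood of the circle.
\<close>

definition near_circle :: "(complex \<Rightarrow> bool) \<Rightarrow> bool" where
  "near_circle Q \<longleftrightarrow> (\<exists>T. open T \<and> sphere 0 1 \<subseteq> T \<and> (\<forall>z\<in>T. Q z))"

text \<open>\<^const>\<open>Arg\<close> takes values in the interval from \<open>-pi\<close> (excluded) to \<open>pi\<close> (included).\<close>

definition principal_root :: "nat \<Rightarrow> complex \<Rightarrow> complex" where
  "principal_root N z = complex_of_real (root N (cmod z)) * exp (\<i> * complex_of_real (Arg z / real N))"

definition holo_circle :: "nat \<Rightarrow> (complex \<Rightarrow> complex) set" where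
  "holo_circle N = {f. \<exists>g. g analytic_on sphere 0 1 \<and> f = (\<lambda>z. g (principal_root N z))}"

definition puiseux_circle :: "(complex \<Rightarrow> complex) set" where
  "puiseux_circle = (\<Union>N\<in>{0<..}. holo_circle N)"

definition puiseux_matrix :: "(complex \<Rightarrow> complex^'n^'m) \<Rightarrow> bool" where
  "puiseux_matrix A \<longleftrightarrow> (\<forall>i j. (\<lambda>z. A z $ i $ j) \<in> puiseux_circle)"

definition para_conj :: "(complex \<Rightarrow> complex^'n^'m) \<Rightarrow> complex \<Rightarrow> complex^'m^'n" where
  "para_conj A z = (\<chi> i j. cnj (A (inverse (cnj z)) $ j $ i))"

definition para_hermitian :: "(complex \<Rightarrow> complex^'n^'n) \<Rightarrow> bool" where
  "para_hermitian A \<longleftrightarrow> near_circle (\<lambda>z. A z = para_conj A z)"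

definition para_unitary :: "(complex \<Rightarrow> complex^'n^'n) \<Rightarrow> bool" where
  "para_unitary U \<longleftrightarrow>
     near_circle (\<lambda>z. U z ** para_conj U z = mat 1 \<and> para_conj U z ** U z = mat 1)"

end

theory Submission
  imports Defs "HOL-Complex_Analysis.Complex_Analysis"
    "HOL-Computational_Algebra.Fundamental_Theorem_Algebra"
begin

text \<open>
  In the variable \<open>w = z\<^sup>1\<^sup>/\<^sup>N\<close> the matrix becomes a matrix \<open>G(w)\<close> that is analytic on the circle and Hermitian at
  each of its points. It suffices to diagonalise \<open>G(w\<^sup>K)\<close> by analytic matrices for some \<open>K\<close>, with all
  identities holding on the circle: para-conjugation is an analytic operation that agrees there with the
  conjugate transpose, so the identity theorem carries the identities to a neighbourhood.

  Eigenvalues: the characteristic polynomial has only real roots. Near a point, a real-rooted monic polynomial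
  with analytic coefficients splits into analytic linear factors (Rellich; \<open>analytic_rellich_local\<close>): after
  translation by the mean of the roots and division of the roots by a power of the parameter, the roots at the
  base point are not all equal, and contour integrals separate them into two clusters of smaller size. Hence
  a root can be continued along the circle for ever. Going round \<open>n\<close> times yields \<open>n + 1\<close> germs of roots at
  the starting point, two of which agree, so the root is analytic in \<open>w\<^sup>1\<^sup>/\<^sup>K\<close> for some \<open>K\<close>
  (\<open>analytic_circle_root\<close>). Division by this root and induction split the polynomial (\<open>analytic_circle_split\<close>).

  Eigenvectors: for a Hermitian matrix \<open>H\<close> the product of the factors \<open>H - \<mu>\<^sub>j\<close> is zero. Applying the factors
  one at a time to a constant vector, the last stage with nonzero image under \<open>H\<close> produces an analytic
  eigenvector (\<open>analytic_eigenvector\<close>). Its common zeros can be divided out, and then it can be scaled to norm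
  one because its squared norm is positive and thus has an analytic square root (\<open>analytic_vec_normalise\<close>).
  Replacing \<open>G\<close> by \<open>G - \<Sum> \<lambda>\<^sub>j v\<^sub>j v\<^sub>j\<^sup>*\<close> and repeating gives an orthonormal basis (\<open>orthonormal_eigenvectors\<close>).
\<close>

(* The dollar sign is left to vector components. *)
unbundle no fps_syntax

section \<open>Germs of analytic functions\<close>

lemma analytic_germ_factor:
  assumes f: "f analytic_on {a}" and nz: "\<not> (\<forall>\<^sub>F z in nhds a. f z = 0)"
  obtains m u where "u analytic_on {a}" "u a \<noteq> 0" "\<forall>\<^sub>F z in nhds a. f z = (z - a) ^ m * u z"
proof (cases "f a = 0")
  case False
  then show ?thesis
    using that[of f 0] f by simp
next
  case True
  obtain r where r: "r > 0" "f holomorphic_on ball a r"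
    using f analytic_at_ball by blast
  have "\<not> f constant_on ball a r"
  proof
    assume "f constant_on ball a r"
    then have "\<forall>z\<in>ball a r. f z = 0"
      using True r(1) unfolding constant_on_def by (metis centre_in_ball)
    then have "\<forall>\<^sub>F z in nhds a. f z = 0"
      using eventually_nhds_in_open[of "ball a r" a] r(1) by (auto elim: eventually_mono)
    then show False
      using nz by contradiction
  qed
  then obtain g e n where g: "0 < n" "0 < e" "g holomorphic_on ball a e"
      "\<And>w. w \<in> ball a e \<Longrightarrow> f w = (w - a)^n * g w" "\<And>w. w \<in> ball a e \<Longrightarrow> g w \<noteq> 0"
    using holomorphic_factor_zero_nonconstant[of f "ball a r" a, OF r(2) open_ball connected_ball] True r(1)
    by (metis centre_in_ball)
  show ?thesis
  proof (rule that[of g n])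
    show "g analytic_on {a}" "g a \<noteq> 0"
      using g analytic_at_ball by auto
    show "\<forall>\<^sub>F z in nhds a. f z = (z - a) ^ n * g z"
      using eventually_nhds_in_open[of "ball a e" a] g(2,4) by (auto elim: eventually_mono)
  qed
qed

lemma analytic_germ_eventually_nonzero:
  assumes f: "f analytic_on {a}" and nz: "\<not> (\<forall>\<^sub>F z in nhds a. f z = 0)"
  shows "\<forall>\<^sub>F z in at a. f z \<noteq> 0"
proof -
  obtain m u where u: "u analytic_on {a}" "u a \<noteq> 0" "\<forall>\<^sub>F z in nhds a. f z = (z - a) ^ m * u z"
    using analytic_germ_factor[OF assms] .
  have "\<forall>\<^sub>F z in at a. u z \<noteq> 0"
    using analytic_at_neq_imp_eventually_neq[OF u(1,2)] .
  moreover have "\<forall>\<^sub>F z in at a. f z = (z - a) ^ m * u z"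
    using u(3) by (auto simp: eventually_at_filter elim: eventually_mono)
  moreover have "\<forall>\<^sub>F z in at a. z \<noteq> a"
    by (simp add: eventually_at_filter)
  ultimately show ?thesis
    by eventually_elim auto
qed

lemma analytic_germ_identity:
  assumes f: "f analytic_on {a}" and "\<exists>\<^sub>F z in at a within S. f z = 0"
  shows "\<forall>\<^sub>F z in nhds a. f z = 0"
proof (rule ccontr)
  assume "\<not> ?thesis"
  then have "\<forall>\<^sub>F z in at a within S. f z \<noteq> 0"
    using analytic_germ_eventually_nonzero[OF f] by (meson at_le filter_leD subset_UNIV)
  then show False
    using assms(2) by (simp add: frequently_def)
qed

lemma at_within_Reals_neq_bot: "at (complex_of_real t) within \<real> \<noteq> bot"
proof -
  have "complex_of_real t islimpt \<real>"
    unfolding islimpt_approachable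
  proof (intro allI impI)
    fix e :: real assume "e > 0"
    then show "\<exists>x'\<in>\<real>. x' \<noteq> complex_of_real t \<and> dist x' (complex_of_real t) < e"
      by (intro bexI[of _ "complex_of_real (t + e/2)"]) (auto simp: dist_norm)
  qed
  then show ?thesis
    by (simp add: trivial_limit_within)
qed

text \<open>Finitely many nonzero germs have a common punctured neighbourhood without zeros.\<close>

lemma analytic_germ_prod_zero:
  assumes "finite I" and "\<And>i. i \<in> I \<Longrightarrow> f i analytic_on {a}"
    and "\<exists>\<^sub>F z in at a within S. \<exists>i\<in>I. f i z = 0"
  shows "\<exists>i\<in>I. \<forall>\<^sub>F z in nhds a. f i z = 0"
proof (rule ccontr)
  assume *: "\<not> ?thesis"
  have "\<forall>\<^sub>F z in at a. \<forall>i\<in>I. f i z \<noteq> 0"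
    using assms(1) * assms(2)
    by (intro eventually_ball_finite) (auto intro!: analytic_germ_eventually_nonzero)
  then have "\<forall>\<^sub>F z in at a within S. \<forall>i\<in>I. f i z \<noteq> 0"
    by (meson at_le filter_leD subset_UNIV)
  then show False
    using assms(3) by (simp add: frequently_def)
qed

text \<open>The order of vanishing can be read off along any set that accumulates at the base point; below, this
  set is the real line, where the bound stems from the reality of the roots.\<close>

lemma analytic_germ_divide_power:
  assumes h: "h analytic_on {a}" and S: "at a within S \<noteq> bot"
    and bound: "\<forall>\<^sub>F s in at a within S. norm (h s) \<le> C * norm (s - a) ^ m"
  obtains d where "d analytic_on {a}" "\<forall>\<^sub>F s in nhds a. h s = (s - a) ^ m * d s"
proof (cases "\<forall>\<^sub>F z in nhds a. h z = 0")
  case True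
  then show ?thesis
    using that[of "\<lambda>_. 0"] by auto
next
  case False
  obtain k u where u: "u analytic_on {a}" "u a \<noteq> 0" "\<forall>\<^sub>F z in nhds a. h z = (z - a) ^ k * u z"
    using analytic_germ_factor[OF h False] .
  have "m \<le> k"
  proof (rule ccontr)
    assume km: "\<not> m \<le> k"
    have "\<forall>\<^sub>F s in at a within S. norm (u s) \<le> C * norm (s - a) ^ (m - k)"
    proof -
      have "\<forall>\<^sub>F s in at a within S. h s = (s - a) ^ k * u s"
        using u(3) by (auto simp: eventually_at_filter elim: eventually_mono)
      moreover have "\<forall>\<^sub>F s in at a within S. s \<noteq> a"
        by (simp add: eventually_at_filter)
      ultimately show ?thesis
        using bound
      proof eventually_elim
        case (elim s)
        have "norm (s - a) ^ k * norm (u s) \<le> C * norm (s - a) ^ m"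
          using elim by (simp add: norm_mult norm_power)
        also have "norm (s - a) ^ m = norm (s - a) ^ k * norm (s - a) ^ (m - k)"
          using km by (simp flip: power_add)
        finally show ?case
          using elim(2) by (simp add: mult.left_commute)
      qed
    qed
    moreover have "((\<lambda>s. norm (u s)) \<longlongrightarrow> norm (u a)) (at a within S)"
      using analytic_at_imp_isCont[OF u(1)]
      by (intro tendsto_norm) (auto simp: isCont_def intro: tendsto_mono[OF at_le[OF subset_UNIV]])
    moreover have "((\<lambda>s. C * norm (s - a) ^ (m - k)) \<longlongrightarrow> C * norm (a - a) ^ (m - k)) (at a within S)"
      by (intro tendsto_intros)
    ultimately have "norm (u a) \<le> C * norm (a - a) ^ (m - k)"
      using tendsto_le[OF S] by blast
    then show False
      using u(2) km by (simp add: power_0_left split: if_splits)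
  qed
  show ?thesis
  proof (rule that[of "\<lambda>s. (s - a) ^ (k - m) * u s"])
    show "(\<lambda>s. (s - a) ^ (k - m) * u s) analytic_on {a}"
      using u(1) by (intro analytic_intros)
    show "\<forall>\<^sub>F s in nhds a. h s = (s - a) ^ m * ((s - a) ^ (k - m) * u s)"
      using u(3) by eventually_elim (simp add: \<open>m \<le> k\<close> mult.assoc[symmetric] flip: power_add)
  qed
qed

section \<open>Monic polynomials with analytic coefficients\<close>

definition analytic_monic :: "complex set \<Rightarrow> nat \<Rightarrow> (complex \<Rightarrow> complex poly) \<Rightarrow> bool" where
  "analytic_monic S n a \<longleftrightarrow>
     (\<forall>s. degree (a s) = n \<and> lead_coeff (a s) = 1) \<and> (\<forall>k. (\<lambda>s. coeff (a s) k) analytic_on S)"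

lemma degree_div_field:
  fixes p q :: "'a::field poly"
  assumes "q \<noteq> 0"
  shows "degree (p div q) = degree p - degree q"
proof (cases "degree p < degree q")
  case True
  then show ?thesis
    by (auto simp: div_poly_less)
next
  case False
  show ?thesis
  proof (cases "p mod q = 0")
    case True
    then have p: "p = p div q * q"
      by (metis add.right_neutral div_mult_mod_eq)
    show ?thesis
    proof (cases "p div q = 0")
      case True
      then show ?thesis using p by auto
    next
      case False
      then have "degree p = degree (p div q) + degree q"
        using assms by (subst p) (simp add: degree_mult_eq)
      then show ?thesis by simp
    qed
  next
    case nz: False
    then have less: "degree (p mod q) < degree q"
      using assms degree_mod_less[of q p] by auto
    have "degree (p div q * q) = degree (p - p mod q)"
      by (simp add: minus_mod_eq_div_mult)
    also have "\<dots> = degree p"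
      using less False degree_add_eq_left[of "- (p mod q)" p] by simp
    finally have *: "degree (p div q * q) = degree p" .
    moreover have "p div q \<noteq> 0"
      using * less False by auto
    ultimately show ?thesis
      using assms by (simp add: degree_mult_eq)
  qed
qed

text \<open>For a monic divisor the coefficients of the quotient are determined from the top down by ring operations
  alone, which keeps them analytic.\<close>

lemma coeff_div_monic:
  fixes p q :: "'a::field poly"
  assumes "lead_coeff q = 1"
  shows "coeff (p div q) j =
           coeff p (degree q + j) - (\<Sum>i=1..degree p. coeff (p div q) (j + i) * coeff q (degree q - i) * of_bool (i \<le> degree q))"
proof -
  define N where "N = degree q"
  have q0: "q \<noteq> 0"
    using assms by auto
  have dd: "degree (p div q) \<le> degree p"
    using q0 by (simp add: degree_div_field)
  have "coeff p (N + j) = coeff (p div q * q) (N + j) + coeff (p mod q) (N + j)"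
    by (metis coeff_add div_mult_mod_eq)
  also have "coeff (p mod q) (N + j) = 0"
    using q0 degree_mod_less[of q p] unfolding N_def by (metis coeff_0 coeff_eq_0 trans_less_add1)
  also have "coeff (p div q * q) (N + j) = (\<Sum>i\<le>N + j. coeff (p div q) i * coeff q (N + j - i))"
    by (simp add: coeff_mult)
  also have "\<dots> = (\<Sum>i\<in>{j..N + j}. coeff (p div q) i * coeff q (N + j - i))"
    by (rule sum.mono_neutral_right) (auto simp: N_def intro!: coeff_eq_0)
  also have "\<dots> = (\<Sum>i\<in>{0..N}. coeff (p div q) (j + i) * coeff q (N - i))"
    by (rule sum.reindex_bij_witness[of _ "\<lambda>i. j + i" "\<lambda>i. i - j"]) auto
  also have "\<dots> = coeff (p div q) j + (\<Sum>i\<in>{1..N}. coeff (p div q) (j + i) * coeff q (N - i))"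
    using assms by (subst sum.atLeast_Suc_atMost) (simp_all add: N_def)
  also have "(\<Sum>i\<in>{1..N}. coeff (p div q) (j + i) * coeff q (N - i)) =
      (\<Sum>i\<in>{1..N} \<inter> {1..degree p}. coeff (p div q) (j + i) * coeff q (N - i))"
    by (rule sum.mono_neutral_right) (use dd in \<open>auto simp: N_def intro!: coeff_eq_0\<close>)
  also have "\<dots> = (\<Sum>i=1..degree p. coeff (p div q) (j + i) * coeff q (N - i) * of_bool (i \<le> N))"
    by (rule sum.mono_neutral_cong_left) auto
  finally show ?thesis
    by (simp add: N_def)
qed

lemma analytic_coeff_div:
  assumes b: "analytic_monic S N b"
    and a: "\<And>k. (\<lambda>s. coeff (a s) k) analytic_on S" "\<And>s. degree (a s) = n"
  shows "(\<lambda>s. coeff (a s div b s) j) analytic_on S"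
proof (induction "n - j" arbitrary: j rule: less_induct)
  case less
  have bs: "degree (b s) = N" "lead_coeff (b s) = 1" for s
    using b by (auto simp: analytic_monic_def)
  have b0: "b s \<noteq> 0" for s
    using bs(2)[of s] by auto
  show ?case
  proof (cases "j > n")
    case True
    have "coeff (a s div b s) j = 0" for s
      using True b0 by (intro coeff_eq_0) (auto simp: degree_div_field a)
    then show ?thesis
      by simp
  next
    case False
    have *: "(\<lambda>s. coeff (a s div b s) (j + i)) analytic_on S" if "i \<in> {1..n}" for i
    proof (cases "j = n")
      case True
      have "coeff (a s div b s) (j + i) = 0" for s
        using True that b0 by (intro coeff_eq_0) (auto simp: degree_div_field a)
      then show ?thesis
        by simp
    next
      case False
      with \<open>\<not> j > n\<close> show ?thesis
        using less that by auto
    qed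
    have "(\<lambda>s. coeff (a s) (N + j) -
        (\<Sum>i=1..n. coeff (a s div b s) (j + i) * coeff (b s) (N - i) * of_bool (i \<le> N))) analytic_on S"
      using b by (intro analytic_intros a * ) (auto simp: analytic_monic_def)
    moreover have "coeff (a s div b s) j = coeff (a s) (N + j) -
        (\<Sum>i=1..n. coeff (a s div b s) (j + i) * coeff (b s) (N - i) * of_bool (i \<le> N))" for s
      using coeff_div_monic[OF bs(2), of "a s" s j] by (simp only: bs(1) a(2))
    ultimately show ?thesis
      by simp
  qed
qed

lemma analytic_monic_div:
  assumes b: "analytic_monic S N b" and a: "analytic_monic S n a" and "N \<le> n"
  shows "analytic_monic S (n - N) (\<lambda>s. a s div b s)"
proof -
  have bs: "degree (b s) = N" "lead_coeff (b s) = 1" for s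
    using b by (auto simp: analytic_monic_def)
  have as: "degree (a s) = n" "lead_coeff (a s) = 1" for s
    using a by (auto simp: analytic_monic_def)
  have b0: "b s \<noteq> 0" for s
    using bs(2)[of s] by auto
  have "degree (a s div b s) = n - N" for s
    using b0 by (simp add: degree_div_field bs as)
  moreover have "coeff (a s div b s) (n - N) = 1" for s
  proof -
    have "coeff (a s div b s) (n - N + i) = 0" if "i \<in> {1..n}" for i
      using that b0 by (intro coeff_eq_0) (simp add: degree_div_field bs as)
    then show ?thesis
      using coeff_div_monic[of "b s" "a s" "n - N"] bs(1,2)[of s] as(1,2)[of s] assms(3)
      by simp
  qed
  ultimately show ?thesis
    using analytic_coeff_div[OF b, of a n] a unfolding analytic_monic_def by auto
qed

abbreviation roots_poly :: "complex multiset \<Rightarrow> complex poly" where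
  "roots_poly A \<equiv> \<Prod>r\<in>#A. [:-r, 1:]"

lemma roots_poly_monic: "lead_coeff (roots_poly A) = 1" "degree (roots_poly A) = size A"
proof -
  have "lead_coeff (roots_poly A) = 1 \<and> degree (roots_poly A) = size A"
  proof (induction A)
    case (add x A)
    have "roots_poly A \<noteq> 0" using add by auto
    then have "degree ([:-x, 1:] * roots_poly A) = Suc (size A)"
      using add by (subst degree_mult_eq) auto
    moreover have "lead_coeff ([:-x, 1:] * roots_poly A) = 1"
      using conjunct1[OF add] by (simp only: lead_coeff_mult) simp
    ultimately show ?case by (simp only: image_mset_add_mset prod_mset.add_mset size_add_mset)
  qed simp
  then show "lead_coeff (roots_poly A) = 1" "degree (roots_poly A) = size A" by auto
qed

lemma monic_eq_roots_poly:
  assumes "lead_coeff p = (1::complex)"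
  obtains A where "p = roots_poly A" "size A = degree p"
proof -
  have "p \<noteq> 0"
    using assms by auto
  then obtain A where "size A = degree p" "p = smult (lead_coeff p) (roots_poly A)"
    using alg_closed_imp_factorization by blast
  then show ?thesis
    using that[of A] assms by simp
qed

lemma poly_roots_poly: "poly (roots_poly A) x = (\<Prod>r\<in>#A. x - r)"
  by (induction A) (auto simp: algebra_simps)

lemma poly_roots_poly_eq_0_iff: "poly (roots_poly A) x = 0 \<longleftrightarrow> x \<in># A"
  by (auto simp: poly_roots_poly)

lemma synthetic_div_eq:
  fixes b :: "'a::idom poly"
  assumes "[:-r, 1:] * q = b"
  shows "synthetic_div b r = q"
proof -
  have "poly b r = 0"
    using assms by auto
  then have "[:-r, 1:] * synthetic_div b r = b"
    using synthetic_div_correct'[of r b] by simp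
  then show ?thesis
    using assms by (metis mult_cancel_left one_neq_zero pCons_eq_0_iff)
qed

lemma pderiv_roots_poly:
  "pderiv (roots_poly A) = (\<Sum>r\<in>#A. synthetic_div (roots_poly A) r)"
proof (induction A)
  case empty
  then show ?case by (simp add: pderiv_1)
next
  case (add x A)
  have x: "synthetic_div (roots_poly (add_mset x A)) x = roots_poly A"
    by (rule synthetic_div_eq) simp
  have r: "synthetic_div (roots_poly (add_mset x A)) r = [:-x, 1:] * synthetic_div (roots_poly A) r"
    if "r \<in># A" for r
  proof (rule synthetic_div_eq)
    have "[:-r, 1:] * synthetic_div (roots_poly A) r = roots_poly A"
      using synthetic_div_correct'[of r "roots_poly A"] that poly_roots_poly_eq_0_iff[of A r] by simp
    then show "[:-r, 1:] * ([:-x, 1:] * synthetic_div (roots_poly A) r) = roots_poly (add_mset x A)"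
      by (simp only: image_mset_add_mset prod_mset.add_mset mult.left_commute[of "[:-r,1:]"])
  qed
  have "pderiv (roots_poly (add_mset x A)) = roots_poly A + [:-x, 1:] * pderiv (roots_poly A)"
    by (simp only: image_mset_add_mset prod_mset.add_mset pderiv_mult) (simp add: pderiv_pCons)
  also have "[:-x, 1:] * pderiv (roots_poly A) =
      (\<Sum>r\<in>#A. [:-x, 1:] * synthetic_div (roots_poly A) r)"
    unfolding add by (simp only: sum_mset_distrib_left)
  also have "\<dots> = (\<Sum>r\<in>#A. synthetic_div (roots_poly (add_mset x A)) r)"
    using r by (intro arg_cong[of _ _ sum_mset] image_mset_cong) auto
  finally show ?case
    using x by simp
qed

lemma coeff_synthetic_div:
  fixes b :: "'a::comm_ring_1 poly"
  assumes "degree b \<le> N"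
  shows "coeff (synthetic_div b r) j = (\<Sum>i=Suc j..N. coeff b i * r ^ (i - Suc j))"
proof (induction "N - j" arbitrary: j)
  case 0
  have "coeff (synthetic_div b r) j = 0" if "N \<le> j"
  proof (cases "degree b = 0")
    case True then show ?thesis by (simp add: synthetic_div_eq_0_iff[THEN iffD2])
  next
    case False
    then show ?thesis
      using that assms by (intro coeff_eq_0) (auto simp: degree_synthetic_div)
  qed
  then show ?case using 0 by simp
next
  case (Suc d)
  have "coeff (b + smult r (synthetic_div b r)) (Suc j) = coeff (synthetic_div b r) j"
    by (simp add: synthetic_div_correct)
  then have "coeff (synthetic_div b r) j = coeff b (Suc j) + r * coeff (synthetic_div b r) (Suc j)"
    by simp
  also have "coeff (synthetic_div b r) (Suc j) = (\<Sum>i=Suc (Suc j)..N. coeff b i * r ^ (i - Suc (Suc j)))"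
    using Suc by auto
  also have "r * \<dots> = (\<Sum>i=Suc (Suc j)..N. coeff b i * r ^ (i - Suc j))"
    unfolding sum_distrib_left
    by (intro sum.cong refl) (auto simp: le_iff_add)
  finally show ?case
    using Suc(2) by (simp add: sum.atLeast_Suc_atMost)
qed

lemma sum_mset_sum_swap: "(\<Sum>r\<in>#A. \<Sum>i\<in>I. f i r) = (\<Sum>i\<in>I. \<Sum>r\<in>#A. f i r)"
  by (induction A) (auto simp: sum.distrib)

text \<open>The coefficients of the derivative are compared in the product rule
  \<open>p' = \<Sum> p / (x - r)\<close>, the sum being over the roots \<open>r\<close> of \<open>p\<close>.\<close>

lemma newton_identities:
  assumes "k \<le> size A"
  shows "of_nat k * coeff (roots_poly A) k =
           (\<Sum>i=k..size A. coeff (roots_poly A) i * (\<Sum>r\<in>#A. r ^ (i - k)))"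
proof -
  define b where "b = roots_poly A"
  have deg: "degree b \<le> size A"
    by (simp add: b_def roots_poly_monic)
  show ?thesis
  proof (cases k)
    case 0
    have "(\<Sum>i=0..size A. coeff b i * (\<Sum>r\<in>#A. r ^ i)) = (\<Sum>r\<in>#A. \<Sum>i=0..size A. coeff b i * r ^ i)"
      by (simp add: sum_mset_sum_swap sum_mset_distrib_left)
    also have "\<dots> = (\<Sum>r\<in>#A. poly b r)"
      using roots_poly_monic(2)[of A] unfolding poly_altdef b_def by (simp add: atLeast0AtMost)
    also have "\<dots> = (\<Sum>r\<in>#A. 0)"
      by (intro arg_cong[of _ _ sum_mset] image_mset_cong) (simp add: b_def poly_roots_poly_eq_0_iff)
    finally show ?thesis
      by (simp add: 0 b_def)
  next
    case (Suc j)
    have "of_nat k * coeff b k = coeff (pderiv b) j"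
      by (simp add: coeff_pderiv Suc)
    also have "\<dots> = (\<Sum>r\<in>#A. coeff (synthetic_div b r) j)"
    proof -
      have "coeff (\<Sum>r\<in>#B. synthetic_div b r) j = (\<Sum>r\<in>#B. coeff (synthetic_div b r) j)" for B
        by (induction B) auto
      then show ?thesis
        using pderiv_roots_poly[of A] by (simp add: b_def)
    qed
    also have "\<dots> = (\<Sum>r\<in>#A. \<Sum>i=k..size A. coeff b i * r ^ (i - k))"
      using deg by (simp add: coeff_synthetic_div Suc)
    also have "\<dots> = (\<Sum>i=k..size A. coeff b i * (\<Sum>r\<in>#A. r ^ (i - k)))"
      by (simp add: sum_mset_sum_swap sum_mset_distrib_left)
    finally show ?thesis
      by (simp add: b_def)
  qed
qed

text \<open>Single roots need not depend analytically on the parameter, but their power sums are contour integrals.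
  Newton's identities recover the coefficients from them.\<close>

lemma analytic_coeff_of_power_sums:
  assumes size: "\<And>s. size (A s) = N"
    and ps: "\<And>k. (\<lambda>s. \<Sum>r\<in>#A s. r ^ k) analytic_on S"
  shows "(\<lambda>s. coeff (roots_poly (A s)) k) analytic_on S"
proof (induction "N - k" arbitrary: k rule: less_induct)
  case less
  consider "k > N" | "k = N" | "k < N" by linarith
  then show ?case
  proof cases
    case 1
    then have "coeff (roots_poly (A s)) k = 0" for s
      by (intro coeff_eq_0) (simp add: roots_poly_monic size)
    then show ?thesis by simp
  next
    case 2
    then have "coeff (roots_poly (A s)) k = 1" for s
      using roots_poly_monic[of "A s"] size[of s] by simp
    then show ?thesis by simp
  next
    case 3
    have eq: "coeff (roots_poly (A s)) k =
        (\<Sum>i=Suc k..N. coeff (roots_poly (A s)) i * (\<Sum>r\<in>#A s. r ^ (i - k))) / (of_nat k - of_nat N)" for s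
    proof -
      let ?c = "coeff (roots_poly (A s))"
      have "of_nat k * ?c k = (\<Sum>i=k..N. ?c i * (\<Sum>r\<in>#A s. r ^ (i - k)))"
        using newton_identities[of k "A s"] 3 size by simp
      also have "\<dots> = ?c k * of_nat N + (\<Sum>i=Suc k..N. ?c i * (\<Sum>r\<in>#A s. r ^ (i - k)))"
        using 3 size by (subst sum.atLeast_Suc_atMost) simp_all
      finally have "(of_nat k - of_nat N) * ?c k = (\<Sum>i=Suc k..N. ?c i * (\<Sum>r\<in>#A s. r ^ (i - k)))"
        by (simp add: algebra_simps)
      moreover have "(of_nat k - of_nat N :: complex) \<noteq> 0"
        using 3 by simp
      ultimately show ?thesis
        by (simp add: field_simps)
    qed
    have "(\<lambda>s. coeff (roots_poly (A s)) i) analytic_on S" if "i \<in> {Suc k..N}" for i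
      using that 3 by (intro less) auto
    then have "(\<lambda>s. (\<Sum>i=Suc k..N. coeff (roots_poly (A s)) i * (\<Sum>r\<in>#A s. r ^ (i - k))) / (of_nat k - of_nat N)) analytic_on S"
      using 3 ps by (intro analytic_intros) auto
    then show ?thesis
      by (subst eq)
  qed
qed

definition analytic_coeffs :: "complex set \<Rightarrow> (complex \<Rightarrow> complex poly) \<Rightarrow> bool" where
  "analytic_coeffs S a \<longleftrightarrow> (\<forall>k. (\<lambda>s. coeff (a s) k) analytic_on S)"

lemma analytic_coeffs_const: "analytic_coeffs S (\<lambda>_. p)"
  by (simp add: analytic_coeffs_def)

lemma analytic_coeffs_add:
  "analytic_coeffs S a \<Longrightarrow> analytic_coeffs S b \<Longrightarrow> analytic_coeffs S (\<lambda>s. a s + b s)"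
  by (auto simp: analytic_coeffs_def intro: analytic_intros)

lemma analytic_coeffs_mult:
  "analytic_coeffs S a \<Longrightarrow> analytic_coeffs S b \<Longrightarrow> analytic_coeffs S (\<lambda>s. a s * b s)"
  by (auto simp: analytic_coeffs_def coeff_mult intro!: analytic_intros)

lemma analytic_coeffs_sum:
  "(\<And>i. i \<in> I \<Longrightarrow> analytic_coeffs S (a i)) \<Longrightarrow> analytic_coeffs S (\<lambda>s. \<Sum>i\<in>I. a i s)"
  by (induction I rule: infinite_finite_induct) (auto intro: analytic_coeffs_add analytic_coeffs_const)

lemma analytic_coeffs_prod:
  "(\<And>i. i \<in> I \<Longrightarrow> analytic_coeffs S (a i)) \<Longrightarrow> analytic_coeffs S (\<lambda>s. \<Prod>i\<in>I. a i s)"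
  by (induction I rule: infinite_finite_induct) (auto intro: analytic_coeffs_mult analytic_coeffs_const)

lemma analytic_coeffs_power:
  "analytic_coeffs S a \<Longrightarrow> analytic_coeffs S (\<lambda>s. a s ^ n)"
  by (induction n) (auto intro: analytic_coeffs_mult analytic_coeffs_const)

lemma analytic_coeffs_linear:
  assumes "c analytic_on S" "d analytic_on S"
  shows "analytic_coeffs S (\<lambda>s. [:c s, d s:])"
  unfolding analytic_coeffs_def
proof
  fix k
  show "(\<lambda>s. coeff [:c s, d s:] k) analytic_on S"
    using assms by (cases k; cases "k - 1") (auto simp: coeff_pCons)
qed

lemma analytic_coeffs_smult:
  "c analytic_on S \<Longrightarrow> analytic_coeffs S a \<Longrightarrow> analytic_coeffs S (\<lambda>s. smult (c s) (a s))"
  by (auto simp: analytic_coeffs_def intro!: analytic_intros)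

lemma analytic_monic_iff:
  "analytic_monic S n a \<longleftrightarrow> (\<forall>s. degree (a s) = n \<and> lead_coeff (a s) = 1) \<and> analytic_coeffs S a"
  by (simp add: analytic_monic_def analytic_coeffs_def)

lemma pcompose_eq_sum:
  fixes p q :: "'a::comm_ring_1 poly"
  assumes "degree p \<le> n"
  shows "pcompose p q = (\<Sum>i\<le>n. smult (coeff p i) (q ^ i))"
proof -
  have "pcompose p q = pcompose (\<Sum>i\<le>n. monom (coeff p i) i) q"
    using assms by (simp add: poly_as_sum_of_monoms')
  also have "\<dots> = (\<Sum>i\<le>n. pcompose (monom (coeff p i) i) q)"
    by (simp add: pcompose_sum)
  also have "\<dots> = (\<Sum>i\<le>n. smult (coeff p i) (q ^ i))"
  proof (rule sum.cong[OF refl])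
    fix i
    have "pcompose ([:0, 1:] ^ i) q = q ^ i"
      by (induction i) (simp_all add: pcompose_mult pcompose_pCons pcompose_1 del: mult_pCons_left)
    then show "pcompose (monom (coeff p i) i) q = smult (coeff p i) (q ^ i)"
      by (simp add: monom_altdef pcompose_smult)
  qed
  finally show ?thesis .
qed

lemma linear_prod_monic:
  "degree (\<Prod>j<n. [:-c j, 1:] :: complex poly) = n \<and> lead_coeff (\<Prod>j<n. [:-c j, 1:] :: complex poly) = 1"
proof -
  have "lead_coeff (\<Prod>j<n. [:-c j, 1:] :: complex poly) = 1"
    by (simp add: lead_coeff_prod)
  moreover have "degree (\<Prod>j<n. [:-c j, 1:] :: complex poly) = (\<Sum>j<n. degree [:-c j, 1:])"
    by (rule degree_prod_eq_sum_degree) auto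
  ultimately show ?thesis by simp
qed

lemma analytic_monic_linear_prod:
  assumes "\<And>j. j < n \<Longrightarrow> c j analytic_on S"
  shows "analytic_monic S n (\<lambda>s. \<Prod>j<n. [:-c j s, 1:])"
  unfolding analytic_monic_iff
proof (rule conjI)
  show "analytic_coeffs S (\<lambda>s. \<Prod>j<n. [:-c j s, 1:])"
    using assms by (auto intro!: analytic_coeffs_prod analytic_coeffs_linear analytic_intros)
  show "\<forall>s. degree (\<Prod>j<n. [:-c j s, 1:]) = n \<and> lead_coeff (\<Prod>j<n. [:-c j s, 1:]) = 1"
    by (rule allI) (rule linear_prod_monic)
qed

lemma analytic_monic_identity:
  assumes a: "analytic_monic {z} n a" and b: "analytic_monic {z} n b"
    and S: "at z within S \<noteq> bot" and eq: "\<forall>\<^sub>F s in at z within S. a s = b s"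
  shows "\<forall>\<^sub>F s in nhds z. a s = b s"
proof -
  have "\<forall>\<^sub>F s in nhds z. coeff (a s) k - coeff (b s) k = 0" for k
  proof (rule analytic_germ_identity[where S = S])
    show "(\<lambda>s. coeff (a s) k - coeff (b s) k) analytic_on {z}"
      using a b by (auto simp: analytic_monic_def intro!: analytic_intros)
    show "\<exists>\<^sub>F s in at z within S. coeff (a s) k - coeff (b s) k = 0"
      using eq by (intro eventually_frequently[OF S]) (auto elim: eventually_mono)
  qed
  then have "\<forall>\<^sub>F s in nhds z. \<forall>k\<in>{..n}. coeff (a s) k - coeff (b s) k = 0"
    by (intro eventually_ball_finite) auto
  then show ?thesis
  proof eventually_elim
    case (elim s)
    have "degree (a s) = n" "degree (b s) = n"
      using a b by (auto simp: analytic_monic_def)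
    then have "coeff (a s) k = coeff (b s) k" for k
      using elim by (cases "k \<le> n") (auto simp: coeff_eq_0)
    then show ?case
      by (simp add: poly_eq_iff)
  qed
qed

section \<open>Splitting off a cluster of roots\<close>

text \<open>Differentiation under the integral sign.\<close>

lemma holomorphic_contour_integral_quotient:
  fixes \<alpha> \<beta> :: "nat \<Rightarrow> complex \<Rightarrow> complex"
  assumes U: "open U" "convex U"
    and \<alpha>: "\<And>i. i \<le> m \<Longrightarrow> \<alpha> i holomorphic_on U" and \<beta>: "\<And>i. i \<le> n \<Longrightarrow> \<beta> i holomorphic_on U"
    and nz: "\<And>s x. s \<in> U \<Longrightarrow> x \<in> sphere c \<rho> \<Longrightarrow> (\<Sum>i\<le>n. \<beta> i s * x ^ i) \<noteq> 0" and \<rho>: "\<rho> > 0"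
  shows "(\<lambda>s. contour_integral (circlepath c \<rho>)
            (\<lambda>x. (\<Sum>i\<le>m. \<alpha> i s * x ^ i) / (\<Sum>i\<le>n. \<beta> i s * x ^ i))) holomorphic_on U"
proof -
  define g where "g = circlepath c \<rho>"
  define w :: "real \<Rightarrow> complex" where "w t = 2 * of_real pi * \<i> * of_real \<rho> * exp (2 * of_real pi * \<i> * of_real t)" for t
  define p where "p s x = (\<Sum>i\<le>m. \<alpha> i s * x ^ i)" for s x
  define q where "q s x = (\<Sum>i\<le>n. \<beta> i s * x ^ i)" for s x
  define p' where "p' s x = (\<Sum>i\<le>m. deriv (\<alpha> i) s * x ^ i)" for s x
  define q' where "q' s x = (\<Sum>i\<le>n. deriv (\<beta> i) s * x ^ i)" for s x
  have gs: "g t \<in> sphere c \<rho>" if "t \<in> {0..1}" for t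
    using that \<rho> path_image_circlepath_nonneg[of \<rho> c] unfolding g_def path_image_def by (metis imageI less_imp_le)
  have cg: "continuous_on {0..1} g"
    using path_circlepath[of c \<rho>] by (simp add: g_def path_def)
  have nz': "q s (g t) \<noteq> 0" if "s \<in> U" "t \<in> {0..1}" for s t
    using nz gs that unfolding q_def by blast
  have fst_in: "fst ` (U \<times> {0..1::real}) \<subseteq> U" and snd_in: "snd ` (U \<times> {0..1::real}) \<subseteq> {0..1}"
    by auto
  have c_fst: "continuous_on (U \<times> {0..1::real}) (\<lambda>z. h (fst z))" if "h holomorphic_on U" for h
    using holomorphic_on_imp_continuous_on[OF that]
    by (intro continuous_on_compose2[OF _ continuous_on_fst[OF continuous_on_id] fst_in])
  have c_snd: "continuous_on (U \<times> {0..1::real}) (\<lambda>z. g (snd z))"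
    by (intro continuous_on_compose2[OF cg continuous_on_snd[OF continuous_on_id] snd_in])
  have cont: "continuous_on (U \<times> {0..1}) (\<lambda>z. p (fst z) (g (snd z)))"
    "continuous_on (U \<times> {0..1}) (\<lambda>z. q (fst z) (g (snd z)))"
    "continuous_on (U \<times> {0..1}) (\<lambda>z. p' (fst z) (g (snd z)))"
    "continuous_on (U \<times> {0..1}) (\<lambda>z. q' (fst z) (g (snd z)))"
    unfolding p_def q_def p'_def q'_def using \<alpha> \<beta> holomorphic_deriv[OF _ U(1)]
    by (auto intro!: continuous_intros c_fst c_snd)
  have "(\<lambda>s. integral (cbox 0 1) (\<lambda>t. p s (g t) / q s (g t) * w t)) holomorphic_on U"
  proof (rule leibniz_rule_holomorphic)
    show "((\<lambda>s. p s (g t) / q s (g t) * w t) has_field_derivative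
        (p' s (g t) * q s (g t) - p s (g t) * q' s (g t)) / (q s (g t) * q s (g t)) * w t) (at s within U)"
      if "s \<in> U" "t \<in> cbox 0 1" for s t
    proof -
      have "(\<alpha> i has_field_derivative deriv (\<alpha> i) s) (at s within U)" if "i \<le> m" for i
        using holomorphic_derivI[OF \<alpha>[OF that] U(1) \<open>s \<in> U\<close>] by (simp add: has_field_derivative_at_within)
      moreover have "(\<beta> i has_field_derivative deriv (\<beta> i) s) (at s within U)" if "i \<le> n" for i
        using holomorphic_derivI[OF \<beta>[OF that] U(1) \<open>s \<in> U\<close>] by (simp add: has_field_derivative_at_within)
      ultimately have "((\<lambda>s. p s (g t)) has_field_derivative p' s (g t)) (at s within U)"
        "((\<lambda>s. q s (g t)) has_field_derivative q' s (g t)) (at s within U)"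
        unfolding p_def q_def p'_def q'_def by (auto intro!: DERIV_sum DERIV_cmult_right)
      then show ?thesis
        using nz' that by (intro DERIV_cmult_right DERIV_divide) auto
    qed
    show "(\<lambda>t. p s (g t) / q s (g t) * w t) integrable_on cbox 0 1" if "s \<in> U" for s
      unfolding p_def q_def w_def using that cg nz'[unfolded q_def]
      by (intro integrable_continuous continuous_intros) auto
    show "continuous_on (U \<times> cbox 0 1)
      (\<lambda>(s, t). (p' s (g t) * q s (g t) - p s (g t) * q' s (g t)) / (q s (g t) * q s (g t)) * w t)"
      unfolding case_prod_unfold w_def using cont nz'
      by (intro continuous_intros) auto
  qed fact
  moreover have "contour_integral g (\<lambda>x. p s x / q s x) = integral (cbox 0 1) (\<lambda>t. p s (g t) / q s (g t) * w t)" for s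
    unfolding contour_integral_integral
    by (simp add: g_def w_def vector_derivative_circlepath)
  ultimately show ?thesis
    by (simp add: p_def q_def g_def)
qed

lemma has_contour_integral_power_sum:
  assumes \<rho>: "\<rho> > 0" and off: "\<And>r. r \<in># A \<Longrightarrow> dist c r \<noteq> \<rho>"
  shows "((\<lambda>x. x ^ k * (\<Sum>r\<in>#A. 1 / (x - r))) has_contour_integral
           2 * of_real pi * \<i> * (\<Sum>r\<in>#filter_mset (\<lambda>r. dist c r < \<rho>) A. r ^ k)) (circlepath c \<rho>)"
  using off
proof (induction A)
  case empty
  then show ?case using has_contour_integral_0 by simp
next
  case (add r A)
  have "((\<lambda>x. x ^ k / (x - r)) has_contour_integral
      (if dist c r < \<rho> then 2 * of_real pi * \<i> * r ^ k else 0)) (circlepath c \<rho>)"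
  proof (cases "dist c r < \<rho>")
    case True
    then show ?thesis
      using Cauchy_integral_circlepath[of c \<rho> "\<lambda>x. x ^ k" r]
      by (simp add: dist_norm norm_minus_commute continuous_intros holomorphic_intros)
  next
    case False
    then have "dist c r > \<rho>"
      using add.prems[of r] by auto
    moreover have "((\<lambda>x. x ^ k / (x - r)) has_contour_integral 0) (circlepath c \<rho>)"
      using calculation \<rho>
      by (intro Cauchy_theorem_convex_simple[of _ "cball c \<rho>"] holomorphic_intros) auto
    ultimately show ?thesis
      by simp
  qed
  moreover have "((\<lambda>x. x ^ k * (\<Sum>r\<in>#A. 1 / (x - r))) has_contour_integral
      2 * of_real pi * \<i> * (\<Sum>r\<in>#filter_mset (\<lambda>r. dist c r < \<rho>) A. r ^ k)) (circlepath c \<rho>)"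
    using add by auto
  ultimately show ?case
    using has_contour_integral_add by (force simp: ring_distribs)
qed

lemma log_derivative_roots_poly:
  assumes "x \<notin># A"
  shows "poly (pderiv (roots_poly A)) x / poly (roots_poly A) x = (\<Sum>r\<in>#A. 1 / (x - r))"
proof -
  have nz: "poly (roots_poly A) x \<noteq> 0"
    using assms by (simp add: poly_roots_poly_eq_0_iff)
  have "poly (synthetic_div (roots_poly A) r) x = poly (roots_poly A) x * (1 / (x - r))" if "r \<in># A" for r
  proof -
    have "[:-r, 1:] * synthetic_div (roots_poly A) r = roots_poly A"
      using synthetic_div_correct'[of r "roots_poly A"] that poly_roots_poly_eq_0_iff[of A r] by simp
    then have "(x - r) * poly (synthetic_div (roots_poly A) r) x = poly (roots_poly A) x"
      by (metis (no_types, lifting) poly_mult poly_pCons poly_0 mult.right_neutral add.right_neutral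
          mult_zero_right add.commute diff_conv_add_uminus)
    moreover have "x \<noteq> r"
      using that assms by auto
    ultimately show ?thesis
      by (simp add: field_simps)
  qed
  then have "(\<Sum>r\<in>#A. poly (synthetic_div (roots_poly A) r) x) = (\<Sum>r\<in>#A. poly (roots_poly A) x * (1 / (x - r)))"
    by (intro arg_cong[of _ _ sum_mset] image_mset_cong) auto
  moreover have "poly (\<Sum>r\<in>#B. synthetic_div b r) x = (\<Sum>r\<in>#B. poly (synthetic_div b r) x)" for B b
    by (induction B) auto
  ultimately have "poly (pderiv (roots_poly A)) x = (\<Sum>r\<in>#A. poly (roots_poly A) x * (1 / (x - r)))"
    by (simp add: pderiv_roots_poly)
  also have "\<dots> = poly (roots_poly A) x * (\<Sum>r\<in>#A. 1 / (x - r))"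
    by (simp only: sum_mset_distrib_left)
  finally show ?thesis
    using nz by simp
qed

lemma analytic_common_ball:
  assumes "\<And>k. k \<le> (n::nat) \<Longrightarrow> f k analytic_on {z::complex}"
  obtains \<delta> where "\<delta> > 0" "\<And>k. k \<le> n \<Longrightarrow> f k holomorphic_on ball z \<delta>"
proof -
  have "\<forall>k. \<exists>e>0. k \<le> n \<longrightarrow> f k holomorphic_on ball z e"
    using assms analytic_at_ball by (metis zero_less_one)
  then obtain e where e: "\<And>k. e k > 0" "\<And>k. k \<le> n \<Longrightarrow> f k holomorphic_on ball z (e k)"
    by metis
  show ?thesis
  proof (rule that[of "Min (e ` {..n})"])
    show "Min (e ` {..n}) > 0"
      using e(1) by (subst Min_gr_iff) auto
    fix k assume "k \<le> n"
    then have "Min (e ` {..n}) \<le> e k"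
      by (intro Min_le) auto
    then show "f k holomorphic_on ball z (Min (e ` {..n}))"
      using e(2)[OF \<open>k \<le> n\<close>] subset_ball holomorphic_on_subset by blast
  qed
qed

lemma roots_stay_off_sphere:
  assumes a: "analytic_monic {z} n a" and \<rho>: "\<rho> > 0"
    and off: "\<And>x. x \<in> sphere c \<rho> \<Longrightarrow> poly (a z) x \<noteq> 0"
  shows "\<forall>\<^sub>F s in nhds z. \<forall>x\<in>sphere c \<rho>. poly (a s) x \<noteq> 0"
proof -
  have "continuous_on (sphere c \<rho>) (\<lambda>x. norm (poly (a z) x))"
    by (intro continuous_intros)
  moreover have "sphere c \<rho> \<noteq> {}"
    using \<rho> by simp
  ultimately obtain x0 where x0: "x0 \<in> sphere c \<rho>"
      "\<And>x. x \<in> sphere c \<rho> \<Longrightarrow> norm (poly (a z) x0) \<le> norm (poly (a z) x)"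
    using continuous_attains_inf[of "sphere c \<rho>"] by (metis compact_sphere)
  define M where "M = norm (poly (a z) x0)"
  have M: "M > 0"
    using off[OF x0(1)] by (simp add: M_def)
  define R where "R = norm c + \<rho>"
  define E where "E s = (\<Sum>k\<le>n. norm (coeff (a s) k - coeff (a z) k) * R ^ k)" for s
  have deg: "degree (a s) = n" for s
    using a by (simp add: analytic_monic_def)
  have "isCont (\<lambda>s. coeff (a s) k) z" for k
    using a by (intro analytic_at_imp_isCont) (simp add: analytic_monic_def)
  then have "isCont E z"
    unfolding E_def by (intro continuous_intros)
  moreover have "E z = 0"
    by (simp add: E_def)
  ultimately have "(E \<longlongrightarrow> 0) (nhds z)"
    using tendsto_at_iff_tendsto_nhds[of E z] by (simp add: isCont_def)
  then have "\<forall>\<^sub>F s in nhds z. E s < M"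
    using M by (simp add: order_tendstoD)
  then show ?thesis
  proof eventually_elim
    case (elim s)
    show ?case
    proof
      fix x assume x: "x \<in> sphere c \<rho>"
      then have xR: "norm x \<le> R"
        using norm_triangle_ineq[of "x - c" c] by (simp add: R_def dist_norm norm_minus_commute)
      have "poly (a s) x - poly (a z) x = (\<Sum>k\<le>n. (coeff (a s) k - coeff (a z) k) * x ^ k)"
        by (simp add: poly_altdef deg algebra_simps sum_subtractf)
      also have "norm \<dots> \<le> E s"
        unfolding E_def using xR
        by (intro sum_norm_le) (auto simp: norm_mult norm_power intro!: mult_left_mono power_mono)
      finally have "norm (poly (a s) x - poly (a z) x) < M"
        using elim by simp
      moreover have "M \<le> norm (poly (a z) x)"
        using x0 x by (simp add: M_def)
      ultimately show "poly (a s) x \<noteq> 0"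
        by auto
    qed
  qed
qed

text \<open>The argument principle, weighted by \<open>x\<^sup>k\<close>: the contour integral of \<open>x\<^sup>k p'(x) / p(x)\<close> is the \<open>k\<close>-th power
  sum of the roots inside the circle, and it depends analytically on the parameter as long as no root meets the
  circle. So the factor that collects the inner roots has analytic coefficients.\<close>

lemma analytic_monic_split_disc:
  assumes a: "analytic_monic {z} n a" and \<rho>: "\<rho> > 0"
    and off: "\<And>x. x \<in> sphere c \<rho> \<Longrightarrow> poly (a z) x \<noteq> 0"
    and in_root: "poly (a z) x1 = 0" "dist c x1 < \<rho>"
    and out_root: "poly (a z) x2 = 0" "\<rho> < dist c x2"
  obtains N b q where "0 < N" "N < n" "analytic_monic {z} N b" "analytic_monic {z} (n - N) q"
    "\<forall>\<^sub>F s in nhds z. a s = b s * q s"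
proof -
  have deg: "degree (a s) = n" and lc: "lead_coeff (a s) = 1" for s
    using a unfolding analytic_monic_def by blast+
  have "(\<lambda>s. coeff (a s) k) analytic_on {z}" if "k \<le> n" for k
    using a by (simp add: analytic_monic_def)
  then obtain \<delta>0 where \<delta>0: "\<delta>0 > 0" "\<And>k. k \<le> n \<Longrightarrow> (\<lambda>s. coeff (a s) k) holomorphic_on ball z \<delta>0"
    using analytic_common_ball[of n "\<lambda>k s. coeff (a s) k" z] by blast
  obtain \<delta>1 where \<delta>1: "\<delta>1 > 0" "\<And>s x. dist s z < \<delta>1 \<Longrightarrow> x \<in> sphere c \<rho> \<Longrightarrow> poly (a s) x \<noteq> 0"
    using roots_stay_off_sphere[OF a \<rho> off] unfolding eventually_nhds_metric by blast
  define U where "U = ball z (min \<delta>0 \<delta>1)"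
  have U: "open U" "convex U" "connected U" "z \<in> U"
    using \<delta>0(1) \<delta>1(1) by (auto simp: U_def)
  have hol: "(\<lambda>s. coeff (a s) k) holomorphic_on U" if "k \<le> n" for k
    using \<delta>0(2)[OF that] by (rule holomorphic_on_subset) (auto simp: U_def)
  have nz: "poly (a s) x \<noteq> 0" if "s \<in> U" "x \<in> sphere c \<rho>" for s x
    using \<delta>1(2) that by (auto simp: U_def dist_commute)
  have "\<exists>A. a s = roots_poly A \<and> size A = n" for s
    using monic_eq_roots_poly[OF lc[of s]] deg[of s] by metis
  then obtain A where A: "\<And>s. a s = roots_poly (A s)" "\<And>s. size (A s) = n"
    by metis
  define B where "B s = filter_mset (\<lambda>r. dist c r < \<rho>) (A s)" for s
  define I where "I k s = contour_integral (circlepath c \<rho>) (\<lambda>x. x ^ k * poly (pderiv (a s)) x / poly (a s) x)" for k s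
  have power_sum: "I k s = 2 * of_real pi * \<i> * (\<Sum>r\<in>#B s. r ^ k)" if "s \<in> U" for k s
  proof -
    have offA: "dist c r \<noteq> \<rho>" if "r \<in># A s" for r
    proof -
      have "poly (a s) r = 0"
        using that by (simp add: A poly_roots_poly_eq_0_iff)
      then show ?thesis
        using nz[OF \<open>s \<in> U\<close>, of r] by auto
    qed
    have "I k s = contour_integral (circlepath c \<rho>) (\<lambda>x. x ^ k * (\<Sum>r\<in>#A s. 1 / (x - r)))"
      unfolding I_def
    proof (rule contour_integral_cong[OF refl])
      fix x assume "x \<in> path_image (circlepath c \<rho>)"
      then have "x \<in> sphere c \<rho>"
        using \<rho> by simp
      then have "x \<notin># A s"
        using nz[OF that] by (simp add: A poly_roots_poly_eq_0_iff)
      then show "x ^ k * poly (pderiv (a s)) x / poly (a s) x = x ^ k * (\<Sum>r\<in>#A s. 1 / (x - r))"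
        using log_derivative_roots_poly[of x "A s"] unfolding A by (metis times_divide_eq_right)
    qed
    also have "\<dots> = 2 * of_real pi * \<i> * (\<Sum>r\<in>#B s. r ^ k)"
      unfolding B_def by (intro contour_integral_unique has_contour_integral_power_sum \<rho> offA)
    finally show ?thesis .
  qed
  have I_hol: "I k holomorphic_on U" for k
  proof -
    define \<alpha> where "\<alpha> i s = (if i < k then 0 else of_nat (Suc (i - k)) * coeff (a s) (Suc (i - k)))" for i s
    have eq: "x ^ k * poly (pderiv (a s)) x = (\<Sum>i\<le>n + k. \<alpha> i s * x ^ i)" for s x
    proof -
      have "poly (pderiv (a s)) x = (\<Sum>i\<le>n. coeff (pderiv (a s)) i * x ^ i)"
        unfolding poly_altdef by (rule sum.mono_neutral_left) (auto simp: degree_pderiv deg coeff_eq_0)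
      then have "x ^ k * poly (pderiv (a s)) x = (\<Sum>i\<le>n. of_nat (Suc i) * coeff (a s) (Suc i) * x ^ (i + k))"
        by (simp add: sum_distrib_left coeff_pderiv power_add mult_ac)
      also have "\<dots> = (\<Sum>i\<in>{k..n + k}. \<alpha> i s * x ^ i)"
        by (rule sum.reindex_bij_witness[of _ "\<lambda>i. i - k" "\<lambda>i. i + k"]) (auto simp: \<alpha>_def)
      also have "\<dots> = (\<Sum>i\<le>n + k. \<alpha> i s * x ^ i)"
        by (rule sum.mono_neutral_left) (auto simp: \<alpha>_def)
      finally show ?thesis .
    qed
    have "\<alpha> i holomorphic_on U" if "i \<le> n + k" for i
    proof (cases "i < k \<or> Suc (i - k) > n")
      case True
      then have "\<alpha> i = (\<lambda>_. 0)"
        by (auto simp: \<alpha>_def fun_eq_iff coeff_eq_0 deg)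
      then show ?thesis by simp
    next
      case False
      then show ?thesis
        unfolding \<alpha>_def by (auto intro!: holomorphic_intros hol)
    qed
    then have "(\<lambda>s. contour_integral (circlepath c \<rho>)
            (\<lambda>x. (\<Sum>i\<le>n + k. \<alpha> i s * x ^ i) / (\<Sum>i\<le>n. coeff (a s) i * x ^ i))) holomorphic_on U"
      using nz by (intro holomorphic_contour_integral_quotient U hol \<rho>) (auto simp: poly_altdef deg)
    then show ?thesis
      unfolding I_def eq by (simp add: poly_altdef deg)
  qed
  \<comment> \<open>The power sum of exponent zero counts the roots in the disc: it is continuous and
    integer-valued, hence constant.\<close>
  define N where "N = size (B z)"
  have sizeB: "size (B s) = N" if "s \<in> U" for s
  proof -
    have const: "(\<lambda>s. of_nat (size (B s)) :: complex) constant_on U"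
    proof (rule continuous_discrete_range_constant[OF U(3)])
      have "continuous_on U (\<lambda>s. I 0 s / (2 * of_real pi * \<i>))"
        by (intro continuous_intros holomorphic_on_imp_continuous_on I_hol) simp
      then show "continuous_on U (\<lambda>s. of_nat (size (B s)) :: complex)"
        by (rule continuous_on_eq) (simp add: power_sum)
      fix s assume "s \<in> U"
      show "\<exists>e>0. \<forall>y. y \<in> U \<and> of_nat (size (B y)) \<noteq> (of_nat (size (B s)) :: complex) \<longrightarrow>
          e \<le> norm (of_nat (size (B y)) - of_nat (size (B s)) :: complex)"
      proof (intro exI[of _ 1] conjI allI impI)
        fix y assume y: "y \<in> U \<and> of_nat (size (B y)) \<noteq> (of_nat (size (B s)) :: complex)"
        have "of_nat (size (B y)) - of_nat (size (B s)) = (of_int (int (size (B y)) - int (size (B s))) :: complex)"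
          by simp
        moreover have "1 \<le> \<bar>int (size (B y)) - int (size (B s))\<bar>"
          using y by auto
        ultimately show "1 \<le> norm (of_nat (size (B y)) - of_nat (size (B s)) :: complex)"
          by (metis norm_of_int of_int_abs of_int_1_le_iff)
      qed simp
    qed
    then obtain w :: complex where "\<And>s. s \<in> U \<Longrightarrow> of_nat (size (B s)) = w"
      unfolding constant_on_def by blast
    then have "of_nat (size (B s)) = (of_nat (size (B z)) :: complex)"
      using that U(4) by metis
    then show ?thesis
      by (simp add: N_def)
  qed
  have "x1 \<in># B z"
    using in_root by (simp add: B_def A(1) poly_roots_poly_eq_0_iff)
  then have N0: "0 < N"
    unfolding N_def using nonempty_has_size by fastforce
  have "B z \<subset># A z"
  proof -
    have "x2 \<in># A z" "x2 \<notin># B z"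
      using out_root by (auto simp: B_def A(1) poly_roots_poly_eq_0_iff)
    moreover have "B z \<subseteq># A z"
      by (simp add: B_def)
    ultimately show ?thesis
      by (metis subset_mset.nless_le)
  qed
  then have Nn: "N < n"
    unfolding N_def using A(2)[of z] mset_subset_size by fastforce
  \<comment> \<open>The default outside \<open>U\<close> keeps the degree equal to \<open>N\<close> everywhere.\<close>
  define C where "C s = (if s \<in> U then B s else replicate_mset N 0)" for s
  define b where "b s = roots_poly (C s)" for s
  have sizeC: "size (C s) = N" for s
    by (simp add: C_def sizeB)
  have "(\<lambda>s. \<Sum>r\<in>#C s. r ^ k) analytic_on {z}" for k
  proof (rule holomorphic_on_imp_analytic_at[OF _ U(1,4)])
    have "(\<lambda>s. I k s / (2 * of_real pi * \<i>)) holomorphic_on U"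
      by (intro holomorphic_intros I_hol) simp
    then show "(\<lambda>s. \<Sum>r\<in>#C s. r ^ k) holomorphic_on U"
      by (rule holomorphic_transform) (simp add: power_sum C_def)
  qed
  then have b: "analytic_monic {z} N b"
    unfolding analytic_monic_def b_def
    using analytic_coeff_of_power_sums[of C N "{z}", OF sizeC] roots_poly_monic[of "C s" for s]
    by (simp add: sizeC)
  show ?thesis
  proof (rule that[OF N0 Nn b analytic_monic_div[OF b a]])
    show "N \<le> n" using Nn by simp
    show "\<forall>\<^sub>F s in nhds z. a s = b s * (a s div b s)"
      using eventually_nhds_in_open[OF U(1,4)]
    proof eventually_elim
      case (elim s)
      define X where "X = filter_mset (\<lambda>r. \<not> dist c r < \<rho>) (A s)"
      have "A s = B s + X"
        by (simp add: B_def X_def)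
      then have "a s = b s * roots_poly X"
        using elim by (simp add: A(1) b_def C_def)
      then have "b s dvd a s"
        by simp
      then show ?case
        by simp
    qed
  qed
qed

lemma analytic_monic_split:
  assumes a: "analytic_monic {z} n a"
    and roots: "poly (a z) x1 = 0" "poly (a z) x2 = 0" "x1 \<noteq> x2"
  obtains N b q where "0 < N" "N < n" "analytic_monic {z} N b" "analytic_monic {z} (n - N) q"
    "\<forall>\<^sub>F s in nhds z. a s = b s * q s"
proof -
  have "a z \<noteq> 0"
    using a by (auto simp: analytic_monic_def dest!: spec[of _ z])
  then have "finite (dist x1 ` {x. poly (a z) x = 0})"
    by (simp add: poly_roots_finite)
  moreover have "infinite {0<..<dist x1 x2}"
    using roots by (intro infinite_Ioo) simp
  ultimately have "infinite ({0<..<dist x1 x2} - dist x1 ` {x. poly (a z) x = 0})"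
    by (rule Diff_infinite_finite)
  then obtain \<rho> where \<rho>: "0 < \<rho>" "\<rho> < dist x1 x2" "\<rho> \<notin> dist x1 ` {x. poly (a z) x = 0}"
    by (metis (no_types, lifting) DiffE finite.emptyI ex_in_conv greaterThanLessThan_iff)
  have off: "poly (a z) x \<noteq> 0" if "x \<in> sphere x1 \<rho>" for x
    using that \<rho>(3) by auto
  show ?thesis
    by (rule analytic_monic_split_disc[OF a \<rho>(1) off roots(1) _ roots(2)])
       (use \<rho>(1,2) in \<open>auto intro: that\<close>)
qed

section \<open>Local splitting of real-rooted polynomials\<close>

lemma coeff_roots_poly_bound:
  assumes "\<And>r. r \<in># A \<Longrightarrow> norm r \<le> R" "R \<ge> 0" "j \<le> size A"
  shows "norm (coeff (roots_poly A) j) \<le> 2 ^ size A * R ^ (size A - j)"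
  using assms
proof (induction A arbitrary: j)
  case empty
  then show ?case by simp
next
  case (add x A)
  let ?n = "size A"
  have x: "norm x \<le> R"
    using add.prems by auto
  have IH: "norm (coeff (roots_poly A) i) \<le> 2 ^ ?n * R ^ (?n - i)" if "i \<le> ?n" for i
    using add that by auto
  have step: "norm (x * coeff (roots_poly A) i) \<le> 2 ^ ?n * R ^ (Suc ?n - i)" if "i \<le> Suc ?n" for i
  proof (cases "i = Suc ?n")
    case True
    then have "coeff (roots_poly A) i = 0"
      by (intro coeff_eq_0) (simp add: roots_poly_monic)
    then show ?thesis using add.prems by simp
  next
    case False
    with that have "i \<le> ?n" by simp
    have "norm (x * coeff (roots_poly A) i) \<le> R * (2 ^ ?n * R ^ (?n - i))"
      unfolding norm_mult using x IH[OF \<open>i \<le> ?n\<close>] add.prems by (intro mult_mono) auto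
    also have "\<dots> = 2 ^ ?n * R ^ (Suc ?n - i)"
      using \<open>i \<le> ?n\<close> by (simp add: Suc_diff_le)
    finally show ?thesis .
  qed
  show ?case
  proof (cases j)
    case 0
    have "norm (x * coeff (roots_poly A) 0) \<le> 2 ^ ?n * R ^ Suc ?n"
      using step[of 0] by simp
    also have "\<dots> \<le> 2 ^ Suc ?n * R ^ Suc ?n"
      using add.prems by (intro mult_right_mono) auto
    finally show ?thesis
      using 0 by (simp add: norm_mult)
  next
    case (Suc i)
    then have i: "i \<le> ?n"
      using add.prems by simp
    have "norm (coeff (roots_poly A) i - x * coeff (roots_poly A) (Suc i)) \<le>
        2 ^ ?n * R ^ (?n - i) + 2 ^ ?n * R ^ (Suc ?n - Suc i)"
      using IH[OF i] step[of "Suc i"] i by (intro norm_triangle_le_diff add_mono) auto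
    then show ?thesis
      using Suc by (simp add: mult_ac)
  qed
qed

lemma roots_poly_second_coeff:
  assumes "size A \<ge> 1"
  shows "coeff (roots_poly A) (size A - 1) = - (\<Sum>r\<in>#A. r)"
proof -
  obtain n where n: "size A = Suc n"
    using assms by (cases "size A") auto
  have "coeff (roots_poly A) (Suc n) = 1"
    using roots_poly_monic[of A] by (simp add: n)
  then show ?thesis
    using newton_identities[of n A] by (simp add: n algebra_simps eq_neg_iff_add_eq_0)
qed

lemma roots_poly_third_coeff:
  assumes "size A \<ge> 2" and "(\<Sum>r\<in>#A. r) = 0"
  shows "- 2 * coeff (roots_poly A) (size A - 2) = (\<Sum>r\<in>#A. r ^ 2)"
proof -
  obtain n where n: "size A = Suc (Suc n)"
    using assms by (metis One_nat_def Suc_1 Suc_le_D Suc_le_mono)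
  have "coeff (roots_poly A) (Suc (Suc n)) = 1" "coeff (roots_poly A) (Suc n) = 0"
    using roots_poly_monic[of A] roots_poly_second_coeff[of A] assms by (simp_all add: n)
  then have "(\<Sum>r\<in>#A. r ^ 2) + 2 * coeff (roots_poly A) n = 0"
    using newton_identities[of n A] by (simp add: n algebra_simps power2_eq_square)
  then show ?thesis
    by (simp add: n add_eq_0_iff)
qed

lemma pcompose_roots_poly:
  "pcompose (roots_poly A) [:m, 1:] = roots_poly (image_mset (\<lambda>r. r - m) A)"
proof (induction A)
  case (add x A)
  have "pcompose [:-x, 1:] [:m, 1:] = [:- (x - m), 1:]"
    by (simp add: pcompose_pCons)
  then show ?case
    using add by (simp only: image_mset_add_mset prod_mset.add_mset pcompose_mult)
qed (simp add: pcompose_1)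

text \<open>For odd \<open>M\<close> the power changes sign at the base point, so the one-sided limits of \<open>u\<close> would have opposite
  signs.\<close>

lemma even_order_of_nonneg:
  assumes z: "z \<in> \<real>" and u: "u analytic_on {z}" "u z \<noteq> 0"
    and nonneg: "\<forall>\<^sub>F s in at z within \<real>. (s - z) ^ M * u s \<in> \<real>\<^sub>\<ge>\<^sub>0"
  shows "even M"
proof (rule ccontr)
  assume odd: "odd M"
  obtain x where x: "z = complex_of_real x"
    using z by (auto elim: Reals_cases)
  define h where "h t = u (complex_of_real (x + t))" for t :: real
  have "filterlim (\<lambda>t. complex_of_real (x + t)) (nhds z) (at 0)"
    unfolding x by (rule tendsto_eq_intros refl | simp)+
  then have lim: "filterlim (\<lambda>t. complex_of_real (x + t)) (at z within \<real>) (at 0)"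
    by (rule filterlim_at[THEN iffD2, OF conjI, rotated])
       (auto simp: eventually_at_filter x)
  have "isCont u z"
    using u(1) by (rule analytic_at_imp_isCont)
  then have hlim: "(h \<longlongrightarrow> u z) (at 0)"
    unfolding h_def using \<open>filterlim _ (nhds z) (at 0)\<close> isCont_tendsto_compose by blast
  have *: "\<forall>\<^sub>F t in at 0. complex_of_real t ^ M * h t \<in> \<real>\<^sub>\<ge>\<^sub>0"
    using eventually_compose_filterlim[OF nonneg lim] by (simp add: h_def x)
  have prod: "Im (h t) = 0 \<and> t ^ M * Re (h t) \<ge> 0" if "complex_of_real t ^ M * h t \<in> \<real>\<^sub>\<ge>\<^sub>0" "t \<noteq> 0" for t
  proof -
    have "complex_of_real t ^ M * h t = complex_of_real (t ^ M) * h t"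
      by simp
    then have "complex_of_real (t ^ M) * h t \<in> \<real>\<^sub>\<ge>\<^sub>0"
      using that(1) by simp
    then show ?thesis
      using that(2) by (simp add: complex_nonneg_Reals_iff)
  qed
  have right: "\<forall>\<^sub>F t in at_right 0. Im (h t) = 0 \<and> Re (h t) \<ge> 0"
  proof -
    have "\<forall>\<^sub>F t in at_right 0. complex_of_real t ^ M * h t \<in> \<real>\<^sub>\<ge>\<^sub>0"
      using * by (simp add: eventually_at_split)
    moreover have "\<forall>\<^sub>F t in at_right (0::real). t > 0"
      by (simp add: eventually_at_right_less)
    ultimately show ?thesis
    proof eventually_elim
      case (elim t)
      then have "Im (h t) = 0" "t ^ M * Re (h t) \<ge> 0" "t ^ M > 0"
        using prod[of t] by auto
      then show ?case
        by (simp add: zero_le_mult_iff)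
    qed
  qed
  have left: "\<forall>\<^sub>F t in at_left 0. Re (h t) \<le> 0"
  proof -
    have "\<forall>\<^sub>F t in at_left 0. complex_of_real t ^ M * h t \<in> \<real>\<^sub>\<ge>\<^sub>0"
      using * by (simp add: eventually_at_split)
    moreover have "\<forall>\<^sub>F t in at_left (0::real). t < 0"
      by (auto simp: eventually_at_filter)
    ultimately show ?thesis
    proof eventually_elim
      case (elim t)
      then have "t ^ M * Re (h t) \<ge> 0" "t ^ M < 0"
        using prod[of t] odd by (auto simp: power_less_zero_eq)
      then show ?case
        by (simp add: zero_le_mult_iff)
    qed
  qed
  have lim_r: "((\<lambda>t. Re (h t)) \<longlongrightarrow> Re (u z)) (at_right 0)" "((\<lambda>t. Im (h t)) \<longlongrightarrow> Im (u z)) (at_right 0)"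
    "((\<lambda>t. Re (h t)) \<longlongrightarrow> Re (u z)) (at_left 0)"
    using hlim by (auto simp: filterlim_at_split intro: tendsto_Re tendsto_Im)
  have "Re (u z) \<ge> 0"
    using lim_r(1) right by (intro tendsto_lowerbound[OF lim_r(1)]) (auto elim: eventually_mono)
  moreover have "Re (u z) \<le> 0"
    using left by (intro tendsto_upperbound[OF lim_r(3)]) auto
  moreover have "((\<lambda>t. Im (h t)) \<longlongrightarrow> 0) (at_right 0)"
    by (rule tendsto_eventually) (use right in \<open>auto elim: eventually_mono\<close>)
  then have "Im (u z) = 0"
    using lim_r(2) tendsto_unique[OF trivial_limit_at_right_real] by blast
  ultimately show False
    using u(2) by (simp add: complex_eq_iff)
qed

lemma analytic_germ_power_mult_zero:
  assumes "f analytic_on {z}" "\<forall>\<^sub>F s in nhds z. (s - z) ^ k * f s = 0"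
  shows "f z = 0"
proof -
  have "\<forall>\<^sub>F s in at z. f s = 0"
    using assms(2) unfolding eventually_at_filter by eventually_elim auto
  then have "\<forall>\<^sub>F s in nhds z. f s = 0"
    by (intro analytic_germ_identity[OF assms(1), of UNIV]) (simp add: eventually_frequently)
  then show ?thesis
    by (rule eventually_nhds_x_imp_x)
qed

lemma sum_mset_Reals: "(\<And>r. r \<in># A \<Longrightarrow> r \<in> \<real>) \<Longrightarrow> (\<Sum>r\<in>#A. r :: complex) \<in> \<real>"
  by (induction A) auto

lemma norm_le_sum_mset_squares:
  assumes "\<And>r. r \<in># A \<Longrightarrow> r \<in> \<real>"
  shows "(\<Sum>r\<in>#A. r ^ 2 :: complex) \<in> \<real>\<^sub>\<ge>\<^sub>0"
    "r0 \<in># A \<Longrightarrow> norm r0 ^ 2 \<le> norm (\<Sum>r\<in>#A. r ^ 2 :: complex)"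
proof -
  have sq: "r ^ 2 = complex_of_real (norm r ^ 2)" if "r \<in># A" for r
    using assms[OF that] by (auto elim!: Reals_cases simp flip: of_real_power)
  then have "(\<Sum>r\<in>#A. r ^ 2) = (\<Sum>r\<in>#A. complex_of_real (norm r ^ 2))"
    by (intro arg_cong[of _ _ sum_mset] image_mset_cong)
  also have "\<dots> = complex_of_real (\<Sum>r\<in>#A. norm r ^ 2)"
    by (induction A) auto
  finally have eq: "(\<Sum>r\<in>#A. r ^ 2) = complex_of_real (\<Sum>r\<in>#A. norm r ^ 2)" .
  have nonneg: "(\<Sum>r\<in>#B. norm (r::complex) ^ 2) \<ge> 0" for B
    by (induction B) auto
  show "(\<Sum>r\<in>#A. r ^ 2 :: complex) \<in> \<real>\<^sub>\<ge>\<^sub>0"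
    unfolding eq using nonneg[of A] by simp
  assume "r0 \<in># A"
  then obtain B where "A = add_mset r0 B"
    by (metis multi_member_split)
  then have "norm r0 ^ 2 \<le> (\<Sum>r\<in>#A. norm r ^ 2)"
    using nonneg[of B] by simp
  then show "norm r0 ^ 2 \<le> norm (\<Sum>r\<in>#A. r ^ 2 :: complex)"
    unfolding eq using nonneg[of A] by simp
qed

definition real_rooted :: "complex poly \<Rightarrow> bool" where
  "real_rooted p \<longleftrightarrow> (\<forall>x. poly p x = 0 \<longrightarrow> x \<in> \<real>)"

text \<open>Real-rootedness excludes fractional powers. Let the mean of the roots be zero. Then the sum of the squares of
  the roots is, up to a factor, the coefficient of index \<open>n - 2\<close>; being nonnegative on the real line, it has
  even order \<open>2k\<close> (or vanishes, and all roots agree). As the roots are real, each of them is \<open>O((s - z)\<^sup>k)\<close>.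
  After division of all roots by \<open>(s - z)\<^sup>k\<close> their sum at \<open>z\<close> is zero but the sum of their squares is not;
  hence they are not all equal and the polynomial splits there into factors of smaller degree.\<close>

lemma analytic_rellich_local:
  assumes "analytic_monic {z} n a" and z: "z \<in> \<real>"
    and "\<forall>\<^sub>F s in at z within \<real>. real_rooted (a s)"
  shows "\<exists>\<mu>. (\<forall>j<n. \<mu> j analytic_on {z}) \<and> (\<forall>\<^sub>F s in nhds z. a s = (\<Prod>j<n. [:-\<mu> j s, 1:]))"
  using assms(1,3)
proof (induction n arbitrary: a rule: less_induct)
  case (less n a)
  note a = \<open>analytic_monic {z} n a\<close>
  have bot: "at z within \<real> \<noteq> bot"
    using z at_within_Reals_neq_bot by (auto elim!: Reals_cases)
  have deg: "degree (a s) = n" and lc: "coeff (a s) n = 1" for s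
    using a unfolding analytic_monic_def by metis+
  have coefs: "(\<lambda>s. coeff (a s) k) analytic_on {z}" for k
    using a by (simp add: analytic_monic_def)
  have "\<exists>A. a s = roots_poly A \<and> size A = n" for s
    using monic_eq_roots_poly[of "a s"] deg[of s] lc[of s] by metis
  then obtain A where A: "\<And>s. a s = roots_poly (A s)" "\<And>s. size (A s) = n"
    by metis
  consider "n = 0" | "n = 1" | "n \<ge> 2"
    by linarith
  then show ?case
  proof cases
    case 1
    then show ?thesis
      using A by (auto intro!: always_eventually)
  next
    case 2
    have "a s = [:coeff (a s) 0, 1:]" for s
      using deg[of s] lc[of s] 2
      by (intro poly_eqI) (auto simp: coeff_pCons coeff_eq_0 split: nat.splits)
    then have "\<forall>\<^sub>F s in nhds z. a s = (\<Prod>j<n. [:- (- coeff (a s) 0), 1:])"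
      unfolding 2 by (intro always_eventually allI) (metis (no_types, lifting) lessThan_Suc
          One_nat_def lessThan_0 minus_minus prod.empty prod.insert empty_iff finite.emptyI mult.right_neutral)
    then show ?thesis
      using coefs[of 0] by (intro exI[of _ "\<lambda>_ s. - coeff (a s) 0"] conjI) (auto intro: analytic_intros)
  next
    case 3
    \<comment> \<open>The substitution removes the mean of the roots, so that the third coefficient of \<open>b\<close>
      measures the size of all roots.\<close>
    define m where "m s = - coeff (a s) (n - 1) / of_nat n" for s
    define b where "b s = pcompose (a s) [:m s, 1:]" for s
    define B where "B s = image_mset (\<lambda>r. r - m s) (A s)" for s
    have m: "m analytic_on {z}"
      unfolding m_def using 3 by (intro analytic_intros coefs) auto
    have m_mean: "of_nat n * m s = (\<Sum>r\<in>#A s. r)" for s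
      using roots_poly_second_coeff[of "A s"] 3 by (simp add: m_def A)
    have b_roots: "b s = roots_poly (B s)" and sizeB: "size (B s) = n" for s
      unfolding b_def B_def by (simp_all add: A pcompose_roots_poly)
    have sumB: "(\<Sum>r\<in>#B s. r) = 0" for s
    proof -
      have "(\<Sum>r\<in>#X. r - c) = (\<Sum>r\<in>#X. r) - of_nat (size X) * c" for X and c :: complex
        by (induction X) (auto simp: algebra_simps)
      then show ?thesis
        using m_mean[of s] A(2)[of s] by (simp add: B_def image_mset.compositionality o_def)
    qed
    have b: "analytic_monic {z} n b"
    proof -
      have "b = (\<lambda>s. \<Sum>i\<le>n. smult (coeff (a s) i) ([:m s, 1:] ^ i))"
        unfolding b_def by (rule ext, rule pcompose_eq_sum) (simp add: deg)
      then have "analytic_coeffs {z} b"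
        using m by (auto intro!: analytic_coeffs_sum analytic_coeffs_smult analytic_coeffs_power
            analytic_coeffs_linear coefs)
      then show ?thesis
        using roots_poly_monic[of "B s" for s] unfolding analytic_monic_iff by (simp add: b_roots sizeB)
    qed
    have bdeg: "degree (b s) = n" for s
      using b by (simp add: analytic_monic_def)
    have b_coefs: "(\<lambda>s. coeff (b s) k) analytic_on {z}" for k
      using b by (simp add: analytic_monic_def)
    have poly_b: "poly (b s) x = poly (a s) (x + m s)" for s x
      by (simp add: b_def poly_pcompose algebra_simps)
    have real: "\<forall>\<^sub>F s in at z within \<real>. s \<in> \<real> \<and> s \<noteq> z \<and> m s \<in> \<real> \<and> (\<forall>r\<in>#B s. r \<in> \<real>)"
    proof -
      have "\<forall>\<^sub>F s in at z within \<real>. s \<in> \<real> \<and> s \<noteq> z"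
        by (auto simp: eventually_at_filter)
      with less.prems(2) show ?thesis
      proof eventually_elim
        case (elim s)
        then have rA: "r \<in> \<real>" if "r \<in># A s" for r
          using that by (simp add: real_rooted_def A poly_roots_poly_eq_0_iff)
        then have "of_nat n * m s \<in> \<real>"
          unfolding m_mean by (rule sum_mset_Reals)
        moreover have "m s = of_nat n * m s / of_nat n"
          using 3 by simp
        ultimately have "m s \<in> \<real>"
          by (metis Reals_divide Reals_of_nat)
        then show ?case
          using rA elim by (auto simp: B_def)
      qed
    qed
    define q where "q s = - 2 * coeff (b s) (n - 2)" for s
    have q: "q analytic_on {z}"
      unfolding q_def by (intro analytic_intros b_coefs)
    have q_sum: "q s = (\<Sum>r\<in>#B s. r ^ 2)" for s
      unfolding q_def b_roots using roots_poly_third_coeff[of "B s"] 3 sumB sizeB by simp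
    show ?thesis
    proof (cases "\<forall>\<^sub>F s in nhds z. q s = 0")
      case True
      then have "\<forall>\<^sub>F s in at z within \<real>. q s = 0"
        by (auto simp: eventually_at_filter elim: eventually_mono)
      with real have ev: "\<forall>\<^sub>F s in at z within \<real>. a s = (\<Prod>j<n. [:-m s, 1:])"
      proof eventually_elim
        case (elim s)
        have "r = m s" if "r \<in># A s" for r
        proof -
          have "norm (r - m s) ^ 2 \<le> norm (q s)"
            unfolding q_sum using elim that by (intro norm_le_sum_mset_squares(2)) (auto simp: B_def)
          then show ?thesis using elim by simp
        qed
        then have "A s = replicate_mset n (m s)"
          using A(2)[of s] by (metis set_mset_subset_singletonD subsetI singletonI)
        then show ?case
          by (simp add: A)
      qed
      have "analytic_monic {z} n (\<lambda>s. \<Prod>j<n. [:-m s, 1:])"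
        using m by (rule analytic_monic_linear_prod)
      from analytic_monic_identity[OF a this bot ev] show ?thesis
        using m by (intro exI[of _ "\<lambda>_. m"]) auto
    next
      case False
      obtain M u where u: "u analytic_on {z}" "u z \<noteq> 0" "\<forall>\<^sub>F s in nhds z. q s = (s - z) ^ M * u s"
        using analytic_germ_factor[OF q False] .
      have u_at: "\<forall>\<^sub>F s in at z within \<real>. q s = (s - z) ^ M * u s"
        using u(3) by (auto simp: eventually_at_filter elim: eventually_mono)
      have "\<forall>\<^sub>F s in at z within \<real>. (s - z) ^ M * u s \<in> \<real>\<^sub>\<ge>\<^sub>0"
        using real u_at
      proof eventually_elim
        case (elim s)
        then have "q s \<in> \<real>\<^sub>\<ge>\<^sub>0"
          unfolding q_sum by (intro norm_le_sum_mset_squares) auto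
        with elim show ?case by simp
      qed
      then have "even M"
        using even_order_of_nonneg[OF z u(1,2)] by blast
      then obtain k where M: "M = 2 * k"
        by (auto elim: evenE)
      define C where "C = sqrt (norm (u z) + 1)"
      have root_bound: "\<forall>\<^sub>F s in at z within \<real>. \<forall>r\<in>#B s. norm r \<le> C * norm (s - z) ^ k"
      proof -
        have "isCont u z"
          using u(1) by (rule analytic_at_imp_isCont)
        then have "((\<lambda>s. norm (u s)) \<longlongrightarrow> norm (u z)) (at z within \<real>)"
          by (intro tendsto_norm) (auto simp: isCont_def intro: tendsto_mono[OF at_le[OF subset_UNIV]])
        then have "\<forall>\<^sub>F s in at z within \<real>. norm (u s) < norm (u z) + 1"
          by (rule order_tendstoD) simp
        with real u_at show ?thesis
        proof eventually_elim
          case (elim s)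
          show ?case
          proof
            fix r assume "r \<in># B s"
            then have "norm r ^ 2 \<le> norm (q s)"
              unfolding q_sum using elim by (intro norm_le_sum_mset_squares(2)) auto
            also have "\<dots> = norm (s - z) ^ (2 * k) * norm (u s)"
              using elim by (simp add: M norm_mult norm_power)
            also have "\<dots> \<le> norm (s - z) ^ (2 * k) * (norm (u z) + 1)"
              using elim by (intro mult_left_mono) auto
            also have "\<dots> = (C * norm (s - z) ^ k) ^ 2"
              by (simp add: C_def power_mult_distrib power_mult mult.commute flip: power_mult)
            finally show "norm r \<le> C * norm (s - z) ^ k"
              by (rule power2_le_imp_le) (simp add: C_def)
          qed
        qed
      qed
      \<comment> \<open>The roots are of order \<open>(s - z) ^ k\<close>, so the coefficients admit the division that
        rescales the roots by this factor.\<close>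
      have "\<exists>d. d analytic_on {z} \<and> (\<forall>\<^sub>F s in nhds z. coeff (b s) j = (s - z) ^ (k * (n - j)) * d s)"
        if "j < n" for j
      proof -
        have "\<forall>\<^sub>F s in at z within \<real>. norm (coeff (b s) j) \<le> (2 ^ n * C ^ (n - j)) * norm (s - z) ^ (k * (n - j))"
          using root_bound
        proof eventually_elim
          case (elim s)
          then have "norm (coeff (b s) j) \<le> 2 ^ n * (C * norm (s - z) ^ k) ^ (n - j)"
            using coeff_roots_poly_bound[of "B s" "C * norm (s - z) ^ k" j] that
            by (simp add: b_roots sizeB C_def)
          then show ?case
            by (simp add: power_mult_distrib power_mult mult.assoc)
        qed
        from analytic_germ_divide_power[OF b_coefs bot this] show ?thesis
          by metis
      qed
      then obtain d where d: "\<And>j. j < n \<Longrightarrow> d j analytic_on {z}"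
        "\<And>j. j < n \<Longrightarrow> \<forall>\<^sub>F s in nhds z. coeff (b s) j = (s - z) ^ (k * (n - j)) * d j s"
        by metis
      define c where "c s = monom 1 n + (\<Sum>j<n. monom (d j s) j)" for s
      have c_coeff: "coeff (c s) j = (if j < n then d j s else if j = n then 1 else 0)" for s j
        by (auto simp: c_def coeff_sum if_distrib[of "\<lambda>p. coeff p _"] sum.delta' cong: if_cong)
      have c: "analytic_monic {z} n c"
      proof -
        have "degree (c s) = n" for s
          by (intro antisym degree_le le_degree) (auto simp: c_coeff)
        moreover have "(\<lambda>s. coeff (c s) j) analytic_on {z}" for j
          unfolding c_coeff using d(1)[of j] by (cases "j < n"; cases "j = n") auto
        ultimately show ?thesis
          by (simp add: analytic_monic_def c_coeff)
      qed
      have rescale: "\<forall>\<^sub>F s in nhds z. \<forall>y. poly (b s) ((s - z) ^ k * y) = (s - z) ^ (k * n) * poly (c s) y"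
      proof -
        have "\<forall>\<^sub>F s in nhds z. \<forall>j\<in>{..<n}. coeff (b s) j = (s - z) ^ (k * (n - j)) * d j s"
          using d(2) by (intro eventually_ball_finite) auto
        then show ?thesis
        proof eventually_elim
          case (elim s)
          show ?case
          proof
            fix y
            define t where "t = (s - z) ^ k"
            have cdeg: "degree (c s) = n"
              using c by (simp add: analytic_monic_def)
            have "coeff (b s) j * (t * y) ^ j = t ^ n * (coeff (c s) j * y ^ j)" if "j \<le> n" for j
            proof (cases "j = n")
              case True
              have "coeff (b s) n = 1"
                using b bdeg unfolding analytic_monic_def by metis
              then show ?thesis
                using True by (simp add: c_coeff power_mult_distrib)
            next
              case False
              with that have "j < n" by simp
              then have "coeff (b s) j * (t * y) ^ j = (t ^ (n - j) * t ^ j) * (d j s * y ^ j)"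
                using elim by (simp add: t_def power_mult power_mult_distrib)
              also have "t ^ (n - j) * t ^ j = t ^ n"
                using \<open>j < n\<close> by (simp flip: power_add)
              finally show ?thesis
                using \<open>j < n\<close> by (simp add: c_coeff)
            qed
            then have "(\<Sum>j\<le>n. coeff (b s) j * (t * y) ^ j) = t ^ n * (\<Sum>j\<le>n. coeff (c s) j * y ^ j)"
              unfolding sum_distrib_left by (intro sum.cong) auto
            then show "poly (b s) ((s - z) ^ k * y) = (s - z) ^ (k * n) * poly (c s) y"
              by (simp add: poly_altdef bdeg cdeg t_def power_mult)
          qed
        qed
      qed
      then have rescale_at: "\<forall>\<^sub>F s in at z within \<real>. \<forall>y. poly (b s) ((s - z) ^ k * y) = (s - z) ^ (k * n) * poly (c s) y"
        by (auto simp: eventually_at_filter elim: eventually_mono)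
      have c_real: "\<forall>\<^sub>F s in at z within \<real>. real_rooted (c s)"
        using real rescale_at
      proof eventually_elim
        case (elim s)
        show ?case
          unfolding real_rooted_def
        proof (intro allI impI)
          fix y assume "poly (c s) y = 0"
          then have "(s - z) ^ k * y \<in># B s"
            using elim by (simp add: b_roots poly_roots_poly_eq_0_iff[symmetric])
          then have "(s - z) ^ k * y \<in> \<real>" "(s - z) ^ k \<in> \<real>" "(s - z) ^ k \<noteq> 0"
            using elim z by auto
          moreover from this(3) have "y = ((s - z) ^ k * y) / (s - z) ^ k"
            by simp
          ultimately show "y \<in> \<real>"
            by (metis Reals_divide)
        qed
      qed
      have "d (n - 1) z = 0"
      proof (rule analytic_germ_power_mult_zero[of "d (n - 1)"])
        show "d (n - 1) analytic_on {z}"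
          using d(1) 3 by simp
        have "coeff (b s) (n - 1) = 0" for s
          unfolding b_roots using roots_poly_second_coeff[of "B s"] sizeB sumB 3 by simp
        then show "\<forall>\<^sub>F s in nhds z. (s - z) ^ (k * (n - (n - 1))) * d (n - 1) s = 0"
          using d(2)[of "n - 1"] 3 by (auto elim: eventually_mono)
      qed
      have "2 * d (n - 2) z + u z = 0"
      proof (rule analytic_germ_power_mult_zero[of "\<lambda>s. 2 * d (n - 2) s + u s"])
        show "(\<lambda>s. 2 * d (n - 2) s + u s) analytic_on {z}"
          using d(1)[of "n - 2"] 3 u(1) by (intro analytic_intros) auto
        have "\<forall>\<^sub>F s in nhds z. coeff (b s) (n - 2) = (s - z) ^ (k * 2) * d (n - 2) s"
          using d(2)[of "n - 2"] 3 by simp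
        then show "\<forall>\<^sub>F s in nhds z. (s - z) ^ (2 * k) * (2 * d (n - 2) s + u s) = 0"
          using u(3)
        proof eventually_elim
          case (elim s)
          then show ?case
            unfolding q_def M by (simp add: algebra_simps neg_eq_iff_add_eq_0)
        qed
      qed
      then have "d (n - 2) z \<noteq> 0"
        using u(2) by auto
      obtain x1 x2 where x12: "poly (c z) x1 = 0" "poly (c z) x2 = 0" "x1 \<noteq> x2"
      proof -
        obtain X where X: "c z = roots_poly X" "size X = n"
        proof -
          have c_z: "degree (c z) = n" "lead_coeff (c z) = 1"
            using c unfolding analytic_monic_def by blast+
          obtain X where "c z = roots_poly X" "size X = degree (c z)"
            using monic_eq_roots_poly[OF c_z(2)] .
          then show ?thesis
            using that[of X] c_z(1) by metis
        qed
        have sum0: "(\<Sum>r\<in>#X. r) = 0"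
        proof -
          have "coeff (roots_poly X) (n - 1) = 0"
            unfolding X(1)[symmetric] c_coeff using \<open>d (n - 1) z = 0\<close> 3 by simp
          then show ?thesis
            using roots_poly_second_coeff[of X] X(2) 3 by simp
        qed
        have sq: "(\<Sum>r\<in>#X. r ^ 2) \<noteq> 0"
        proof -
          have "coeff (roots_poly X) (n - 2) \<noteq> 0"
            unfolding X(1)[symmetric] c_coeff using \<open>d (n - 2) z \<noteq> 0\<close> 3 by simp
          then show ?thesis
            using roots_poly_third_coeff[of X] X(2) sum0 3 by auto
        qed
        have "\<exists>x1\<in>#X. \<exists>x2\<in>#X. x1 \<noteq> x2"
        proof (rule ccontr)
          assume no: "\<not> ?thesis"
          obtain x where "x \<in># X"
            using X 3 by (metis multiset_nonemptyE not_numeral_le_zero size_empty)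
          with no have "X = replicate_mset n x"
            using X(2) by (metis set_mset_subset_singletonD subsetI singletonI)
          then show False
            using sum0 sq 3 by (auto simp: sum_mset_replicate_mset)
        qed
        then show ?thesis
          using that by (auto simp: X(1) poly_roots_poly_eq_0_iff)
      qed
      obtain N \<beta> \<gamma> where N: "0 < N" "N < n" and \<beta>: "analytic_monic {z} N \<beta>"
        and \<gamma>: "analytic_monic {z} (n - N) \<gamma>" and c_eq: "\<forall>\<^sub>F s in nhds z. c s = \<beta> s * \<gamma> s"
        using analytic_monic_split[OF c x12] .
      have c_eq': "\<forall>\<^sub>F s in at z within \<real>. c s = \<beta> s * \<gamma> s"
        using c_eq by (auto simp: eventually_at_filter elim: eventually_mono)
      have "\<forall>\<^sub>F s in at z within \<real>. real_rooted (\<beta> s)" "\<forall>\<^sub>F s in at z within \<real>. real_rooted (\<gamma> s)"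
        using c_eq' c_real by (eventually_elim; simp add: real_rooted_def)+
      then obtain \<mu> \<nu> where \<mu>: "\<And>j. j < N \<Longrightarrow> \<mu> j analytic_on {z}" "\<forall>\<^sub>F s in nhds z. \<beta> s = (\<Prod>j<N. [:-\<mu> j s, 1:])"
        and \<nu>: "\<And>j. j < n - N \<Longrightarrow> \<nu> j analytic_on {z}" "\<forall>\<^sub>F s in nhds z. \<gamma> s = (\<Prod>j<n - N. [:-\<nu> j s, 1:])"
        using less.IH[OF N(2) \<beta>] less.IH[OF _ \<gamma>] N by auto
      define \<kappa> where "\<kappa> j = (if j < N then \<mu> j else \<nu> (j - N))" for j
      have \<kappa>: "\<kappa> j analytic_on {z}" if "j < n" for j
        using that \<mu>(1) \<nu>(1) by (auto simp: \<kappa>_def)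
      have c_split: "\<forall>\<^sub>F s in nhds z. c s = (\<Prod>j<n. [:-\<kappa> j s, 1:])"
        using c_eq \<mu>(2) \<nu>(2)
      proof eventually_elim
        case (elim s)
        have "(\<Prod>j<n. [:-\<kappa> j s, 1:]) = (\<Prod>j\<in>{..<N}. [:-\<kappa> j s, 1:]) * (\<Prod>j\<in>{N..<n}. [:-\<kappa> j s, 1:])"
          using N by (subst prod.union_disjoint[symmetric]) (auto intro!: prod.cong)
        also have "(\<Prod>j\<in>{..<N}. [:-\<kappa> j s, 1:]) = \<beta> s"
          using elim by (simp add: \<kappa>_def)
        also have "(\<Prod>j\<in>{N..<n}. [:-\<kappa> j s, 1:]) = \<gamma> s"
          using elim(3) by (subst prod.reindex_bij_witness[of _ "\<lambda>j. j + N" "\<lambda>j. j - N" "{..<n - N}" "\<lambda>j. [:-\<nu> j s, 1:]"])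
            (auto simp: \<kappa>_def)
        finally show ?case
          using elim by simp
      qed
      define \<theta> where "\<theta> j s = m s + (s - z) ^ k * \<kappa> j s" for j s
      have \<theta>: "\<theta> j analytic_on {z}" if "j < n" for j
        unfolding \<theta>_def using m \<kappa>[OF that] by (intro analytic_intros)
      have "\<forall>\<^sub>F s in at z within \<real>. c s = (\<Prod>j<n. [:-\<kappa> j s, 1:])"
        using c_split by (auto simp: eventually_at_filter elim: eventually_mono)
      with real rescale_at have "\<forall>\<^sub>F s in at z within \<real>. a s = (\<Prod>j<n. [:-\<theta> j s, 1:])"
      proof eventually_elim
        case (elim s)
        have "poly (a s) x = poly (\<Prod>j<n. [:-\<theta> j s, 1:]) x" for x
        proof -
          define t where "t = (s - z) ^ k"
          have t: "t \<noteq> 0"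
            using elim by (simp add: t_def)
          define y where "y = (x - m s) / t"
          have x: "x = t * y + m s"
            using t by (simp add: y_def)
          have "poly (a s) x = t ^ n * poly (c s) y"
            using elim(2) unfolding x poly_b[symmetric] t_def by (simp add: power_mult)
          also have "poly (c s) y = (\<Prod>j<n. y - \<kappa> j s)"
            by (simp add: elim(3) poly_prod)
          also have "t ^ n * \<dots> = (\<Prod>j<n. t * (y - \<kappa> j s))"
            by (simp add: prod.distrib)
          also have "\<dots> = poly (\<Prod>j<n. [:-\<theta> j s, 1:]) x"
            by (simp add: poly_prod x \<theta>_def t_def algebra_simps)
          finally show ?thesis .
        qed
        then show ?case
          by (simp add: poly_eq_poly_eq_iff[symmetric] fun_eq_iff)
      qed
      from analytic_monic_identity[OF a analytic_monic_linear_prod[OF \<theta>] bot this] show ?thesis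
        using \<theta> by blast
    qed
  qed
qed

section \<open>Analytic continuation of a root along the circle\<close>

lemma analytic_germ_root_is_factor:
  fixes n :: nat
  assumes f: "f analytic_on {z}" and root: "\<forall>\<^sub>F s in nhds z. poly (a s) (f s) = 0"
    and \<mu>: "\<And>j. j < n \<Longrightarrow> \<mu> j analytic_on {z}"
    and split: "\<forall>\<^sub>F s in nhds z. a s = (\<Prod>j<n. [:-\<mu> j s, 1:])"
  shows "\<exists>j<n. \<forall>\<^sub>F s in nhds z. f s = \<mu> j s"
proof -
  have "\<forall>\<^sub>F s in nhds z. \<exists>j\<in>{..<n}. f s - \<mu> j s = 0"
    using root split by eventually_elim (auto simp: poly_prod)
  then have "\<forall>\<^sub>F s in at z. \<exists>j\<in>{..<n}. f s - \<mu> j s = 0"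
    by (auto simp: eventually_at_filter elim: eventually_mono)
  then have "\<exists>\<^sub>F s in at z. \<exists>j\<in>{..<n}. f s - \<mu> j s = 0"
    by (intro eventually_frequently) auto
  then have "\<exists>j\<in>{..<n}. \<forall>\<^sub>F s in nhds z. f s - \<mu> j s = 0"
    using f \<mu> by (intro analytic_germ_prod_zero[of "{..<n}" "\<lambda>j s. f s - \<mu> j s" z UNIV] analytic_intros) auto
  then show ?thesis
    by auto
qed

text \<open>At each point the local splitting lists all germs of roots, so a root given on one side of the point
  coincides with one of them and continues to the other side. Bolzano's lemma combines these steps.\<close>

lemma analytic_root_on_segment:
  fixes x y :: real
  assumes a: "analytic_monic \<real> n a" and real: "\<And>s. s \<in> \<real> \<Longrightarrow> real_rooted (a s)"
    and n: "n > 0" and xy: "x \<le> y"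
  obtains g where "g analytic_on (of_real ` {x..y})"
    "\<And>t. t \<in> {x..y} \<Longrightarrow> \<forall>\<^sub>F s in nhds (complex_of_real t). poly (a s) (g s) = 0"
proof -
  have local: "\<exists>\<mu>. (\<forall>j<n. \<mu> j analytic_on {of_real t}) \<and>
      (\<forall>\<^sub>F s in nhds (complex_of_real t). a s = (\<Prod>j<n. [:-\<mu> j s, 1:]))" for t
  proof (rule analytic_rellich_local)
    have "{complex_of_real t} \<subseteq> \<real>"
      by simp
    then show "analytic_monic {of_real t} n a"
      using a unfolding analytic_monic_def using analytic_on_subset by blast
    show "\<forall>\<^sub>F s in at (complex_of_real t) within \<real>. real_rooted (a s)"
      using real by (auto simp: eventually_at_filter)
  qed simp
  define P where "P x y \<longleftrightarrow> (\<forall>f. f analytic_on {of_real x} \<and> (\<forall>\<^sub>F s in nhds (of_real x). poly (a s) (f s) = 0) \<longrightarrow>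
    (\<exists>g. g analytic_on (of_real ` {x..y}) \<and>
      (\<forall>t\<in>{x..y}. \<forall>\<^sub>F s in nhds (of_real t). poly (a s) (g s) = 0) \<and>
      (\<forall>\<^sub>F s in nhds (of_real x). g s = f s)))" for x y :: real
  have "P x y"
    using xy
  proof (rule Bolzano)
    fix x y z :: real
    assume P: "P x y" "P y z" and le: "x \<le> y" "y \<le> z"
    show "P x z"
      unfolding P_def
    proof (intro allI impI)
      fix f assume f: "f analytic_on {complex_of_real x} \<and> (\<forall>\<^sub>F s in nhds (of_real x). poly (a s) (f s) = 0)"
      obtain g1 where g1: "g1 analytic_on (of_real ` {x..y})"
          "\<And>t. t \<in> {x..y} \<Longrightarrow> \<forall>\<^sub>F s in nhds (of_real t). poly (a s) (g1 s) = 0"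
          "\<forall>\<^sub>F s in nhds (of_real x). g1 s = f s"
        using P(1) f unfolding P_def by blast
      have "g1 analytic_on {of_real y}"
        using g1(1) le by (auto intro: analytic_on_subset)
      then obtain g2 where g2: "g2 analytic_on (of_real ` {y..z})"
          "\<And>t. t \<in> {y..z} \<Longrightarrow> \<forall>\<^sub>F s in nhds (of_real t). poly (a s) (g2 s) = 0"
          "\<forall>\<^sub>F s in nhds (of_real y). g2 s = g1 s"
        using P(2) g1(2)[of y] le unfolding P_def by auto
      define h where "h s = (if Re s < y then g1 s else g2 s)" for s
      have h1: "\<forall>\<^sub>F s in nhds (of_real t). h s = g1 s" if "t \<le> y" for t
      proof (cases "t < y")
        case True
        then have "\<forall>\<^sub>F s in nhds (of_real t). s \<in> {s. Re s < y}"
          by (intro eventually_nhds_in_open open_halfspace_Re_lt) auto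
        then show ?thesis
          by eventually_elim (simp add: h_def)
      next
        case False
        with that have "t = y" by simp
        then show ?thesis
          using g2(3) by (auto simp: h_def elim: eventually_mono)
      qed
      have h2: "\<forall>\<^sub>F s in nhds (of_real t). h s = g2 s" if "y < t" for t
      proof -
        have "\<forall>\<^sub>F s in nhds (of_real t). s \<in> {s. Re s > y}"
          using that by (intro eventually_nhds_in_open open_halfspace_Re_gt) auto
        then show ?thesis
          by eventually_elim (simp add: h_def)
      qed
      have local_h: "h analytic_on {of_real t} \<and> (\<forall>\<^sub>F s in nhds (of_real t). poly (a s) (h s) = 0)"
        if t: "t \<in> {x..z}" for t
      proof (cases "t \<le> y")
        case True
        then have "g1 analytic_on {of_real t}"
          using g1(1) t by (auto intro: analytic_on_subset)
        then have "h analytic_on {of_real t}"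
          using analytic_at_cong[OF h1[OF True] refl] by simp
        moreover have "\<forall>\<^sub>F s in nhds (of_real t). poly (a s) (h s) = 0"
          using h1[OF True] g1(2)[of t] True t by (auto elim: eventually_elim2)
        ultimately show ?thesis by blast
      next
        case False
        then have y: "y < t" by simp
        then have "g2 analytic_on {of_real t}"
          using g2(1) t by (auto intro: analytic_on_subset)
        then have "h analytic_on {of_real t}"
          using analytic_at_cong[OF h2[OF y] refl] by simp
        moreover have "\<forall>\<^sub>F s in nhds (of_real t). poly (a s) (h s) = 0"
          using h2[OF y] g2(2)[of t] y t by (auto elim: eventually_elim2)
        ultimately show ?thesis by blast
      qed
      show "\<exists>g. g analytic_on (of_real ` {x..z}) \<and>
          (\<forall>t\<in>{x..z}. \<forall>\<^sub>F s in nhds (of_real t). poly (a s) (g s) = 0) \<and>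
          (\<forall>\<^sub>F s in nhds (of_real x). g s = f s)"
      proof (intro exI[of _ h] conjI ballI)
        show "h analytic_on (of_real ` {x..z})"
          using local_h by (subst analytic_on_analytic_at) auto
        show "\<forall>\<^sub>F s in nhds (of_real x). h s = f s"
          using h1[OF le(1)] g1(3) by eventually_elim simp
      qed (use local_h in blast)
    qed
  next
    fix x0 :: real
    obtain \<mu> where \<mu>: "\<And>j. j < n \<Longrightarrow> \<mu> j analytic_on {of_real x0}"
      "\<forall>\<^sub>F s in nhds (complex_of_real x0). a s = (\<Prod>j<n. [:-\<mu> j s, 1:])"
      using local[of x0] by blast
    have "\<mu> j analytic_on {of_real x0}" if "j \<le> n - 1" for j
      using that n by (intro \<mu>(1)) linarith
    then obtain \<delta> where \<delta>: "\<delta> > 0" "\<And>j. j \<le> n - 1 \<Longrightarrow> \<mu> j holomorphic_on ball (of_real x0) \<delta>"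
      using analytic_common_ball by blast
    obtain \<epsilon> where \<epsilon>: "\<epsilon> > 0" "\<And>s. dist s (complex_of_real x0) < \<epsilon> \<Longrightarrow> a s = (\<Prod>j<n. [:-\<mu> j s, 1:])"
      using \<mu>(2) unfolding eventually_nhds_metric by blast
    define d where "d = min \<delta> \<epsilon>"
    have d: "d > 0"
      using \<delta>(1) \<epsilon>(1) by (simp add: d_def)
    have an: "\<mu> j analytic_on {of_real t}" if "j < n" "\<bar>t - x0\<bar> < d" for j t
    proof (rule holomorphic_on_imp_analytic_at)
      show "\<mu> j holomorphic_on ball (of_real x0) \<delta>"
        using \<delta>(2) that by simp
      show "complex_of_real t \<in> ball (of_real x0) \<delta>"
        using that by (simp add: d_def dist_of_real dist_real_def abs_minus_commute)
    qed simp
    have sp: "\<forall>\<^sub>F s in nhds (complex_of_real t). a s = (\<Prod>j<n. [:-\<mu> j s, 1:])" if "\<bar>t - x0\<bar> < d" for t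
    proof -
      have "\<forall>\<^sub>F s in nhds (complex_of_real t). s \<in> ball (of_real x0) \<epsilon>"
        using that by (intro eventually_nhds_in_open)
          (auto simp: d_def dist_of_real dist_real_def abs_minus_commute)
      then show ?thesis
        by eventually_elim (auto intro!: \<epsilon>(2) simp: dist_commute)
    qed
    show "\<exists>d>0. \<forall>x y. x \<le> x0 \<and> x0 \<le> y \<and> y - x < d \<longrightarrow> P x y"
    proof (intro exI[of _ d] conjI allI impI d)
      fix x y :: real assume xy: "x \<le> x0 \<and> x0 \<le> y \<and> y - x < d"
      then have near: "\<bar>t - x0\<bar> < d" if "t \<in> {x..y}" for t
        using that by auto
      show "P x y"
        unfolding P_def
      proof (intro allI impI)
        fix f assume f: "f analytic_on {complex_of_real x} \<and> (\<forall>\<^sub>F s in nhds (of_real x). poly (a s) (f s) = 0)"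
        have x: "\<bar>x - x0\<bar> < d"
          using near[of x] xy by simp
        obtain j where j: "j < n" "\<forall>\<^sub>F s in nhds (of_real x). f s = \<mu> j s"
          using analytic_germ_root_is_factor[OF conjunct1[OF f] conjunct2[OF f] an[OF _ x] sp[OF x]]
          by blast
        show "\<exists>g. g analytic_on (of_real ` {x..y}) \<and>
            (\<forall>t\<in>{x..y}. \<forall>\<^sub>F s in nhds (of_real t). poly (a s) (g s) = 0) \<and>
            (\<forall>\<^sub>F s in nhds (of_real x). g s = f s)"
        proof (intro exI[of _ "\<mu> j"] conjI ballI)
          show "\<mu> j analytic_on (of_real ` {x..y})"
            using an[OF j(1)] near by (subst analytic_on_analytic_at) auto
          show "\<forall>\<^sub>F s in nhds (of_real x). \<mu> j s = f s"
            using j(2) by eventually_elim simp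
          fix t assume "t \<in> {x..y}"
          show "\<forall>\<^sub>F s in nhds (complex_of_real t). poly (a s) (\<mu> j s) = 0"
            using sp[OF near[OF \<open>t \<in> {x..y}\<close>]]
            by eventually_elim (use j(1) in \<open>auto simp: poly_prod\<close>)
        qed
      qed
    qed
  qed
  obtain \<mu> where \<mu>: "\<And>j. j < n \<Longrightarrow> \<mu> j analytic_on {of_real x}"
      "\<forall>\<^sub>F s in nhds (complex_of_real x). a s = (\<Prod>j<n. [:-\<mu> j s, 1:])"
    using local[of x] by blast
  have "\<forall>\<^sub>F s in nhds (complex_of_real x). poly (a s) (\<mu> 0 s) = 0"
    using \<mu>(2) by eventually_elim (use n in \<open>auto simp: poly_prod\<close>)
  with \<open>P x y\<close> \<mu>(1)[OF n] obtain g where "g analytic_on (of_real ` {x..y})"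
      "\<forall>t\<in>{x..y}. \<forall>\<^sub>F s in nhds (complex_of_real t). poly (a s) (g s) = 0"
    unfolding P_def by blast
  then show ?thesis
    using that by blast
qed

lemma analytic_circle_power:
  assumes "f analytic_on sphere 0 1"
  shows "(\<lambda>w. f (w ^ K)) analytic_on sphere 0 1"
proof -
  have "f \<circ> (\<lambda>w. w ^ K) analytic_on sphere 0 1"
    by (rule analytic_on_compose_gen[OF _ assms]) (auto intro: analytic_intros simp: norm_power)
  then show ?thesis
    by (simp add: o_def)
qed

text \<open>The parameter \<open>s\<close> of the segment corresponds to \<open>w = exp (\<i> s / K)\<close>. The logarithm that inverts this map jumps
  at \<open>w = 1\<close>, where periodicity makes the two branches give the same function.\<close>

lemma analytic_circle_of_periodic:
  assumes g: "g analytic_on (of_real ` {0..2 * pi * real K})"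
    and periodic: "\<forall>\<^sub>F s in nhds 0. g (s + of_real (2 * pi * real K)) = g s"
  obtains L where "L analytic_on sphere 0 1"
    "\<And>w. w \<in> sphere 0 1 \<Longrightarrow> \<exists>t\<in>{0..2 * pi * real K}. exp (\<i> * of_real t) = w ^ K \<and> L w = g (of_real t)"
proof -
  define \<sigma> where "\<sigma> w = of_nat K * (of_real pi - \<i> * Ln (- w))" for w
  define L where "L w = g (\<sigma> w)" for w
  have \<sigma>_circle: "\<exists>t\<in>{0..2 * pi * real K}. exp (\<i> * of_real t) = w ^ K \<and> \<sigma> w = of_real t"
    if "w \<in> sphere 0 1" for w
  proof (intro bexI conjI)
    have nz: "w \<noteq> 0" and n1: "norm w = 1"
      using that by auto
    then have Ln: "Ln (- w) = \<i> * of_real (Arg (- w))"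
      using Ln_Arg[of "- w"] by simp
    then show \<sigma>: "\<sigma> w = of_real (real K * (pi + Arg (- w)))"
      by (simp add: \<sigma>_def algebra_simps)
    have "exp (\<i> * of_real (real K * (pi + Arg (- w)))) = exp (of_nat K * (\<i> * of_real pi + Ln (- w)))"
      by (simp add: Ln algebra_simps)
    also have "\<dots> = w ^ K"
      using nz by (simp add: exp_of_nat_mult exp_add exp_pi_i')
    finally show "exp (\<i> * of_real (real K * (pi + Arg (- w)))) = w ^ K" .
    have "pi + Arg (- w) \<ge> 0" "pi + Arg (- w) \<le> 2 * pi"
      using Arg_bounded[of "- w"] by auto
    then show "real K * (pi + Arg (- w)) \<in> {0..2 * pi * real K}"
      using mult_left_mono[of "pi + Arg (- w)" "2 * pi" "real K"] by (simp add: mult_ac)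
  qed
  have "L analytic_on {w}" if w: "w \<in> sphere 0 1" for w
  proof (cases "w = 1")
    case False
    have "- w \<notin> \<real>\<^sub>\<le>\<^sub>0"
    proof
      assume "- w \<in> \<real>\<^sub>\<le>\<^sub>0"
      then obtain r where "- w = of_real r" "r \<le> 0"
        by (metis nonpos_Reals_cases)
      then have "w = of_real (- r)"
        by (metis add.inverse_inverse of_real_minus)
      then show False
        using w False \<open>r \<le> 0\<close> by auto
    qed
    then have "\<sigma> analytic_on {w}"
      unfolding \<sigma>_def by (intro analytic_intros) auto
    moreover have "g analytic_on \<sigma> ` {w}"
      using \<sigma>_circle[OF w] by (auto intro: analytic_on_subset[OF g])
    ultimately show ?thesis
      unfolding L_def using analytic_on_compose[of \<sigma> "{w}" g] by (simp add: o_def)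
  next
    case True
    define \<tau> where "\<tau> w = of_nat K * (- \<i> * Ln w)" for w
    have \<tau>: "\<tau> analytic_on {1}"
      unfolding \<tau>_def by (intro analytic_intros) auto
    have "complex_of_real 0 \<in> of_real ` {0..2 * pi * real K}"
      by (intro imageI) auto
    then have "g analytic_on \<tau> ` {1}"
      by (auto simp: \<tau>_def intro: analytic_on_subset[OF g])
    then have "(\<lambda>w. g (\<tau> w)) analytic_on {1}"
      using analytic_on_compose[OF \<tau>, of g] by (simp add: o_def)
    moreover have "\<forall>\<^sub>F w in nhds 1. L w = g (\<tau> w)"
    proof -
      have "filterlim \<tau> (nhds 0) (nhds 1)"
      proof -
        have "isCont \<tau> 1"
          using \<tau> by (rule analytic_at_imp_isCont)
        then have "(\<tau> \<longlongrightarrow> \<tau> 1) (nhds 1)"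
          unfolding isCont_def by (simp only: tendsto_at_iff_tendsto_nhds)
        moreover have "\<tau> 1 = 0"
          by (simp add: \<tau>_def)
        ultimately show ?thesis by simp
      qed
      then have "\<forall>\<^sub>F w in nhds 1. g (\<tau> w + of_real (2 * pi * real K)) = g (\<tau> w)"
        using eventually_compose_filterlim[OF periodic] by blast
      moreover have "\<forall>\<^sub>F w in nhds (1::complex). w \<in> {w. Re w > 0}"
        by (intro eventually_nhds_in_open open_halfspace_Re_gt) simp
      ultimately show ?thesis
      proof eventually_elim
        case (elim w)
        then have nz: "w \<noteq> 0" and re: "Re w > 0"
          by auto
        show ?case
        proof (cases "Im w \<le> 0")
          case True
          then have "Ln (- w) = Ln w + \<i> * pi"
            using Ln_minus[OF nz] re by simp
          then have "\<sigma> w = \<tau> w + of_real (2 * pi * real K)"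
            by (simp add: \<sigma>_def \<tau>_def algebra_simps)
          then show ?thesis
            using elim by (simp add: L_def)
        next
          case False
          then have Ln_eq: "Ln (- w) = Ln w - \<i> * pi"
            by (subst Ln_minus[OF nz]) simp
          have "\<sigma> w = \<tau> w"
            unfolding \<sigma>_def \<tau>_def Ln_eq by (simp add: algebra_simps)
          then show ?thesis
            by (simp add: L_def)
        qed
      qed
    qed
    ultimately show ?thesis
      using True analytic_at_cong[of L "\<lambda>w. g (\<tau> w)" 1 1] by simp
  qed
  then have "L analytic_on sphere 0 1"
    by (subst analytic_on_analytic_at) blast
  then show ?thesis
    using that[of L] \<sigma>_circle unfolding L_def by metis
qed

text \<open>A root is followed \<open>n\<close> times round the circle. By the pigeonhole principle two of the \<open>n + 1\<close> germs obtained
  at the starting point agree, and the root closes up after the turns between them.\<close>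

lemma analytic_circle_root:
  assumes a: "analytic_monic (sphere 0 1) n a" and real: "\<And>z. z \<in> sphere 0 1 \<Longrightarrow> real_rooted (a z)"
    and n: "n > 0"
  obtains K L where "K > 0" "L analytic_on sphere 0 1" "\<And>w. w \<in> sphere 0 1 \<Longrightarrow> poly (a (w ^ K)) (L w) = 0"
proof -
  define b where "b s = a (exp (\<i> * s))" for s
  have b: "analytic_monic \<real> n b"
  proof -
    have "(\<lambda>s. coeff (b s) k) analytic_on \<real>" for k
    proof -
      have "(\<lambda>z. coeff (a z) k) \<circ> (\<lambda>s. exp (\<i> * s)) analytic_on \<real>"
      proof (rule analytic_on_compose_gen)
        show "(\<lambda>z. coeff (a z) k) analytic_on sphere 0 1"
          using a by (simp add: analytic_monic_def)
        show "exp (\<i> * s) \<in> sphere 0 1" if "s \<in> \<real>" for s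
          using that by (auto elim!: Reals_cases)
      qed (intro analytic_intros)
      then show ?thesis
        by (simp add: b_def o_def)
    qed
    moreover have "degree (b s) = n \<and> lead_coeff (b s) = 1" for s
      using a unfolding analytic_monic_def b_def by blast
    ultimately show ?thesis
      unfolding analytic_monic_def by blast
  qed
  have b_real: "real_rooted (b s)" if "s \<in> \<real>" for s
    unfolding b_def using that by (intro real) (auto elim!: Reals_cases)
  have b_per: "b (s + of_real (2 * pi * real k)) = b s" for s k
  proof -
    have "exp (\<i> * (s + of_real (2 * pi * real k))) = exp (\<i> * s) * exp (of_nat k * (2 * of_real pi * \<i>))"
      unfolding exp_add[symmetric] by (rule arg_cong[of _ _ exp]) (simp add: algebra_simps)
    then show ?thesis
      by (simp add: b_def exp_of_nat_mult)
  qed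
  obtain f where f: "f analytic_on (of_real ` {0..2 * pi * real n})"
    "\<And>t. t \<in> {0..2 * pi * real n} \<Longrightarrow> \<forall>\<^sub>F s in nhds (complex_of_real t). poly (b s) (f s) = 0"
    using analytic_root_on_segment[OF b b_real n, of 0 "2 * pi * real n"] by auto
  define F where "F k s = f (s + of_real (2 * pi * real k))" for k s
  have F_an: "F k analytic_on {of_real t}" if "t + 2 * pi * real k \<in> {0..2 * pi * real n}" for k t
  proof -
    have "f analytic_on (\<lambda>s. s + of_real (2 * pi * real k)) ` {of_real t}"
    proof (rule analytic_on_subset[OF f(1)])
      have "complex_of_real t + of_real (2 * pi * real k) = of_real (t + 2 * pi * real k)"
        by simp
      then show "(\<lambda>s. s + of_real (2 * pi * real k)) ` {complex_of_real t} \<subseteq> of_real ` {0..2 * pi * real n}"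
        using that by blast
    qed
    then show ?thesis
    proof -
      assume "f analytic_on (\<lambda>s. s + of_real (2 * pi * real k)) ` {complex_of_real t}"
      then have "f \<circ> (\<lambda>s. s + of_real (2 * pi * real k)) analytic_on {of_real t}"
        by (intro analytic_on_compose analytic_intros)
      then show ?thesis
        unfolding F_def o_def .
    qed
  qed
  have F_root: "\<forall>\<^sub>F s in nhds (of_real t). poly (b s) (F k s) = 0"
    if "t + 2 * pi * real k \<in> {0..2 * pi * real n}" for k t
  proof -
    have "filterlim (\<lambda>s. s + of_real (2 * pi * real k)) (nhds (of_real (t + 2 * pi * real k))) (nhds (complex_of_real t))"
      by (rule tendsto_eq_intros refl filterlim_ident | simp)+
    from eventually_compose_filterlim[OF f(2)[OF that] this] show ?thesis
      by (simp only: b_per F_def)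
  qed
  obtain \<mu> where \<mu>: "\<And>j. j < n \<Longrightarrow> \<mu> j analytic_on {0}" "\<forall>\<^sub>F s in nhds 0. b s = (\<Prod>j<n. [:-\<mu> j s, 1:])"
  proof -
    have "analytic_monic {0} n b"
    proof -
      have "f analytic_on {0}" if "f analytic_on \<real>" for f :: "complex \<Rightarrow> complex"
        using that by (rule analytic_on_subset) simp
      then show ?thesis
        using b unfolding analytic_monic_def by blast
    qed
    moreover have "\<forall>\<^sub>F s in at 0 within \<real>. real_rooted (b s)"
      using b_real by (auto simp: eventually_at_filter)
    ultimately show ?thesis
      using analytic_rellich_local[of 0 n b] that by auto
  qed
  \<comment> \<open>The \<open>n + 1\<close> shifts of \<open>f\<close> are among the \<open>n\<close> local roots.\<close>
  have "\<exists>j<n. \<forall>\<^sub>F s in nhds 0. F k s = \<mu> j s" if "k \<le> n" for k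
  proof (rule analytic_germ_root_is_factor[OF _ _ \<mu>])
    have k: "0 + 2 * pi * real k \<in> {0..2 * pi * real n}"
      using that by simp
    show "F k analytic_on {0}"
      using F_an[OF k] by simp
    show "\<forall>\<^sub>F s in nhds 0. poly (b s) (F k s) = 0"
      using F_root[OF k] by simp
  qed
  then obtain J where J: "\<And>k. k \<le> n \<Longrightarrow> J k < n \<and> (\<forall>\<^sub>F s in nhds 0. F k s = \<mu> (J k) s)"
    by metis
  have "\<not> inj_on J {..n}"
  proof
    assume "inj_on J {..n}"
    then have "card {..n} \<le> card {..<n}"
      using J by (intro card_inj_on_le[of J]) auto
    then show False by simp
  qed
  then obtain k l where kl: "k \<le> n" "l \<le> n" "k < l" "J k = J l"
    unfolding inj_on_def by (metis atMost_iff linorder_neqE_nat)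
  define K where "K = l - k"
  have K: "K > 0" "k + K = l"
    using kl by (auto simp: K_def)
  have seg: "t + 2 * pi * real k \<in> {0..2 * pi * real n}" if "t \<in> {0..2 * pi * real K}" for t
  proof -
    have "t + 2 * pi * real k \<le> 2 * pi * real K + 2 * pi * real k"
      using that by simp
    also have "\<dots> = 2 * pi * real l"
      unfolding K(2)[symmetric] by (simp add: algebra_simps)
    also have "\<dots> \<le> 2 * pi * real n"
      using kl by simp
    finally show ?thesis
      using that by simp
  qed
  have "F k analytic_on (of_real ` {0..2 * pi * real K})"
    using F_an seg by (subst analytic_on_analytic_at) auto
  moreover have "\<forall>\<^sub>F s in nhds 0. F k (s + of_real (2 * pi * real K)) = F k s"
  proof -
    have "F k (s + of_real (2 * pi * real K)) = F l s" for s
      unfolding F_def K(2)[symmetric] by (simp add: algebra_simps)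
    moreover have "\<forall>\<^sub>F s in nhds 0. F l s = F k s"
      using J[OF kl(1)] J[OF kl(2)] kl(4) by (auto elim: eventually_elim2)
    ultimately show ?thesis by simp
  qed
  ultimately obtain L where L: "L analytic_on sphere 0 1"
    "\<And>w. w \<in> sphere 0 1 \<Longrightarrow> \<exists>t\<in>{0..2 * pi * real K}. exp (\<i> * of_real t) = w ^ K \<and> L w = F k (of_real t)"
    using analytic_circle_of_periodic[of "F k" K] by blast
  have "poly (a (w ^ K)) (L w) = 0" if w: "w \<in> sphere 0 1" for w
  proof -
    obtain t where t: "t \<in> {0..2 * pi * real K}" "exp (\<i> * of_real t) = w ^ K" "L w = F k (of_real t)"
      using L(2)[OF w] by blast
    have "poly (b (of_real t)) (F k (of_real t)) = 0"
      using F_root[OF seg[OF t(1)]] by (rule eventually_nhds_x_imp_x)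
    then show ?thesis
      by (simp add: b_def t)
  qed
  then show ?thesis
    using that K(1) L(1) by blast
qed

text \<open>The quotient by the linear factor of one root is again real-rooted.\<close>

lemma analytic_circle_split:
  assumes "analytic_monic (sphere 0 1) n a" "\<And>z. z \<in> sphere 0 1 \<Longrightarrow> real_rooted (a z)"
  shows "\<exists>K>0. \<exists>\<mu>. (\<forall>j<n. \<mu> j analytic_on sphere 0 1) \<and>
    (\<forall>w\<in>sphere 0 1. a (w ^ K) = (\<Prod>j<n. [:-\<mu> j w, 1:]))"
  using assms
proof (induction n arbitrary: a)
  case 0
  have "a w = 1" for w
  proof -
    have "degree (a w) = 0" "coeff (a w) 0 = 1"
      using 0(1) unfolding analytic_monic_def by metis+
    then show ?thesis
      by (metis degree_0_id one_pCons of_nat_1 degree_eq_zeroE coeff_pCons_0)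
  qed
  then show ?case
    by (intro exI[of _ 1]) auto
next
  case (Suc n)
  obtain K0 L where K0: "K0 > 0" "L analytic_on sphere 0 1"
      "\<And>w. w \<in> sphere 0 1 \<Longrightarrow> poly (a (w ^ K0)) (L w) = 0"
    using analytic_circle_root[OF Suc.prems] by blast
  define l where "l w = [:- L w, 1:]" for w
  define b where "b w = a (w ^ K0) div l w" for w
  have "analytic_monic (sphere 0 1) 1 l"
    unfolding analytic_monic_iff l_def using K0(2) by (auto intro!: analytic_coeffs_linear analytic_intros)
  moreover have "analytic_monic (sphere 0 1) (Suc n) (\<lambda>w. a (w ^ K0))"
    using Suc.prems(1) analytic_circle_power unfolding analytic_monic_def by blast
  ultimately have b: "analytic_monic (sphere 0 1) n b"
    unfolding b_def using analytic_monic_div[of "sphere 0 1" 1 l "Suc n"] by simp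
  have a_eq: "a (w ^ K0) = l w * b w" if "w \<in> sphere 0 1" for w
  proof -
    have "l w dvd a (w ^ K0)"
      unfolding l_def using K0(3)[OF that] by (simp add: poly_eq_0_iff_dvd)
    then show ?thesis
      by (simp add: b_def)
  qed
  have "real_rooted (b w)" if "w \<in> sphere 0 1" for w
  proof -
    have "w ^ K0 \<in> sphere 0 1"
      using that by (simp add: norm_power)
    from Suc.prems(2)[OF this] show ?thesis
      unfolding a_eq[OF that] by (simp add: real_rooted_def)
  qed
  from Suc.IH[OF b this] obtain K1 \<nu> where K1: "K1 > 0" "\<And>j. j < n \<Longrightarrow> \<nu> j analytic_on sphere 0 1"
    "\<And>w. w \<in> sphere 0 1 \<Longrightarrow> b (w ^ K1) = (\<Prod>j<n. [:-\<nu> j w, 1:])"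
    by blast
  define \<mu> where "\<mu> j w = (case j of 0 \<Rightarrow> L (w ^ K1) | Suc i \<Rightarrow> \<nu> i w)" for j w
  show ?case
  proof (intro exI[of _ "K1 * K0"] conjI exI[of _ \<mu>] allI impI ballI)
    fix j assume "j < Suc n"
    then show "\<mu> j analytic_on sphere 0 1"
      unfolding \<mu>_def using analytic_circle_power[OF K0(2)] K1(2) by (cases j) auto
  next
    fix w :: complex assume w: "w \<in> sphere 0 1"
    then have "w ^ K1 \<in> sphere 0 1"
      by (simp add: norm_power)
    then have "a (w ^ (K1 * K0)) = l (w ^ K1) * b (w ^ K1)"
      using a_eq[of "w ^ K1"] by (simp add: power_mult)
    also have "\<dots> = (\<Prod>j<Suc n. [:-\<mu> j w, 1:])"
      unfolding prod.lessThan_Suc_shift K1(3)[OF w] by (simp add: \<mu>_def l_def)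
    finally show "a (w ^ (K1 * K0)) = (\<Prod>j<Suc n. [:-\<mu> j w, 1:])" .
  qed (use K0 K1 in simp)
qed

section \<open>Hermitian matrices at a point\<close>

text \<open>A maximum \<open>e\<close> of the quadratic form on the unit sphere of the subspace is an eigenvector, since the form
  increases in the direction of \<open>T e - r e\<close> unless this vector is zero.\<close>

lemma self_adjoint_eigenvector_in_subspace:
  fixes T :: "'a::euclidean_space \<Rightarrow> 'a"
  assumes T: "linear T" and sa: "\<And>x y. T x \<bullet> y = x \<bullet> T y"
    and W: "subspace W" and inv: "\<And>x. x \<in> W \<Longrightarrow> T x \<in> W" and w0: "w0 \<in> W" "w0 \<noteq> 0"
  obtains e r where "e \<in> W" "e \<noteq> 0" "T e = r *\<^sub>R e"
proof -
  define C where "C = W \<inter> sphere 0 1"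
  have "compact C"
    unfolding C_def using closed_subspace[OF W] by (intro closed_Int_compact) auto
  moreover have sgn: "sgn x \<in> C" if "x \<in> W" "x \<noteq> 0" for x
  proof -
    have "sgn x \<in> W"
      unfolding sgn_div_norm using W that(1) by (rule subspace_scale)
    then show ?thesis
      using that(2) by (simp add: C_def norm_sgn)
  qed
  moreover have "continuous_on C (\<lambda>x. x \<bullet> T x)"
    by (intro continuous_on_inner continuous_on_id linear_continuous_on T[unfolded linear_conv_bounded_linear])
  ultimately obtain e where e: "e \<in> C" "\<And>x. x \<in> C \<Longrightarrow> x \<bullet> T x \<le> e \<bullet> T e"
    using continuous_attains_sup[of C "\<lambda>x. x \<bullet> T x"] sgn[OF w0] by blast
  define r where "r = e \<bullet> T e"
  have eW: "e \<in> W" and ee: "e \<bullet> e = 1"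
    using e(1) by (auto simp: C_def norm_eq_1)
  have bound: "x \<bullet> T x \<le> r * (x \<bullet> x)" if "x \<in> W" for x
  proof (cases "x = 0")
    case False
    from e(2)[OF sgn[OF that False]] have "(x \<bullet> T x) / (norm x)\<^sup>2 \<le> r"
      by (simp add: r_def sgn_div_norm linear_scale[OF T] power2_eq_square divide_inverse mult_ac)
    then show ?thesis
      using False by (simp add: pos_divide_le_eq power2_norm_eq_inner)
  qed (simp add: linear_0[OF T])
  define f where "f = T e - r *\<^sub>R e"
  have fW: "f \<in> W"
    unfolding f_def using eW inv W by (intro subspace_diff subspace_scale) auto
  define c where "c = f \<bullet> T f - r * (f \<bullet> f)"
  have quad: "2 * t * (f \<bullet> f) + t\<^sup>2 * c \<le> 0" for t
  proof -
    have "e + t *\<^sub>R f \<in> W"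
      using eW fW W by (intro subspace_add subspace_scale)
    from bound[OF this] have "(e + t *\<^sub>R f) \<bullet> T (e + t *\<^sub>R f) \<le> r * ((e + t *\<^sub>R f) \<bullet> (e + t *\<^sub>R f))" .
    also have "(e + t *\<^sub>R f) \<bullet> T (e + t *\<^sub>R f) = r + 2 * t * (f \<bullet> T e) + t\<^sup>2 * (f \<bullet> T f)"
      using sa[of f e] inner_commute[of "T e" f]
      by (simp add: linear_add[OF T] linear_scale[OF T] inner_add_left inner_add_right r_def power2_eq_square
          inner_commute[of "T f" e] sa[of e f, symmetric] ring_distribs)
    also have "(e + t *\<^sub>R f) \<bullet> (e + t *\<^sub>R f) = 1 + 2 * t * (f \<bullet> e) + t\<^sup>2 * (f \<bullet> f)"
      by (simp add: inner_add_left inner_add_right ee power2_eq_square inner_commute[of e f] ring_distribs)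
    finally have "2 * t * (f \<bullet> T e - r * (f \<bullet> e)) + t\<^sup>2 * c \<le> 0"
      by (simp add: c_def algebra_simps)
    moreover have "f \<bullet> T e - r * (f \<bullet> e) = f \<bullet> f"
      by (simp add: f_def inner_diff_right inner_diff_left)
    ultimately show ?thesis by simp
  qed
  have "f = 0"
  proof (rule ccontr)
    assume "f \<noteq> 0"
    then have N: "f \<bullet> f > 0" by simp
    \<comment> \<open>For such a small step the linear term outweighs the quadratic one.\<close>
    define t where "t = (f \<bullet> f) / (1 + \<bar>c\<bar>)"
    have t: "t > 0" "t * \<bar>c\<bar> < f \<bullet> f"
      using N by (auto simp: t_def field_simps)
    have "t * (2 * (f \<bullet> f) + t * c) \<le> 0"
      using quad[of t] by (simp add: power2_eq_square algebra_simps)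
    then have "2 * (f \<bullet> f) + t * c \<le> 0"
      using t(1) by (simp add: mult_le_0_iff)
    moreover have "t * - \<bar>c\<bar> \<le> t * c"
      using t(1) by (intro mult_left_mono) auto
    ultimately show False
      using t N by simp
  qed
  then have "T e = r *\<^sub>R e"
    by (simp add: f_def)
  then show ?thesis
    using that eW ee by force
qed

primrec eliminate :: "('a::real_vector \<Rightarrow> 'a) \<Rightarrow> (nat \<Rightarrow> real) \<Rightarrow> nat \<Rightarrow> 'a \<Rightarrow> 'a" where
  "eliminate T c 0 y = y"
| "eliminate T c (Suc k) y = T (eliminate T c k y) - c k *\<^sub>R eliminate T c k y"

lemma eliminate_linear: "linear T \<Longrightarrow> linear (eliminate T c k)"
proof (induction k)
  case 0
  have "eliminate T c 0 = id"
    by (simp add: fun_eq_iff)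
  then show ?case
    using linear_id by (simp only:)
next
  case (Suc k)
  then show ?case
    by (intro linearI) (simp_all add: linear_add linear_scale algebra_simps)
qed

lemma eliminate_commute:
  "linear T \<Longrightarrow> eliminate T c k (T y) = T (eliminate T c k y)"
  by (induction k) (simp_all add: linear_diff linear_scale)

lemma eliminate_self_adjoint:
  fixes T :: "'a::real_inner \<Rightarrow> 'a"
  assumes "linear T" and sa: "\<And>x y. T x \<bullet> y = x \<bullet> T y"
  shows "eliminate T c k x \<bullet> y = x \<bullet> eliminate T c k y"
proof (induction k arbitrary: x y)
  case (Suc k)
  have "eliminate T c (Suc k) x \<bullet> y = eliminate T c k x \<bullet> (T y - c k *\<^sub>R y)"
    by (simp add: inner_diff_left inner_diff_right sa)
  also have "\<dots> = x \<bullet> eliminate T c k (T y - c k *\<^sub>R y)"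
    by (rule Suc)
  also have "eliminate T c k (T y - c k *\<^sub>R y) = eliminate T c (Suc k) y"
    using eliminate_linear[OF assms(1)] assms(1)
    by (simp add: linear_diff linear_scale eliminate_commute)
  finally show ?case .
qed simp

lemma eliminate_eigenvector:
  assumes "linear T" "T e = r *\<^sub>R e"
  shows "eliminate T c k e = (\<Prod>i<k. r - c i) *\<^sub>R e"
  by (induction k) (simp_all add: linear_scale[OF assms(1)] assms(2) algebra_simps)

text \<open>The composition of the maps \<open>T - c\<^sub>j\<close> is self-adjoint and its range is invariant under \<open>T\<close>. If the range were
  not zero, it would contain an eigenvector of \<open>T\<close>; this is annihilated by the composition, thus orthogonal to the
  range and hence to itself.\<close>

lemma eliminate_all_eigenvalues:
  fixes T :: "'a::euclidean_space \<Rightarrow> 'a"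
  assumes T: "linear T" and sa: "\<And>x y. T x \<bullet> y = x \<bullet> T y"
    and eig: "\<And>r e. e \<noteq> 0 \<Longrightarrow> T e = r *\<^sub>R e \<Longrightarrow> \<exists>j<n. c j = r"
  shows "eliminate T c n y = 0"
proof (rule ccontr)
  assume nz: "eliminate T c n y \<noteq> 0"
  let ?W = "range (eliminate T c n)"
  have lin: "linear (eliminate T c n)"
    using T by (rule eliminate_linear)
  have "subspace ?W"
    using lin by (rule linear_subspace_image) simp
  moreover have "T x \<in> ?W" if "x \<in> ?W" for x
    using that by (auto simp: eliminate_commute[OF T, symmetric])
  ultimately obtain e r where e: "e \<in> ?W" "e \<noteq> 0" "T e = r *\<^sub>R e"
    using self_adjoint_eigenvector_in_subspace[OF T sa, of ?W "eliminate T c n y"] nz by blast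
  obtain j where "j < n" "c j = r"
    using eig[OF e(2,3)] by blast
  then have "eliminate T c n e = 0"
    by (auto simp: eliminate_eigenvector[OF T e(3)])
  moreover obtain x where "e = eliminate T c n x"
    using e(1) by blast
  then have "e \<bullet> e = x \<bullet> eliminate T c n e"
    using eliminate_self_adjoint[OF T sa, of c n x e] by simp
  ultimately show False
    using e(2) by simp
qed

definition hermitian :: "complex^'n^'n \<Rightarrow> bool" where
  "hermitian M \<longleftrightarrow> (\<forall>i j. M $ i $ j = cnj (M $ j $ i))"

lemma scaleR_eq_of_real_scale: "c *\<^sub>R x = of_real c *s (x :: complex^'n)"
  by (simp add: vec_eq_iff scaleR_conv_of_real[where 'a = complex])

lemma linear_matrix_vector_mult: "linear ((*v) (M :: complex^'n^'m))"
  by (rule linearI) (simp_all add: matrix_vector_right_distrib scaleR_eq_of_real_scale vector_scalar_commute)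

lemma inner_complex_Re: "inner (a::complex) b = Re (a * cnj b)"
  by (simp add: inner_complex_def)

lemma hermitian_self_adjoint:
  fixes M :: "complex^'n^'n"
  assumes "hermitian M"
  shows "(M *v x) \<bullet> y = x \<bullet> (M *v y)"
proof -
  have "(M *v x) \<bullet> y = (\<Sum>i\<in>UNIV. \<Sum>j\<in>UNIV. Re (M $ i $ j * x $ j * cnj (y $ i)))"
    by (simp add: inner_vec_def matrix_vector_mult_def inner_complex_Re sum_distrib_right)
  also have "\<dots> = (\<Sum>j\<in>UNIV. \<Sum>i\<in>UNIV. Re (M $ i $ j * x $ j * cnj (y $ i)))"
    by (rule sum.swap)
  also have "\<dots> = (\<Sum>j\<in>UNIV. \<Sum>i\<in>UNIV. Re (x $ j * cnj (M $ j $ i * y $ i)))"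
  proof (intro sum.cong refl)
    fix i j
    have "M $ i $ j = cnj (M $ j $ i)"
      using assms unfolding hermitian_def by blast
    then show "Re (M $ i $ j * x $ j * cnj (y $ i)) = Re (x $ j * cnj (M $ j $ i * y $ i))"
      by (simp add: mult_ac)
  qed
  also have "\<dots> = x \<bullet> (M *v y)"
    by (simp add: inner_vec_def matrix_vector_mult_def inner_complex_Re sum_distrib_left)
  finally show ?thesis .
qed

lemma hermitian_eigenvalue_real:
  fixes M :: "complex^'n^'n"
  assumes M: "hermitian M" and v: "v \<noteq> 0" "M *v v = x *s v"
  shows "x \<in> \<real>"
proof -
  have "(M *v v) \<bullet> (\<i> *s v) = v \<bullet> (M *v (\<i> *s v))"
    using M by (rule hermitian_self_adjoint)
  also have "M *v (\<i> *s v) = \<i> *s (x *s v)"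
    by (simp add: vector_scalar_commute v(2))
  finally have "(\<Sum>i\<in>UNIV. Re (x * v $ i * cnj (\<i> * v $ i))) = (\<Sum>i\<in>UNIV. Re (v $ i * cnj (\<i> * (x * v $ i))))"
    by (simp add: v(2) inner_vec_def inner_complex_Re)
  moreover have "Re (x * z * cnj (\<i> * z)) = Im x * (norm z)\<^sup>2" "Re (z * cnj (\<i> * (x * z))) = - (Im x * (norm z)\<^sup>2)" for z
    unfolding cmod_power2 by (simp_all add: power2_eq_square algebra_simps)
  ultimately have "Im x * (\<Sum>i\<in>UNIV. (norm (v $ i))\<^sup>2) = - (Im x * (\<Sum>i\<in>UNIV. (norm (v $ i))\<^sup>2))"
    by (simp add: sum_distrib_left sum_negf)
  moreover have "(\<Sum>i\<in>UNIV. (norm (v $ i))\<^sup>2) > 0"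
  proof -
    obtain i where "v $ i \<noteq> 0"
      using v(1) by (auto simp: vec_eq_iff)
    then show ?thesis
      by (intro sum_pos2[of _ i]) auto
  qed
  ultimately have "Im x = 0"
    by auto
  then show ?thesis
    by (simp add: complex_is_Real_iff)
qed

subsection \<open>The characteristic polynomial\<close>

definition charpoly :: "complex^'n^'n \<Rightarrow> complex poly" where
  "charpoly M = det (\<chi> i j. [:- M $ i $ j, of_bool (i = j):])"

lemma poly_charpoly: "poly (charpoly M) x = det (mat x - M)"
proof -
  have "poly (of_int k) x = of_int k" for k
    by (metis of_int_poly poly_const_conv)
  then show ?thesis
    unfolding charpoly_def det_def
    by (auto simp: poly_sum poly_prod mat_def intro!: sum.cong prod.cong)
qed

text \<open>In the Leibniz expansion only the identity permutation contributes in degree \<open>n\<close>.\<close>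

lemma charpoly_monic:
  fixes M :: "complex^'n^'n"
  shows "degree (charpoly M) = CARD('n)" "lead_coeff (charpoly M) = 1"
proof -
  let ?n = "CARD('n)"
  let ?A = "\<chi> i j. [:- M $ i $ j, of_bool (i = j):]"
  let ?P = "{p. p permutes (UNIV :: 'n set)}"
  define t where "t p = of_int (sign p) * (\<Prod>i\<in>UNIV. ?A $ i $ p i)" for p
  have fin: "finite ?P"
    by (simp add: finite_permutations)
  have "charpoly M = t id + (\<Sum>p\<in>?P - {id}. t p)"
    unfolding charpoly_def det_def t_def[symmetric]
    using fin by (rule sum.remove) (simp add: permutes_id)
  moreover have t_id: "t id = (\<Prod>i\<in>UNIV. [:- M $ i $ i, 1:])"
    by (simp add: t_def)
  have lead: "lead_coeff (t id) = 1"
    unfolding t_id by (simp add: lead_coeff_prod)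
  have deg_id: "degree (t id) = ?n"
  proof -
    have "degree (t id) = (\<Sum>i\<in>(UNIV::'n set). degree [:- M $ i $ i, 1:])"
      unfolding t_id by (rule degree_prod_eq_sum_degree) auto
    then show ?thesis by simp
  qed
  have "degree (t p) < ?n" if p: "p \<in> ?P - {id}" for p
  proof -
    obtain i where i: "p i \<noteq> i"
      using p by (auto simp: fun_eq_iff)
    have "degree (t p) \<le> degree (of_int (sign p) :: complex poly) + degree (\<Prod>i\<in>UNIV. ?A $ i $ p i)"
      unfolding t_def by (rule degree_mult_le)
    also have "\<dots> = degree (\<Prod>i\<in>UNIV. ?A $ i $ p i)"
      by simp
    also have "\<dots> \<le> (\<Sum>i\<in>UNIV. degree (?A $ i $ p i))"
      using degree_prod_sum_le[of UNIV "\<lambda>i. ?A $ i $ p i"] by (simp add: o_def)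
    also have "\<dots> < (\<Sum>i\<in>(UNIV::'n set). 1)"
      using i[symmetric] by (intro sum_strict_mono_ex1) auto
    finally show ?thesis by simp
  qed
  then have "degree (\<Sum>p\<in>?P - {id}. t p) < ?n"
    by (intro degree_sum_less) auto
  ultimately show "degree (charpoly M) = ?n" "lead_coeff (charpoly M) = 1"
    using lead deg_id by (simp_all add: degree_add_eq_left lead_coeff_add_le coeff_eq_0)
qed

lemma charpoly_root_iff:
  fixes M :: "complex^'n^'n"
  shows "poly (charpoly M) x = 0 \<longleftrightarrow> (\<exists>v. v \<noteq> 0 \<and> M *v v = x *s v)"
proof -
  have diff: "(mat x - M) *v v = x *s v - M *v v" for v
  proof -
    have "mat x *v v = x *s v"
      by (simp add: vec_eq_iff matrix_vector_mult_def mat_def if_distrib[of "\<lambda>a. a * _"] cong: if_cong)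
    then show ?thesis
      by (simp add: matrix_vector_mult_diff_rdistrib)
  qed
  have "poly (charpoly M) x = 0 \<longleftrightarrow> \<not> invertible (mat x - M)"
    by (simp add: poly_charpoly invertible_det_nz)
  also have "\<dots> \<longleftrightarrow> (\<exists>v. v \<noteq> 0 \<and> (mat x - M) *v v = 0)"
    unfolding invertible_left_inverse matrix_left_invertible_ker by blast
  finally show ?thesis
    by (simp add: diff eq_commute[of "M *v _"])
qed

lemma hermitian_charpoly_real_rooted: "hermitian M \<Longrightarrow> real_rooted (charpoly M)"
  unfolding real_rooted_def charpoly_root_iff using hermitian_eigenvalue_real by blast

section \<open>An analytic eigenvector\<close>

definition analytic_mat :: "complex set \<Rightarrow> (complex \<Rightarrow> complex^'n^'m) \<Rightarrow> bool" where
  "analytic_mat S M \<longleftrightarrow> (\<forall>i j. (\<lambda>z. M z $ i $ j) analytic_on S)"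

definition analytic_vec :: "complex set \<Rightarrow> (complex \<Rightarrow> complex^'n) \<Rightarrow> bool" where
  "analytic_vec S v \<longleftrightarrow> (\<forall>i. (\<lambda>z. v z $ i) analytic_on S)"

lemma analytic_charpoly:
  fixes M :: "complex \<Rightarrow> complex^'n^'n"
  assumes "analytic_mat S M"
  shows "analytic_monic S CARD('n) (\<lambda>z. charpoly (M z))"
proof -
  have "analytic_coeffs S (\<lambda>z. charpoly (M z))"
    unfolding charpoly_def det_def using assms unfolding analytic_mat_def
    by (auto intro!: analytic_coeffs_sum analytic_coeffs_mult analytic_coeffs_const analytic_coeffs_prod
        analytic_coeffs_linear analytic_intros)
  then show ?thesis
    unfolding analytic_monic_iff using charpoly_monic by blast
qed

lemma analytic_vec_mult:
  "analytic_mat S M \<Longrightarrow> analytic_vec S v \<Longrightarrow> analytic_vec S (\<lambda>z. M z *v v z)"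
  unfolding analytic_vec_def analytic_mat_def matrix_vector_mult_def by (auto intro!: analytic_intros)

lemma analytic_vec_scale:
  "c analytic_on S \<Longrightarrow> analytic_vec S v \<Longrightarrow> analytic_vec S (\<lambda>z. c z *s v z)"
  unfolding analytic_vec_def by (auto intro!: analytic_intros)

lemma analytic_vec_diff:
  "analytic_vec S u \<Longrightarrow> analytic_vec S v \<Longrightarrow> analytic_vec S (\<lambda>z. u z - v z)"
  unfolding analytic_vec_def by (auto intro!: analytic_intros)

lemma analytic_vec_sum:
  "(\<And>i. i \<in> I \<Longrightarrow> analytic_vec S (v i)) \<Longrightarrow> analytic_vec S (\<lambda>z. \<Sum>i\<in>I. v i z)"
  unfolding analytic_vec_def by (auto intro!: analytic_intros)

lemma analytic_vec_const: "analytic_vec S (\<lambda>_. c)"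
  by (simp add: analytic_vec_def)

lemma circle_root_exists:
  assumes "z \<in> sphere 0 1" "K > 0"
  obtains w where "w \<in> sphere 0 1" "w ^ K = (z::complex)"
proof
  have "z = exp (\<i> * of_real (Arg z))"
    using assms(1) Arg_eq[of z] by (cases "z = 0") auto
  then show "exp (\<i> * of_real (Arg z / real K)) ^ K = z"
    using assms(2) by (simp flip: exp_of_nat_mult)
  show "exp (\<i> * of_real (Arg z / real K)) \<in> sphere 0 1"
    using norm_exp_i_times[of "Arg z / real K"] by simp
qed

text \<open>Starting from a constant vector, \<open>y\<^sub>k\<^sub>+\<^sub>1 = (H - \<mu>\<^sub>k) y\<^sub>k\<close> reaches zero after all eigenvalues have been used. At the last
  stage with \<open>H y\<^sub>k\<close> not identically zero, \<open>H y\<^sub>k\<close> is annihilated by \<open>H - \<mu>\<^sub>k\<close>. Working with \<open>H y\<^sub>k\<close> in place of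
  \<open>y\<^sub>k\<close> forces the eigenvalue to be nonzero, which makes the eigenvector orthogonal to the kernel of \<open>H\<close>.\<close>

lemma analytic_eigenvector:
  fixes H :: "complex \<Rightarrow> complex^'n^'n"
  assumes H: "analytic_mat (sphere 0 1) H" and herm: "\<And>z. z \<in> sphere 0 1 \<Longrightarrow> hermitian (H z)"
    and z0: "z0 \<in> sphere 0 1" "H z0 \<noteq> 0"
  obtains K l v where "K > 0" "l analytic_on sphere 0 1" "analytic_vec (sphere 0 1) v"
    "\<And>w. w \<in> sphere 0 1 \<Longrightarrow> H (w ^ K) *v v w = l w *s v w"
    "\<exists>w\<in>sphere 0 1. l w \<noteq> 0" "\<exists>w\<in>sphere 0 1. v w \<noteq> 0"
proof -
  let ?S = "sphere 0 (1::real) :: complex set"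
  let ?n = "CARD('n)"
  obtain K \<mu> where K: "K > 0" and \<mu>: "\<And>j. j < ?n \<Longrightarrow> \<mu> j analytic_on ?S"
    "\<And>w. w \<in> ?S \<Longrightarrow> charpoly (H (w ^ K)) = (\<Prod>j<?n. [:-\<mu> j w, 1:])"
    using analytic_circle_split[OF analytic_charpoly[OF H]] hermitian_charpoly_real_rooted[OF herm] by blast
  define H' where "H' w = H (w ^ K)" for w
  have H': "analytic_mat ?S H'"
    using H analytic_circle_power unfolding analytic_mat_def H'_def by blast
  have pow: "w ^ K \<in> ?S" if "w \<in> ?S" for w
    using that by (simp add: norm_power)
  have herm': "hermitian (H' w)" if "w \<in> ?S" for w
    unfolding H'_def using herm[OF pow[OF that]] .
  obtain w0 where w0: "w0 \<in> ?S" "w0 ^ K = z0"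
    using circle_root_exists[OF z0(1) K] .
  obtain a b where ab: "H z0 $ a $ b \<noteq> 0"
    using z0(2) by (auto simp: vec_eq_iff)
  define y where "y = rec_nat (\<lambda>w. axis b 1) (\<lambda>k yk w. H' w *v yk w - \<mu> k w *s yk w)"
  have y0: "y 0 w = axis b 1" and y_Suc: "y (Suc k) w = H' w *v y k w - \<mu> k w *s y k w" for k w
    by (simp_all add: y_def)
  have y_an: "analytic_vec ?S (y k)" if "k \<le> ?n" for k
    using that
  proof (induction k)
    case 0
    then show ?case by (simp add: y_def analytic_vec_const)
  next
    case (Suc k)
    then show ?case
      unfolding y_Suc[abs_def] using H' \<mu>(1)[of k]
      by (intro analytic_vec_diff analytic_vec_mult analytic_vec_scale) auto
  qed
  have yn: "y ?n w = 0" if w: "w \<in> ?S" for w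
  proof -
    have real: "\<mu> j w = of_real (Re (\<mu> j w))" if "j < ?n" for j
    proof -
      have "real_rooted (charpoly (H' w))"
        using herm'[OF w] by (rule hermitian_charpoly_real_rooted)
      then have "\<mu> j w \<in> \<real>"
        using that unfolding real_rooted_def H'_def \<mu>(2)[OF w] by (auto simp: poly_prod)
      then show ?thesis
        by (simp add: complex_is_Real_iff complex_eq_iff)
    qed
    have "y k w = eliminate ((*v) (H' w)) (\<lambda>j. Re (\<mu> j w)) k (axis b 1)" if "k \<le> ?n" for k
      using that
    proof (induction k)
      case (Suc k)
      then show ?case
        using real[of k] by (simp add: y_Suc scaleR_eq_of_real_scale)
    qed (simp add: y0)
    also have "eliminate ((*v) (H' w)) (\<lambda>j. Re (\<mu> j w)) ?n (axis b 1) = 0"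
    proof (rule eliminate_all_eigenvalues[OF linear_matrix_vector_mult])
      show "(H' w *v x) \<bullet> y = x \<bullet> (H' w *v y)" for x y
        using hermitian_self_adjoint[OF herm'[OF w]] .
      fix r :: real and e :: "complex^'n"
      assume e: "e \<noteq> 0" "H' w *v e = r *\<^sub>R e"
      then have "H' w *v e = of_real r *s e"
        by (simp add: scaleR_eq_of_real_scale)
      then have "poly (charpoly (H' w)) (of_real r) = 0"
        using e(1) charpoly_root_iff by blast
      then obtain j where "j < ?n" "of_real r = \<mu> j w"
        unfolding H'_def \<mu>(2)[OF w] by (auto simp: poly_prod)
      then show "\<exists>j<?n. Re (\<mu> j w) = r"
        by (metis Re_complex_of_real)
    qed
    finally show ?thesis by simp
  qed
  define P where "P k \<longleftrightarrow> (\<forall>w\<in>?S. H' w *v y k w = 0)" for k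
  have "\<not> P 0"
  proof
    assume "P 0"
    then have "H' w0 *v axis b 1 = 0"
      using w0 by (simp add: P_def y0)
    then have "(H' w0 *v axis b 1) $ a = 0"
      by simp
    then show False
      using ab by (simp add: H'_def w0(2) matrix_vector_mult_def axis_def if_distrib[of "\<lambda>a. _ * a"] cong: if_cong)
  qed
  moreover have "P ?n"
    by (simp add: P_def yn)
  ultimately obtain k where k: "k < ?n" "\<not> P k" "P (Suc k)"
    using ex_least_nat_less[of P ?n] by auto
  define v where "v w = H' w *v y k w" for w
  have eig: "H' w *v v w = \<mu> k w *s v w" if "w \<in> ?S" for w
  proof -
    have "H' w *v (H' w *v y k w - \<mu> k w *s y k w) = 0"
      using k(3) that by (simp add: P_def y_Suc)
    then show ?thesis
      by (simp add: v_def matrix_vector_mult_diff_distrib vector_scalar_commute)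
  qed
  have v_nz: "\<exists>w\<in>?S. v w \<noteq> 0"
    using k(2) by (auto simp: P_def v_def)
  \<comment> \<open>As \<open>v\<close> lies in the range of the Hermitian matrix, the eigenvalue cannot vanish.\<close>
  have "\<exists>w\<in>?S. \<mu> k w \<noteq> 0"
  proof (rule ccontr)
    assume "\<not> ?thesis"
    then have "H' w *v v w = 0" if "w \<in> ?S" for w
      using eig[OF that] that by (simp add: vec_eq_iff)
    then have "v w \<bullet> v w = 0" if "w \<in> ?S" for w
      using hermitian_self_adjoint[OF herm'[OF that], of "y k w" "v w"] that by (simp add: v_def)
    then show False
      using v_nz by auto
  qed
  moreover have "analytic_vec ?S v"
    unfolding v_def using H' y_an[of k] k(1) by (intro analytic_vec_mult) auto
  ultimately show ?thesis
    using eig v_nz unfolding H'_def by (intro that[OF K \<mu>(1)[OF k(1)], of v])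
qed

section \<open>Analytic functions on the circle\<close>

lemma circle_islimpt:
  assumes "z \<in> sphere 0 1"
  shows "z islimpt (sphere 0 1 :: complex set)"
proof (rule connected_imp_perfect)
  have "1 \<in> sphere (0::complex) 1" "- 1 \<in> sphere (0::complex) 1" "1 \<noteq> (- 1 :: complex)"
    by simp_all
  then show "sphere (0::complex) 1 \<noteq> {x}" for x
    by (metis singletonD)
qed (use assms in \<open>simp_all add: connected_sphere\<close>)

lemma circle_inverse_cnj:
  assumes "z \<in> sphere 0 (1::real)"
  shows "inverse (cnj z) = z"
proof -
  have "z * cnj z = 1"
    using assms by (simp add: complex_mult_cnj cmod_def real_sqrt_eq_1_iff)
  then show ?thesis
    by (metis inverse_unique mult.commute)
qed

lemma analytic_circle_identity:
  assumes f: "f analytic_on sphere 0 1" and inf: "infinite {z \<in> sphere 0 1. f z = 0}"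
    and z: "z \<in> sphere 0 1"
  shows "f z = 0"
proof -
  let ?S = "sphere 0 (1::real) :: complex set"
  obtain T where T: "open T" "?S \<subseteq> T" "f holomorphic_on T"
    using f by (auto simp: analytic_on_holomorphic)
  define C where "C = connected_component_set T 1"
  have C: "open C" "connected C" "?S \<subseteq> C"
    unfolding C_def using T connected_component_maximal[of 1 ?S T]
    by (simp_all add: open_connected_component connected_sphere)
  have hol: "f holomorphic_on C"
    using T(3) connected_component_subset unfolding C_def by (rule holomorphic_on_subset)
  have "f constant_on C"
    using holomorphic_compact_finite_zeros[OF hol C(1,2) compact_sphere C(3)] inf by blast
  moreover obtain w where "w \<in> ?S" "f w = 0"
    using inf by (metis (mono_tags, lifting) finite.emptyI mem_Collect_eq Collect_empty_eq)
  ultimately show ?thesis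
    using C(3) z unfolding constant_on_def by (metis subsetD)
qed

lemma infinite_circle_near:
  fixes z :: complex
  assumes "z \<in> sphere 0 1" "\<forall>\<^sub>F w in nhds z. P w"
  shows "infinite {w \<in> sphere 0 1. P w}"
proof -
  obtain e where e: "e > 0" "\<And>w. dist w z < e \<Longrightarrow> P w"
    using assms(2) unfolding eventually_nhds_metric by blast
  have "infinite (sphere 0 1 \<inter> ball z e)"
    using circle_islimpt[OF assms(1)] e(1) by (simp add: islimpt_eq_infinite_ball)
  then show ?thesis
    by (rule contrapos_nn) (auto elim!: rev_finite_subset intro!: e(2) simp: dist_commute)
qed

lemma analytic_circle_nonzero_near:
  assumes "f analytic_on sphere 0 1" "z0 \<in> sphere 0 1" "f z0 \<noteq> 0" "z \<in> sphere 0 1"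
  shows "\<not> (\<forall>\<^sub>F w in nhds z. f w = 0)"
  using analytic_circle_identity[OF assms(1) _ assms(2)] infinite_circle_near[OF assms(4)] assms(3) by blast

lemma analytic_circle_prod_zero:
  assumes f: "f analytic_on sphere 0 1" and g: "g analytic_on sphere 0 1"
    and fg: "\<And>z. z \<in> sphere 0 1 \<Longrightarrow> f z * g z = 0" and f0: "\<exists>z\<in>sphere 0 1. f z \<noteq> 0"
    and z: "z \<in> sphere 0 1"
  shows "g z = 0"
proof -
  let ?S = "sphere 0 (1::real) :: complex set"
  have "finite {z \<in> ?S. f z = 0}"
    using analytic_circle_identity[OF f] f0 by blast
  moreover have "infinite ?S"
    using infinite_circle_near[of 1 "\<lambda>_. True"] by (simp add: sphere_def)
  moreover have "f z = 0 \<or> g z = 0" if "z \<in> ?S" for z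
    using fg[OF that] by simp
  then have "?S = {z \<in> ?S. f z = 0} \<union> {z \<in> ?S. g z = 0}"
    by blast
  ultimately have "infinite {z \<in> ?S. g z = 0}"
    by (metis finite_UnI)
  then show ?thesis
    using analytic_circle_identity[OF g _ z] by blast
qed

lemma near_circle_iff: "near_circle Q \<longleftrightarrow> (\<forall>z\<in>sphere 0 1. \<forall>\<^sub>F w in nhds z. Q w)"
proof
  assume "near_circle Q"
  then show "\<forall>z\<in>sphere 0 1. \<forall>\<^sub>F w in nhds z. Q w"
    unfolding near_circle_def eventually_nhds by blast
next
  assume Q: "\<forall>z\<in>sphere 0 1. \<forall>\<^sub>F w in nhds z. Q w"
  show "near_circle Q"
    unfolding near_circle_def
  proof (intro exI conjI ballI)
    show "open (interior {w. Q w})" by simp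
    show "sphere 0 1 \<subseteq> interior {w. Q w}"
    proof
      fix z :: complex assume "z \<in> sphere 0 1"
      then have "\<forall>\<^sub>F w in nhds z. Q w"
        using Q by (rule bspec[rotated])
      then obtain S where "open S" "z \<in> S" "\<forall>w\<in>S. Q w"
        by (auto simp only: eventually_nhds)
      then show "z \<in> interior {w. Q w}"
        by (intro interiorI[of S]) auto
    qed
    show "Q z" if "z \<in> interior {w. Q w}" for z
      using that interior_subset by blast
  qed
qed

lemma near_circle_zero:
  assumes f: "f analytic_on sphere 0 1" and zero: "\<And>z. z \<in> sphere 0 1 \<Longrightarrow> f z = 0"
  shows "near_circle (\<lambda>z. f z = 0)"
  unfolding near_circle_iff
proof
  fix z :: complex assume z: "z \<in> sphere 0 1"
  show "\<forall>\<^sub>F w in nhds z. f w = 0"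
  proof (rule analytic_germ_identity)
    show "f analytic_on {z}"
      using f z by (auto intro: analytic_on_subset)
    have "at z within sphere 0 1 \<noteq> bot"
      using circle_islimpt[OF z] by (simp add: trivial_limit_within)
    then show "\<exists>\<^sub>F w in at z within sphere 0 1. f w = 0"
      using zero by (intro eventually_frequently) (auto simp: eventually_at_filter)
  qed
qed

text \<open>The reflection \<open>z \<mapsto> 1 / cnj z\<close> fixes the circle, so this is the analytic counterpart of pointwise conjugation.\<close>

lemma analytic_circle_para_conj:
  assumes f: "f analytic_on sphere 0 1"
  shows "(\<lambda>z. cnj (f (inverse (cnj z)))) analytic_on sphere 0 1"
proof -
  let ?S = "sphere 0 (1::real) :: complex set"
  have "f \<circ> inverse analytic_on ?S"
  proof (rule analytic_on_compose_gen[OF _ f])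
    show "inverse analytic_on ?S"
    proof -
      have "(\<lambda>z. inverse z :: complex) analytic_on ?S"
        by (rule analytic_on_inverse[OF analytic_on_ident]) auto
      then show ?thesis
        by simp
    qed
  qed (auto simp: norm_inverse)
  then obtain T where T: "open T" "?S \<subseteq> T" "(f \<circ> inverse) holomorphic_on T"
    by (auto simp: analytic_on_holomorphic)
  have cnj: "cnj ` (cnj ` T) = T"
    by (simp add: image_image)
  have "cnj ` T = cnj -` T"
    by (auto intro: image_eqI[where x = "cnj _"])
  then have "open (cnj ` T)"
    using T(1) by (auto intro: open_vimage continuous_intros)
  then have "(cnj \<circ> (f \<circ> inverse) \<circ> cnj) holomorphic_on cnj ` T"
    using T(3) by (intro holomorphic_on_compose_cnj_cnj) (simp_all add: cnj)
  moreover have "?S \<subseteq> cnj ` T"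
  proof
    fix z assume "z \<in> ?S"
    then have "cnj z \<in> T"
      using T(2) by auto
    then show "z \<in> cnj ` T"
      by (metis complex_cnj_cnj imageI)
  qed
  ultimately show ?thesis
    using \<open>open (cnj ` T)\<close> unfolding analytic_on_holomorphic o_def by blast
qed

section \<open>Normalisation of analytic vectors\<close>

lemma analytic_vec_divide:
  assumes v: "analytic_vec (sphere 0 1) v" and zero: "v \<zeta> = 0"
  obtains u where "analytic_vec (sphere 0 1) u" "\<And>z. v z = (z - \<zeta>) *s u z"
proof -
  define u where "u z = (\<chi> i. if z = \<zeta> then deriv (\<lambda>w. v w $ i) \<zeta> else (v z $ i - v \<zeta> $ i) / (z - \<zeta>))" for z
  have "(\<lambda>z. u z $ i) analytic_on sphere 0 1" for i
  proof -
    obtain T where "open T" "sphere 0 1 \<subseteq> T" "(\<lambda>z. v z $ i) holomorphic_on T"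
      using v by (auto simp: analytic_on_holomorphic analytic_vec_def)
    then show ?thesis
      unfolding u_def using pole_lemma_open[of "\<lambda>z. v z $ i" T \<zeta>] by (auto simp: analytic_on_holomorphic)
  qed
  moreover have "v z = (z - \<zeta>) *s u z" for z
    unfolding vec_eq_iff vector_smult_component using zero by (simp add: u_def)
  ultimately show ?thesis
    using that unfolding analytic_vec_def by blast
qed

text \<open>Factors \<open>z - \<zeta>\<close> are divided out while all components vanish; the order at \<open>\<zeta>\<close> of a component that is not
  identically zero bounds their number.\<close>

lemma analytic_vec_remove_zero:
  assumes v: "analytic_vec (sphere 0 1) v" and \<zeta>: "\<zeta> \<in> sphere 0 1"
    and nz: "z0 \<in> sphere 0 1" "v z0 \<noteq> 0"
  obtains m u where "analytic_vec (sphere 0 1) u" "\<And>z. v z = (z - \<zeta>) ^ m *s u z" "u \<zeta> \<noteq> 0"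
proof -
  obtain i where i: "v z0 $ i \<noteq> 0"
    using nz(2) by (auto simp: vec_eq_iff)
  have comp: "(\<lambda>z. w z $ i) analytic_on {\<zeta>}" if "analytic_vec (sphere 0 1) w" for w :: "complex \<Rightarrow> complex^'a"
    using that \<zeta> unfolding analytic_vec_def by (meson analytic_on_subset empty_subsetI insert_subset)
  have "\<not> (\<forall>\<^sub>F z in nhds \<zeta>. v z $ i = 0)"
    using v nz(1) i \<zeta> unfolding analytic_vec_def
    by (intro analytic_circle_nonzero_near[of "\<lambda>z. v z $ i" z0]) auto
  then obtain M f where f: "f analytic_on {\<zeta>}" "f \<zeta> \<noteq> 0" "\<forall>\<^sub>F z in nhds \<zeta>. v z $ i = (z - \<zeta>) ^ M * f z"
    using analytic_germ_factor[OF comp[OF v]] by blast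
  have "\<exists>m u. analytic_vec (sphere 0 1) u \<and> (\<forall>z. v z = (z - \<zeta>) ^ m *s u z) \<and> u \<zeta> \<noteq> 0"
    using v f(3)
  proof (induction M arbitrary: v)
    case 0
    have "v \<zeta> $ i = f \<zeta>"
      using eventually_nhds_x_imp_x[OF 0(2)] by simp
    then have "v \<zeta> \<noteq> 0"
      using f(2) by auto
    then show ?case
      using 0(1) by (intro exI[of _ 0] exI[of _ v]) simp
  next
    case (Suc M)
    show ?case
    proof (cases "v \<zeta> = 0")
      case False
      then show ?thesis
        using Suc.prems(1) by (intro exI[of _ 0] exI[of _ v]) simp
    next
      case True
      obtain v1 where v1: "analytic_vec (sphere 0 1) v1" "\<And>z. v z = (z - \<zeta>) *s v1 z"
        using analytic_vec_divide[OF Suc.prems(1) True] by blast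
      have "\<forall>\<^sub>F z in nhds \<zeta>. v1 z $ i - (z - \<zeta>) ^ M * f z = 0"
      proof (rule analytic_germ_identity[of _ _ UNIV])
        show "(\<lambda>z. v1 z $ i - (z - \<zeta>) ^ M * f z) analytic_on {\<zeta>}"
          using comp[OF v1(1)] f(1) by (intro analytic_intros)
        have "\<forall>\<^sub>F z in at \<zeta>. v1 z $ i - (z - \<zeta>) ^ M * f z = 0"
          using Suc.prems(2) unfolding eventually_at_filter
          unfolding v1(2) vector_smult_component by eventually_elim auto
        then show "\<exists>\<^sub>F z in at \<zeta>. v1 z $ i - (z - \<zeta>) ^ M * f z = 0"
          by (intro eventually_frequently) auto
      qed
      then have "\<forall>\<^sub>F z in nhds \<zeta>. v1 z $ i = (z - \<zeta>) ^ M * f z"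
        by simp
      from Suc.IH[OF v1(1) this] obtain m u where u: "analytic_vec (sphere 0 1) u"
          "\<And>z. v1 z = (z - \<zeta>) ^ m *s u z" "u \<zeta> \<noteq> 0"
        by blast
      then show ?thesis
        by (intro exI[of _ "Suc m"] exI[of _ u]) (simp add: v1(2))
    qed
  qed
  then show ?thesis
    using that by blast
qed

lemma analytic_vec_remove_zeros:
  assumes "analytic_vec (sphere 0 1) v" "z0 \<in> sphere 0 1" "v z0 \<noteq> 0"
  shows "\<exists>h u. h analytic_on sphere 0 1 \<and> analytic_vec (sphere 0 1) u \<and>
    (\<forall>z. v z = h z *s u z) \<and> (\<forall>z\<in>sphere 0 1. u z \<noteq> 0)"
  using assms
proof (induction "card {z \<in> sphere 0 1. v z = 0}" arbitrary: v rule: less_induct)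
  case (less v)
  let ?S = "sphere 0 (1::real) :: complex set"
  show ?case
  proof (cases "\<exists>\<zeta>\<in>?S. v \<zeta> = 0")
    case False
    then show ?thesis
      using less.prems(1) by (intro exI[of _ "\<lambda>_. 1"] exI[of _ v]) auto
  next
    case True
    then obtain \<zeta> where \<zeta>: "\<zeta> \<in> ?S" "v \<zeta> = 0"
      by blast
    obtain m u where u: "analytic_vec ?S u" "\<And>z. v z = (z - \<zeta>) ^ m *s u z" "u \<zeta> \<noteq> 0"
      using analytic_vec_remove_zero[OF less.prems(1) \<zeta>(1) less.prems(2,3)] by blast
    have fin: "finite {z \<in> ?S. v z = 0}"
    proof -
      obtain i where i: "v z0 $ i \<noteq> 0"
        using less.prems(3) by (auto simp: vec_eq_iff)
      have an: "(\<lambda>z. v z $ i) analytic_on ?S"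
        using less.prems(1) by (simp add: analytic_vec_def)
      have "finite {z \<in> ?S. v z $ i = 0}"
        using analytic_circle_identity[OF an _ less.prems(2)] i by blast
      then show ?thesis
        by (rule rev_finite_subset) auto
    qed
    have "{z \<in> ?S. u z = 0} \<subseteq> {z \<in> ?S. v z = 0}"
      by (auto simp: u(2))
    moreover have "\<zeta> \<in> {z \<in> ?S. v z = 0} - {z \<in> ?S. u z = 0}"
      using \<zeta> u(3) by auto
    ultimately have "card {z \<in> ?S. u z = 0} < card {z \<in> ?S. v z = 0}"
      using fin by (intro psubset_card_mono) auto
    moreover have "u z0 \<noteq> 0"
      using less.prems(3) unfolding u(2)[of z0] by auto
    ultimately obtain h w where hw: "h analytic_on ?S" "analytic_vec ?S w"
        "\<And>z. u z = h z *s w z" "\<And>z. z \<in> ?S \<Longrightarrow> w z \<noteq> 0"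
      using less.hyps[of u] u(1) less.prems(2) by blast
    show ?thesis
    proof (intro exI[of _ "\<lambda>z. (z - \<zeta>) ^ m * h z"] exI[of _ w] conjI allI ballI)
      show "(\<lambda>z. (z - \<zeta>) ^ m * h z) analytic_on ?S"
        using hw(1) by (intro analytic_intros)
      show "v z = ((z - \<zeta>) ^ m * h z) *s w z" for z
        by (simp add: u(2) hw(3))
    qed (use hw in auto)
  qed
qed

definition hdot :: "complex^'n \<Rightarrow> complex^'n \<Rightarrow> complex" where
  "hdot a b = (\<Sum>i\<in>UNIV. cnj (a $ i) * b $ i)"

lemma hdot_self: "hdot a a = of_real ((norm a)\<^sup>2)"
proof -
  have "cnj z * z = of_real ((norm z)\<^sup>2)" for z
    by (simp add: complex_norm_square[symmetric] mult.commute)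
  then show ?thesis
    by (simp add: hdot_def norm_vec_def L2_set_def sum_nonneg)
qed

text \<open>Once the common zeros are removed, the squared norm is positive on the circle. It extends analytically as
  \<open>q\<close>, whose values on the circle avoid the branch cut of the square root.\<close>

lemma analytic_vec_normalise:
  assumes v: "analytic_vec (sphere 0 1) v" and nz: "\<exists>z\<in>sphere 0 1. v z \<noteq> 0"
  obtains h u where "h analytic_on sphere 0 1" "analytic_vec (sphere 0 1) u"
    "\<And>z. z \<in> sphere 0 1 \<Longrightarrow> v z = h z *s u z" "\<And>z. z \<in> sphere 0 1 \<Longrightarrow> hdot (u z) (u z) = 1"
proof -
  let ?S = "sphere 0 (1::real) :: complex set"
  obtain h w where hw: "h analytic_on ?S" "analytic_vec ?S w"
      "\<And>z. v z = h z *s w z" "\<And>z. z \<in> ?S \<Longrightarrow> w z \<noteq> 0"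
    using analytic_vec_remove_zeros[OF v] nz by blast
  define q where "q z = (\<Sum>i\<in>UNIV. cnj (w (inverse (cnj z)) $ i) * w z $ i)" for z
  have q_an: "q analytic_on ?S"
    unfolding q_def using hw(2) analytic_circle_para_conj unfolding analytic_vec_def
    by (intro analytic_intros) auto
  have q: "q z = of_real ((norm (w z))\<^sup>2)" if "z \<in> ?S" for z
    using hdot_self[of "w z"] that by (simp add: q_def circle_inverse_cnj hdot_def)
  have "csqrt \<circ> q analytic_on ?S"
  proof (rule analytic_on_compose_gen[OF q_an analytic_on_csqrt])
    fix z assume "z \<in> ?S"
    then show "q z \<in> - \<real>\<^sub>\<le>\<^sub>0"
      using hw(4)[of z] by (auto simp: q complex_nonpos_Reals_iff)
  qed
  then have n_an: "(\<lambda>z. csqrt (q z)) analytic_on ?S"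
    by (simp add: o_def)
  have n: "csqrt (q z) = of_real (norm (w z))" if "z \<in> ?S" for z
    by (simp add: q[OF that] csqrt_of_real_nonneg flip: of_real_power)
  define u where "u z = inverse (csqrt (q z)) *s w z" for z
  have u_eq: "u z = of_real (inverse (norm (w z))) *s w z" if "z \<in> ?S" for z
    by (simp add: u_def n[OF that] of_real_inverse)
  show ?thesis
  proof (rule that[of "\<lambda>z. h z * csqrt (q z)" u])
    show "(\<lambda>z. h z * csqrt (q z)) analytic_on ?S"
      using hw(1) n_an by (rule analytic_on_mult)
    have "csqrt (q z) \<noteq> 0" if "z \<in> ?S" for z
      using hw(4)[OF that] n[OF that] by simp
    then have "(\<lambda>z. inverse (csqrt (q z))) analytic_on ?S"
      using n_an by (intro analytic_on_inverse)
    then show "analytic_vec ?S u"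
      unfolding u_def using hw(2) by (rule analytic_vec_scale)
    fix z assume z: "z \<in> ?S"
    show "v z = (h z * csqrt (q z)) *s u z"
      using hw(4)[OF z] by (simp add: u_def hw(3) n[OF z] vec_eq_iff)
    have "u z = inverse (norm (w z)) *\<^sub>R w z"
      by (simp add: u_eq[OF z] scaleR_eq_of_real_scale)
    then have "norm (u z) = 1"
      using hw(4)[OF z] by simp
    then show "hdot (u z) (u z) = 1"
      by (simp add: hdot_self)
  qed
qed

section \<open>Orthonormal eigenvectors\<close>

lemma hermitian_hdot:
  assumes "hermitian M"
  shows "hdot (M *v a) b = hdot a (M *v b)"
proof -
  have "hdot (M *v a) b = (\<Sum>i\<in>UNIV. \<Sum>j\<in>UNIV. cnj (M $ i $ j) * cnj (a $ j) * b $ i)"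
    by (simp add: hdot_def matrix_vector_mult_def sum_distrib_right)
  also have "\<dots> = (\<Sum>j\<in>UNIV. \<Sum>i\<in>UNIV. cnj (M $ i $ j) * cnj (a $ j) * b $ i)"
    by (rule sum.swap)
  also have "\<dots> = (\<Sum>j\<in>UNIV. \<Sum>i\<in>UNIV. cnj (a $ j) * (M $ j $ i * b $ i))"
  proof (intro sum.cong refl)
    fix i j
    have "M $ j $ i = cnj (M $ i $ j)"
      using assms unfolding hermitian_def by blast
    then show "cnj (M $ i $ j) * cnj (a $ j) * b $ i = cnj (a $ j) * (M $ j $ i * b $ i)"
      by simp
  qed
  also have "\<dots> = hdot a (M *v b)"
    by (simp add: hdot_def matrix_vector_mult_def sum_distrib_left)
  finally show ?thesis .
qed

lemma hdot_scale_right: "hdot a (c *s b) = c * hdot a b"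
  by (simp add: hdot_def sum_distrib_left mult_ac)

lemma hdot_zero [simp]: "hdot 0 b = 0" "hdot a 0 = 0"
  by (simp_all add: hdot_def)

lemma hdot_commute: "hdot a b = cnj (hdot b a)"
  by (simp add: hdot_def mult.commute)

lemma hdot_diff_right: "hdot a (b - c) = hdot a b - hdot a c"
  by (simp add: hdot_def algebra_simps sum_subtractf)

lemma hdot_sum_right: "hdot a (\<Sum>j\<in>J. b j) = (\<Sum>j\<in>J. hdot a (b j))"
  by (simp add: hdot_def sum_distrib_left) (rule sum.swap)

text \<open>On the circle the inner product agrees with the analytic function \<open>q\<close>, and analytic functions on the circle
  have no zero divisors.\<close>

lemma analytic_circle_hdot_zero:
  assumes a: "analytic_vec (sphere 0 1) a" and b: "analytic_vec (sphere 0 1) b"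
    and l: "l analytic_on sphere 0 1" "\<exists>z\<in>sphere 0 1. l z \<noteq> 0"
    and zero: "\<And>z. z \<in> sphere 0 1 \<Longrightarrow> l z * hdot (a z) (b z) = 0" and z: "z \<in> sphere 0 1"
  shows "hdot (a z) (b z) = 0"
proof -
  define q where "q z = (\<Sum>i\<in>UNIV. cnj (a (inverse (cnj z)) $ i) * b z $ i)" for z
  have q_an: "q analytic_on sphere 0 1"
    unfolding q_def using a b analytic_circle_para_conj unfolding analytic_vec_def
    by (intro analytic_intros) auto
  have q: "q z = hdot (a z) (b z)" if "z \<in> sphere 0 1" for z
    using that by (simp add: q_def circle_inverse_cnj hdot_def)
  have "q z = 0"
    by (rule analytic_circle_prod_zero[OF l(1) q_an _ l(2) z]) (simp add: q zero)
  then show ?thesis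
    by (simp add: q[OF z])
qed

lemma analytic_vec_power:
  "analytic_vec (sphere 0 1) v \<Longrightarrow> analytic_vec (sphere 0 1) (\<lambda>w. v (w ^ K))"
  unfolding analytic_vec_def using analytic_circle_power by blast

text \<open>The induction is over the set of indices, as the dimension is a type. Each step replaces the variable by a
  root of it, which is why the exponents multiply.\<close>

lemma orthonormal_eigenvectors:
  fixes G :: "complex \<Rightarrow> complex^'n^'n" and J :: "'n set"
  assumes G: "analytic_mat (sphere 0 1) G" and herm: "\<And>z. z \<in> sphere 0 1 \<Longrightarrow> hermitian (G z)"
  shows "\<exists>K>0. \<exists>v l. (\<forall>j\<in>J. analytic_vec (sphere 0 1) (v j) \<and> l j analytic_on sphere 0 1) \<and>
    (\<forall>w\<in>sphere 0 1. (\<forall>j\<in>J. G (w ^ K) *v v j w = l j w *s v j w) \<and>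
       (\<forall>j\<in>J. \<forall>k\<in>J. hdot (v j w) (v k w) = of_bool (j = k)))"
proof -
  let ?S = "sphere 0 (1::real) :: complex set"
  have pow: "w ^ k \<in> ?S" if "w \<in> ?S" for w k
    using that by (simp add: norm_power)
  have "finite J" by simp
  then show ?thesis
  proof (induction J rule: finite_induct)
    case empty
    show ?case
      by (rule exI[of _ 1]) auto
  next
    case (insert i J)
    from insert.IH obtain K v l where K: "K > 0"
      and IH: "\<forall>j\<in>J. analytic_vec ?S (v j) \<and> l j analytic_on ?S"
        "\<forall>w\<in>?S. (\<forall>j\<in>J. G (w ^ K) *v v j w = l j w *s v j w) \<and>
          (\<forall>j\<in>J. \<forall>k\<in>J. hdot (v j w) (v k w) = of_bool (j = k))"
      by blast
    have v: "analytic_vec ?S (v j)" and l: "l j analytic_on ?S" if "j \<in> J" for j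
      using IH(1) that by auto
    have eig: "G (w ^ K) *v v j w = l j w *s v j w" if "w \<in> ?S" "j \<in> J" for w j
      using IH(2) that by blast
    have orth: "hdot (v j w) (v k w) = of_bool (j = k)" if "w \<in> ?S" "j \<in> J" "k \<in> J" for w j k
      using IH(2) that by blast
    have l_real: "cnj (l j w) = l j w" if "w \<in> ?S" "j \<in> J" for w j
    proof -
      have "v j w \<noteq> 0"
        using orth[OF that that(2)] by auto
      then have "l j w \<in> \<real>"
        using hermitian_eigenvalue_real[OF herm[OF pow[OF that(1)]] _ eig[OF that]] by blast
      then show ?thesis
        by (simp add: Reals_cnj_iff)
    qed
    \<comment> \<open>Removing the known eigenvectors leaves a Hermitian matrix \<open>H\<close> that vanishes on them.\<close>
    define H :: "complex \<Rightarrow> complex^'n^'n" where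
      "H w = (\<chi> a b. G (w ^ K) $ a $ b - (\<Sum>j\<in>J. l j w * v j w $ a * cnj (v j (inverse (cnj w)) $ b)))" for w
    have H_an: "analytic_mat ?S H"
    proof -
      have "(\<lambda>w. G (w ^ K) $ a $ b) analytic_on ?S" for a b
        using G analytic_circle_power[of "\<lambda>z. G z $ a $ b"] by (simp add: analytic_mat_def)
      moreover have "(\<lambda>w. v j w $ a) analytic_on ?S" if "j \<in> J" for j a
        using v[OF that] by (simp add: analytic_vec_def)
      moreover have "(\<lambda>w. cnj (v j (inverse (cnj w)) $ b)) analytic_on ?S" if "j \<in> J" for j b
        using v[OF that] analytic_circle_para_conj[of "\<lambda>w. v j w $ b"] by (simp add: analytic_vec_def)
      ultimately show ?thesis
        unfolding analytic_mat_def H_def using l by (simp add: analytic_on_diff analytic_on_sum analytic_on_mult)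
    qed
    have H_circle: "H w $ a $ b = G (w ^ K) $ a $ b - (\<Sum>j\<in>J. l j w * v j w $ a * cnj (v j w $ b))"
      if "w \<in> ?S" for w a b
      using that by (simp add: H_def circle_inverse_cnj)
    have H_herm: "hermitian (H w)" if w: "w \<in> ?S" for w
      unfolding hermitian_def
    proof (intro allI)
      fix a b
      have "G (w ^ K) $ a $ b = cnj (G (w ^ K) $ b $ a)"
        using herm[OF pow[OF w]] unfolding hermitian_def by blast
      then show "H w $ a $ b = cnj (H w $ b $ a)"
        unfolding H_circle[OF w] by (simp add: l_real[OF w] mult_ac)
    qed
    have H_mult: "H w *v x = G (w ^ K) *v x - (\<Sum>j\<in>J. (l j w * hdot (v j w) x) *s v j w)"
      if w: "w \<in> ?S" for w x
    proof -
      have "(\<Sum>b\<in>UNIV. (\<Sum>j\<in>J. l j w * v j w $ a * cnj (v j w $ b)) * x $ b) =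
          (\<Sum>j\<in>J. l j w * hdot (v j w) x * v j w $ a)" for a
        unfolding sum_distrib_right hdot_def sum_distrib_left
        by (subst sum.swap) (simp add: mult_ac)
      then show ?thesis
        by (simp add: vec_eq_iff matrix_vector_mult_def H_circle[OF w] left_diff_distrib sum_subtractf)
    qed
    have H_v: "H w *v v k w = 0" if "w \<in> ?S" "k \<in> J" for w k
    proof -
      have "(\<Sum>j\<in>J. (l j w * hdot (v j w) (v k w)) *s v j w) = (\<Sum>j\<in>J. if j = k then l k w *s v k w else 0)"
        using that by (intro sum.cong refl) (simp add: orth)
      also have "\<dots> = l k w *s v k w"
        using that insert.hyps(1) by simp
      finally show ?thesis
        using that by (simp add: H_mult eig)
    qed
    obtain K1 x m where K1: "K1 > 0" and x: "analytic_vec ?S x" "\<exists>w\<in>?S. x w \<noteq> 0"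
      and m: "m analytic_on ?S" and x_eig: "\<And>w. w \<in> ?S \<Longrightarrow> G (w ^ (K1 * K)) *v x w = m w *s x w"
      and x_orth: "\<And>w j. w \<in> ?S \<Longrightarrow> j \<in> J \<Longrightarrow> hdot (v j (w ^ K1)) (x w) = 0"
    proof (cases "\<forall>z\<in>?S. H z = 0")
      case True
      \<comment> \<open>Any vector orthogonal to the known ones is an eigenvector for the eigenvalue 0. The diagonal
        entries of the complementary projection sum to \<open>CARD('n) - card J\<close>, so it is not zero.\<close>
      define p where "p b w = axis b 1 - (\<Sum>j\<in>J. cnj (v j (inverse (cnj w)) $ b) *s v j w)" for b w
      have p_circle: "p b w = axis b 1 - (\<Sum>j\<in>J. cnj (v j w $ b) *s v j w)" if "w \<in> ?S" for b w
        using that by (simp add: p_def circle_inverse_cnj)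
      have p_orth: "hdot (v k w) (p b w) = 0" if "w \<in> ?S" "k \<in> J" for k b w
      proof -
        have "hdot (v k w) (axis b 1) = cnj (v k w $ b)"
          by (simp add: hdot_def axis_def if_distrib[of "\<lambda>a. _ * a"] cong: if_cong)
        moreover have "(\<Sum>j\<in>J. cnj (v j w $ b) * hdot (v k w) (v j w)) = (\<Sum>j\<in>J. if j = k then cnj (v k w $ b) else 0)"
          using that by (intro sum.cong refl) (simp add: orth)
        ultimately show ?thesis
          using that insert.hyps(1)
          by (simp add: p_circle hdot_diff_right hdot_sum_right hdot_scale_right)
      qed
      have "(\<Sum>b\<in>UNIV. p b 1 $ b) = of_nat CARD('n) - of_nat (card J)"
      proof -
        have "(\<Sum>b\<in>UNIV. \<Sum>j\<in>J. cnj (v j 1 $ b) * v j 1 $ b) = (\<Sum>j\<in>J. hdot (v j 1) (v j 1))"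
          unfolding hdot_def by (rule sum.swap)
        also have "\<dots> = of_nat (card J)"
          by (simp add: orth)
        finally show ?thesis
          by (simp add: p_circle sum_subtractf)
      qed
      moreover have "card J < CARD('n)"
        using insert.hyps(2) by (intro psubset_card_mono) auto
      ultimately obtain b where b: "p b 1 \<noteq> 0"
        by (metis (no_types, lifting) eq_iff_diff_eq_0 nat_neq_iff of_nat_eq_iff sum.neutral zero_index)
      have "analytic_vec ?S (p b)"
        unfolding p_def using v analytic_circle_para_conj
        by (intro analytic_vec_diff analytic_vec_const analytic_vec_sum analytic_vec_scale)
           (auto simp: analytic_vec_def)
      moreover have "G (w ^ (1 * K)) *v p b w = 0 *s p b w" if "w \<in> ?S" for w
        using H_mult[OF that, of "p b w"] True that by (simp add: p_orth)
      ultimately show ?thesis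
        using that[of 1 "p b" "\<lambda>_. 0"] b p_orth by force
    next
      case False
      then obtain z0 where z0: "z0 \<in> ?S" "H z0 \<noteq> 0" by blast
      obtain K1 m x where K1: "K1 > 0" "m analytic_on ?S" "analytic_vec ?S x"
          "\<And>w. w \<in> ?S \<Longrightarrow> H (w ^ K1) *v x w = m w *s x w"
          "\<exists>w\<in>?S. m w \<noteq> 0" "\<exists>w\<in>?S. x w \<noteq> 0"
      proof (rule analytic_eigenvector[OF H_an _ z0])
        show "hermitian (H z)" if "z \<in> ?S" for z
          using that by (rule H_herm)
      qed (rule that)
      have x_orth: "hdot (v j (w ^ K1)) (x w) = 0" if "w \<in> ?S" "j \<in> J" for w j
      proof (rule analytic_circle_hdot_zero[OF analytic_vec_power[OF v[OF that(2)]] K1(3,2,5) _ that(1)])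
        fix z assume z: "z \<in> ?S"
        have "m z * hdot (v j (z ^ K1)) (x z) = hdot (v j (z ^ K1)) (H (z ^ K1) *v x z)"
          by (simp add: K1(4)[OF z] hdot_scale_right)
        also have "\<dots> = hdot (H (z ^ K1) *v v j (z ^ K1)) (x z)"
          using hermitian_hdot[OF H_herm[OF pow[OF z]]] by simp
        finally show "m z * hdot (v j (z ^ K1)) (x z) = 0"
          by (simp add: H_v[OF pow[OF z] that(2)])
      qed
      moreover have "G (w ^ (K1 * K)) *v x w = m w *s x w" if "w \<in> ?S" for w
        using H_mult[OF pow[OF that], of K1 "x w"] that by (simp add: K1(4) x_orth power_mult)
      ultimately show ?thesis
        using that[OF K1(1,3,6,2)] by blast
    qed
    obtain h u where h: "h analytic_on ?S" and u: "analytic_vec ?S u"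
      and xu: "\<And>z. z \<in> ?S \<Longrightarrow> x z = h z *s u z" and u1: "\<And>z. z \<in> ?S \<Longrightarrow> hdot (u z) (u z) = 1"
      by (rule analytic_vec_normalise[OF x]) (rule that)
    have h_nz: "\<exists>z\<in>?S. h z \<noteq> 0"
      using x(2) xu by force
    have u_orth: "hdot (v j (w ^ K1)) (u w) = 0" if "w \<in> ?S" "j \<in> J" for w j
    proof (rule analytic_circle_hdot_zero[OF analytic_vec_power[OF v[OF that(2)]] u h h_nz _ that(1)])
      fix z assume "z \<in> ?S"
      then show "h z * hdot (v j (z ^ K1)) (u z) = 0"
        using x_orth[of z j] that(2) by (simp add: xu hdot_scale_right)
    qed
    have u_eig: "G (w ^ (K1 * K)) *v u w = m w *s u w" if w: "w \<in> ?S" for w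
    proof -
      have "(G (w ^ (K1 * K)) *v u w - m w *s u w) $ a = 0" for a
      proof (rule analytic_circle_prod_zero[OF h _ _ h_nz w])
        have "analytic_mat ?S (\<lambda>w. G (w ^ (K1 * K)))"
          using G analytic_circle_power unfolding analytic_mat_def by blast
        then have "analytic_vec ?S (\<lambda>w. G (w ^ (K1 * K)) *v u w - m w *s u w)"
          using u m by (intro analytic_vec_diff analytic_vec_mult analytic_vec_scale)
        then show "(\<lambda>w. (G (w ^ (K1 * K)) *v u w - m w *s u w) $ a) analytic_on ?S"
          unfolding analytic_vec_def by blast
        fix z assume z: "z \<in> ?S"
        have "h z *s (G (z ^ (K1 * K)) *v u z) = m z *s (h z *s u z)"
          using x_eig[OF z] by (simp add: xu[OF z] vector_scalar_commute)
        then have "h z * (G (z ^ (K1 * K)) *v u z) $ a = m z * (h z * u z $ a)"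
          by (metis vector_smult_component)
        then show "h z * (G (z ^ (K1 * K)) *v u z - m z *s u z) $ a = 0"
          by (simp add: algebra_simps)
      qed
      then show ?thesis
        by (simp add: vec_eq_iff)
    qed
    define v' where "v' j w = (if j = i then u w else v j (w ^ K1))" for j w
    define l' where "l' j w = (if j = i then m w else l j (w ^ K1))" for j w
    have ne: "j \<noteq> i" if "j \<in> J" for j
      using that insert.hyps(2) by auto
    have an: "analytic_vec ?S (v' j) \<and> l' j analytic_on ?S" if "j \<in> insert i J" for j
      using that u m analytic_vec_power[OF v] analytic_circle_power[OF l]
      unfolding v'_def l'_def by (cases "j = i") auto
    have eig': "G (w ^ (K1 * K)) *v v' j w = l' j w *s v' j w" if "w \<in> ?S" "j \<in> insert i J" for w j
      using that u_eig eig[OF pow[OF that(1)], of j K1] unfolding v'_def l'_def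
      by (cases "j = i") (auto simp: power_mult)
    have orth': "hdot (v' j w) (v' k w) = of_bool (j = k)" if "w \<in> ?S" "j \<in> insert i J" "k \<in> insert i J" for w j k
      using that u1 u_orth[of w] orth[OF pow[OF that(1)], of j k K1] ne hdot_commute[of "u w" "v k (w ^ K1)"]
      unfolding v'_def by (cases "j = i"; cases "k = i") auto
    show ?case
      using K K1 an eig' orth' by (intro exI[of _ "K1 * K"] exI[of _ v'] exI[of _ l'] conjI ballI) auto
  qed
qed

section \<open>Puiseux functions on the circle\<close>

lemma near_circle_conj: "near_circle P \<Longrightarrow> near_circle Q \<Longrightarrow> near_circle (\<lambda>z. P z \<and> Q z)"
  unfolding near_circle_iff by (simp add: eventually_conj)

lemma near_circle_mono: "near_circle P \<Longrightarrow> (\<And>z. P z \<Longrightarrow> Q z) \<Longrightarrow> near_circle Q"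
  unfolding near_circle_def by blast

lemma near_circle_nonzero: "near_circle (\<lambda>z. z \<noteq> 0)"
  unfolding near_circle_def by (rule exI[of _ "- {0}"]) auto

lemma norm_principal_root: "N > 0 \<Longrightarrow> norm (principal_root N z) = root N (cmod z)"
  by (simp add: principal_root_def norm_mult)

lemma principal_root_power:
  assumes "N > 0" "K > 0"
  shows "principal_root (N * K) z ^ K = principal_root N z"
proof -
  have "root (N * K) (cmod z) ^ K = root N (cmod z)"
    using assms by (simp add: real_root_mult_exp mult.commute[of N])
  moreover have "exp (\<i> * complex_of_real (Arg z / real (N * K))) ^ K = exp (\<i> * complex_of_real (Arg z / real N))"
    using assms by (simp flip: exp_of_nat_mult)
  ultimately show ?thesis
    unfolding principal_root_def power_mult_distrib by (simp only: flip: of_real_power)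
qed

lemma principal_root_1: "principal_root 1 z = z"
  by (cases "z = 0") (use Arg_eq[of z] in \<open>auto simp: principal_root_def\<close>)

lemma principal_root_inverse_cnj:
  assumes "N > 0" "z \<noteq> 0"
  shows "principal_root N (inverse (cnj z)) = inverse (cnj (principal_root N z))"
proof -
  have "Arg (inverse (cnj z)) = Arg z"
  proof -
    have "inverse (cnj z) = of_real (inverse ((norm z)\<^sup>2)) * z"
      using assms(2) complex_norm_square[of z] by (simp add: field_simps of_real_inverse)
    moreover have "Arg (of_real (inverse ((norm z)\<^sup>2)) * z) = Arg z"
      using assms(2) by (intro Arg_times_of_real) simp
    ultimately show ?thesis
      by simp
  qed
  moreover have "exp (\<i> * complex_of_real t) = inverse (cnj (exp (\<i> * complex_of_real t)))" for t
    by (simp add: exp_cnj exp_minus)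
  ultimately show ?thesis
    using assms unfolding principal_root_def
    by (simp add: norm_inverse real_root_inverse of_real_inverse del: of_real_divide)
qed

lemma principal_root_circle: "N > 0 \<Longrightarrow> z \<in> sphere 0 1 \<Longrightarrow> principal_root N z \<in> sphere 0 1"
  by (simp add: norm_principal_root)

lemma infinite_principal_root_circle:
  assumes "N > 0"
  shows "infinite (principal_root N ` sphere 0 1)"
proof -
  have "inj (principal_root N)"
    using principal_root_power[of 1 N] assms unfolding principal_root_1 by (metis injI mult_1 zero_less_one)
  moreover have "infinite (sphere (0::complex) 1)"
    using infinite_circle_near[of "1::complex" "\<lambda>_. True"] by (simp add: sphere_def)
  ultimately show ?thesis
    using finite_imageD inj_on_subset by blast
qed

text \<open>The root is discontinuous along its branch cut, but its modulus is continuous and the neighbourhood may be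
  shrunk to an annulus.\<close>

lemma near_circle_principal_root:
  assumes Q: "near_circle Q" and N: "N > 0"
  shows "near_circle (\<lambda>z. Q (principal_root N z))"
proof -
  obtain T where T: "open T" "sphere 0 1 \<subseteq> T" "\<And>z. z \<in> T \<Longrightarrow> Q z"
    using Q unfolding near_circle_def by blast
  obtain e where e: "e > 0" "(\<Union>x\<in>sphere 0 1. ball x e) \<subseteq> T"
    using compact_subset_open_imp_ball_epsilon_subset[OF compact_sphere T(1,2)] by blast
  define V where "V = {z. \<bar>root N (cmod z) - 1\<bar> < e} \<inter> - {0}"
  have "open {z. \<bar>root N (cmod z) - 1\<bar> < e}"
    by (intro open_Collect_less continuous_intros)
  then have "open V"
    unfolding V_def by (intro open_Int) auto
  moreover have "sphere 0 1 \<subseteq> V"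
    using e(1) N by (auto simp: V_def)
  moreover have "Q (principal_root N z)" if z: "z \<in> V" for z
  proof -
    define w where "w = principal_root N z"
    have w: "norm w = root N (cmod z)"
      using norm_principal_root[OF N] by (simp add: w_def)
    then have "w \<noteq> 0"
      using z N by (auto simp: V_def)
    have "dist (sgn w) w = \<bar>norm w - 1\<bar>"
    proof -
      have "sgn w - w = (inverse (norm w) - 1) *\<^sub>R w"
        by (simp add: sgn_div_norm algebra_simps)
      then have "dist (sgn w) w = \<bar>inverse (norm w) - 1\<bar> * norm w"
        by (simp add: dist_norm)
      also have "\<dots> = \<bar>(inverse (norm w) - 1) * norm w\<bar>"
        by (simp add: abs_mult)
      also have "(inverse (norm w) - 1) * norm w = 1 - norm w"
        using \<open>w \<noteq> 0\<close> by (simp add: left_diff_distrib)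
      finally show ?thesis by simp
    qed
    then have "w \<in> ball (sgn w) e"
      using z by (simp add: V_def w)
    moreover have "sgn w \<in> sphere 0 1"
      using \<open>w \<noteq> 0\<close> by (simp add: norm_sgn)
    ultimately show ?thesis
      using e(2) T(3) unfolding w_def by blast
  qed
  ultimately show ?thesis
    unfolding near_circle_def by blast
qed

text \<open>The product of the orders of all entries serves as the common order.\<close>

lemma puiseux_matrix_common_root:
  fixes A :: "complex \<Rightarrow> complex^'n^'m"
  assumes "puiseux_matrix A"
  obtains N G where "N > 0" "analytic_mat (sphere 0 1) G" "\<And>z. A z = G (principal_root N z)"
proof -
  have "\<exists>N g. N > 0 \<and> g analytic_on sphere 0 1 \<and> (\<lambda>z. A z $ i $ j) = (\<lambda>z. g (principal_root N z))" for i j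
    using assms unfolding puiseux_matrix_def puiseux_circle_def holo_circle_def by blast
  then obtain N g where N: "\<And>i j. N i j > 0" and g: "\<And>i j. g i j analytic_on sphere 0 1"
    and A: "\<And>i j. (\<lambda>z. A z $ i $ j) = (\<lambda>z. g i j (principal_root (N i j) z))"
    by metis
  define M :: nat where "M = (\<Prod>i\<in>UNIV. \<Prod>j\<in>UNIV. N i j)"
  have M: "M > 0"
    unfolding M_def using N by (intro prod_pos) auto
  have "N i j dvd M" for i j
  proof -
    have "N i j dvd (\<Prod>j\<in>UNIV. N i j)"
      by (rule dvd_prodI) auto
    also have "\<dots> dvd M"
      unfolding M_def by (rule dvd_prodI) auto
    finally show ?thesis .
  qed
  then obtain k where k: "\<And>i j. M = N i j * k i j"
    unfolding dvd_def by metis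
  have k0: "k i j > 0" for i j
    using M k[of i j] by (cases "k i j") auto
  define G :: "complex \<Rightarrow> complex^'n^'m" where "G w = (\<chi> i j. g i j (w ^ k i j))" for w
  show ?thesis
  proof (rule that[OF M])
    show "analytic_mat (sphere 0 1) G"
      unfolding analytic_mat_def G_def using analytic_circle_power[OF g] by simp
    fix z
    have "A z $ i $ j = G (principal_root M z) $ i $ j" for i j
      using fun_cong[OF A[of i j], of z] principal_root_power[OF N[of i j] k0[of i j], of z]
      by (simp add: G_def flip: k)
    then show "A z = G (principal_root M z)"
      by (simp add: vec_eq_iff)
  qed
qed

lemma puiseux_matrixI:
  assumes "N > 0" "analytic_mat (sphere 0 1) G"
  shows "puiseux_matrix (\<lambda>z. G (principal_root N z))"
  unfolding puiseux_matrix_def puiseux_circle_def holo_circle_def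
proof (intro allI UN_I CollectI)
  show "N \<in> {0<..}"
    using assms(1) by simp
  show "\<exists>g. g analytic_on sphere 0 1 \<and> (\<lambda>z. G (principal_root N z) $ i $ j) = (\<lambda>z. g (principal_root N z))" for i j
    using assms(2) unfolding analytic_mat_def by (intro exI[of _ "\<lambda>w. G w $ i $ j"]) simp
qed

lemma analytic_mat_mult:
  "analytic_mat S M \<Longrightarrow> analytic_mat S M' \<Longrightarrow> analytic_mat S (\<lambda>z. M z ** M' z)"
  unfolding analytic_mat_def matrix_matrix_mult_def by (auto intro!: analytic_intros)

lemma analytic_mat_para_conj: "analytic_mat (sphere 0 1) M \<Longrightarrow> analytic_mat (sphere 0 1) (para_conj M)"
  unfolding analytic_mat_def para_conj_def by (auto intro: analytic_circle_para_conj)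

lemma near_circle_mat_eq:
  fixes M M' :: "complex \<Rightarrow> complex^'n^'m"
  assumes "analytic_mat (sphere 0 1) M" "analytic_mat (sphere 0 1) M'"
    and "\<And>z. z \<in> sphere 0 1 \<Longrightarrow> M z = M' z"
  shows "near_circle (\<lambda>z. M z = M' z)"
proof -
  have "near_circle (\<lambda>z. M z $ i $ j - M' z $ i $ j = 0)" for i j
    using assms unfolding analytic_mat_def by (intro near_circle_zero analytic_intros) auto
  then show ?thesis
    unfolding near_circle_iff vec_eq_iff by (simp add: eventually_all_finite)
qed

lemma para_conj_circle:
  "z \<in> sphere 0 1 \<Longrightarrow> para_conj M z $ i $ j = cnj (M z $ j $ i)"
  by (simp add: para_conj_def circle_inverse_cnj)

lemma para_conj_principal_root:
  assumes "N > 0" "z \<noteq> 0"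
  shows "para_conj (\<lambda>z. M (principal_root N z)) z = para_conj M (principal_root N z)"
  by (simp add: para_conj_def principal_root_inverse_cnj assms)

text \<open>The principal root only covers an arc of the circle; the identity theorem extends the symmetry to all of it.\<close>

lemma para_hermitian_pullback:
  fixes G :: "complex \<Rightarrow> complex^'n^'n"
  assumes G: "analytic_mat (sphere 0 1) G" and N: "N > 0"
    and herm: "para_hermitian (\<lambda>z. G (principal_root N z))" and w: "w \<in> sphere 0 1"
  shows "hermitian (G w)"
proof -
  have eq: "G w $ i $ j - para_conj G w $ i $ j = 0" for i j
  proof (rule analytic_circle_identity[OF _ _ w])
    show "(\<lambda>w. G w $ i $ j - para_conj G w $ i $ j) analytic_on sphere 0 1"
      using G analytic_mat_para_conj[OF G] unfolding analytic_mat_def by (intro analytic_intros) auto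
    have "G (principal_root N z) = para_conj G (principal_root N z)" if "z \<in> sphere 0 1" for z
    proof -
      have "G (principal_root N z) = para_conj (\<lambda>z. G (principal_root N z)) z"
        using herm that unfolding para_hermitian_def near_circle_def by blast
      moreover have "z \<noteq> 0"
        using that by auto
      ultimately show ?thesis
        using N by (simp add: para_conj_principal_root)
    qed
    then have "principal_root N ` sphere 0 1 \<subseteq> {w \<in> sphere 0 1. G w $ i $ j - para_conj G w $ i $ j = 0}"
      using principal_root_circle[OF N] by auto
    then show "infinite {w \<in> sphere 0 1. G w $ i $ j - para_conj G w $ i $ j = 0}"
      using infinite_principal_root_circle[OF N] infinite_super by blast
  qed
  show ?thesis
    unfolding hermitian_def
  proof (intro allI)
    show "G w $ i $ j = cnj (G w $ j $ i)" for i j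
      using eq[of i j] unfolding para_conj_circle[OF w] by (simp only: right_minus_eq)
  qed
qed

lemma analytic_eigendecomposition:
  fixes G :: "complex \<Rightarrow> complex^'n^'n"
  assumes G: "analytic_mat (sphere 0 1) G" and herm: "\<And>z. z \<in> sphere 0 1 \<Longrightarrow> hermitian (G z)"
  obtains K and U D :: "complex \<Rightarrow> complex^'n^'n" where
    "K > 0" "analytic_mat (sphere 0 1) U" "analytic_mat (sphere 0 1) D"
    "\<And>w. w \<in> sphere 0 1 \<Longrightarrow> para_conj U w ** U w = mat 1"
    "\<And>w. w \<in> sphere 0 1 \<Longrightarrow> G (w ^ K) = U w ** D w ** para_conj U w"
    "\<And>w i j. i \<noteq> j \<Longrightarrow> D w $ i $ j = 0"
    "\<And>w i j. w \<in> sphere 0 1 \<Longrightarrow> D w $ i $ j \<in> \<real>"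
proof -
  let ?S = "sphere 0 (1::real) :: complex set"
  have "\<exists>K>0. \<exists>v l. (\<forall>j\<in>UNIV. analytic_vec ?S (v j) \<and> l j analytic_on ?S) \<and>
    (\<forall>w\<in>?S. (\<forall>j\<in>UNIV. G (w ^ K) *v v j w = l j w *s v j w) \<and>
       (\<forall>j\<in>UNIV. \<forall>k\<in>(UNIV::'n set). hdot (v j w) (v k w) = of_bool (j = k)))"
    using orthonormal_eigenvectors[OF G herm, of UNIV] by blast
  then obtain K v l where K: "K > 0"
    and *: "\<forall>j\<in>(UNIV::'n set). analytic_vec ?S (v j) \<and> l j analytic_on ?S"
      "\<forall>w\<in>?S. (\<forall>j\<in>UNIV. G (w ^ K) *v v j w = l j w *s v j w) \<and>
         (\<forall>j\<in>UNIV. \<forall>k\<in>UNIV. hdot (v j w) (v k w) = of_bool (j = k))"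
    by blast
  have an: "analytic_vec ?S (v j)" "l j analytic_on ?S" for j
    using *(1) by auto
  have eig: "G (w ^ K) *v v j w = l j w *s v j w" if "w \<in> ?S" for w j
    using *(2) that by blast
  have orth: "hdot (v j w) (v k w) = of_bool (j = k)" if "w \<in> ?S" for w j k
    using *(2) that by blast
  define U :: "complex \<Rightarrow> complex^'n^'n" where "U w = (\<chi> i j. v j w $ i)" for w
  define D :: "complex \<Rightarrow> complex^'n^'n" where "D w = (\<chi> i j. if i = j then l i w else 0)" for w
  have UU: "para_conj U w ** U w = mat 1" if "w \<in> ?S" for w
    using orth[OF that] that
    by (simp add: vec_eq_iff matrix_matrix_mult_def para_conj_circle U_def mat_def hdot_def of_bool_def)
  have GU: "G (w ^ K) ** U w = U w ** D w" if "w \<in> ?S" for w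
  proof -
    have "(G (w ^ K) ** U w) $ i $ j = (U w ** D w) $ i $ j" for i j
    proof -
      have "(G (w ^ K) ** U w) $ i $ j = (G (w ^ K) *v v j w) $ i"
        by (simp add: matrix_matrix_mult_def matrix_vector_mult_def U_def)
      also have "\<dots> = v j w $ i * l j w"
        by (simp add: eig[OF that])
      also have "\<dots> = (U w ** D w) $ i $ j"
        by (simp add: matrix_matrix_mult_def U_def D_def if_distrib[of "\<lambda>a. _ * a"] cong: if_cong)
      finally show ?thesis .
    qed
    then show ?thesis
      by (simp add: vec_eq_iff)
  qed
  show ?thesis
  proof (rule that[OF K, of U D])
    show "analytic_mat ?S U"
      using an(1) by (simp add: analytic_mat_def analytic_vec_def U_def)
    show "analytic_mat ?S D"
      unfolding analytic_mat_def
    proof (intro allI)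
      show "(\<lambda>w. D w $ i $ j) analytic_on ?S" for i j
        using an(2) by (cases "i = j") (simp_all add: D_def)
    qed
    show "para_conj U w ** U w = mat 1" if "w \<in> ?S" for w
      using UU[OF that] .
    show "G (w ^ K) = U w ** D w ** para_conj U w" if "w \<in> ?S" for w
    proof -
      have "U w ** para_conj U w = mat 1"
        using UU[OF that] matrix_left_right_inverse by blast
      then have "G (w ^ K) = G (w ^ K) ** U w ** para_conj U w"
        by (simp flip: matrix_mul_assoc)
      then show ?thesis
        by (simp only: GU[OF that])
    qed
    show "D w $ i $ j = 0" if "i \<noteq> j" for w i j
      using that by (simp add: D_def)
    show "D w $ i $ j \<in> \<real>" if w: "w \<in> ?S" for w i j
    proof -
      have "w ^ K \<in> ?S"
        using w by (simp add: norm_power)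
      moreover have "v i w \<noteq> 0"
        using orth[OF w, of i i] by auto
      ultimately have "l i w \<in> \<real>"
        using hermitian_eigenvalue_real[OF herm _ eig[OF w, of i]] by blast
      then show ?thesis
        by (cases "i = j") (simp_all add: D_def)
    qed
  qed
qed

theorem theorem3p7:
  fixes A :: "complex \<Rightarrow> complex^'n^'n"
  assumes "puiseux_matrix A"
    and "para_hermitian A"
  shows "\<exists>(U :: complex \<Rightarrow> complex^'n^'n) (D :: complex \<Rightarrow> complex^'n^'n).
           puiseux_matrix U \<and> puiseux_matrix D \<and>
           para_unitary U \<and>
           near_circle (\<lambda>z. \<forall>i j. i \<noteq> j \<longrightarrow> D z $ i $ j = 0) \<and>
           (\<forall>z\<in>sphere 0 1. \<forall>i j. D z $ i $ j \<in> \<real>) \<and>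
           near_circle (\<lambda>z. A z = U z ** D z ** para_conj U z)"
proof -
  let ?S = "sphere 0 (1::real) :: complex set"
  obtain N G where N: "N > 0" and G: "analytic_mat ?S G" and A: "\<And>z. A z = G (principal_root N z)"
    by (rule puiseux_matrix_common_root[OF assms(1)]) (rule that)
  have "para_hermitian (\<lambda>z. G (principal_root N z))"
    using assms(2) A by (simp add: A[abs_def])
  then have herm: "hermitian (G w)" if "w \<in> ?S" for w
    using para_hermitian_pullback[OF G N _ that] by simp
  obtain K and U D :: "complex \<Rightarrow> complex^'n^'n" where K: "K > 0"
    and U: "analytic_mat ?S U" and D: "analytic_mat ?S D"
    and UU: "\<And>w. w \<in> ?S \<Longrightarrow> para_conj U w ** U w = mat 1"
    and GUD: "\<And>w. w \<in> ?S \<Longrightarrow> G (w ^ K) = U w ** D w ** para_conj U w"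
    and diag: "\<And>w i j. i \<noteq> j \<Longrightarrow> D w $ i $ j = 0"
    and real: "\<And>w i j. w \<in> ?S \<Longrightarrow> D w $ i $ j \<in> \<real>"
    by (rule analytic_eigendecomposition[OF G herm]) (assumption, rule that)
  define M where "M = N * K"
  have M: "M > 0"
    using N K by (simp add: M_def)
  have one: "analytic_mat ?S (\<lambda>_. mat 1 :: complex^'n^'n)"
    by (simp add: analytic_mat_def)
  have GK: "analytic_mat ?S (\<lambda>w. G (w ^ K))"
    using G analytic_circle_power unfolding analytic_mat_def by blast
  note UP = analytic_mat_para_conj[OF U]
  have 1: "near_circle (\<lambda>w. para_conj U w ** U w = mat 1)"
    using UU by (intro near_circle_mat_eq analytic_mat_mult UP U one)
  have 2: "near_circle (\<lambda>w. U w ** para_conj U w = mat 1)"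
    using UU matrix_left_right_inverse by (intro near_circle_mat_eq analytic_mat_mult UP U one) blast
  have 3: "near_circle (\<lambda>w. G (w ^ K) = U w ** D w ** para_conj U w)"
    using GUD by (intro near_circle_mat_eq analytic_mat_mult UP U D GK)
  note pull = 1[THEN near_circle_principal_root, OF M] 2[THEN near_circle_principal_root, OF M]
    3[THEN near_circle_principal_root, OF M]
  have root: "principal_root M z ^ K = principal_root N z" for z
    unfolding M_def by (rule principal_root_power[OF N K])
  have "near_circle (\<lambda>z. z \<noteq> 0 \<and>
      U (principal_root M z) ** para_conj U (principal_root M z) = mat 1 \<and>
      para_conj U (principal_root M z) ** U (principal_root M z) = mat 1 \<and>
      G (principal_root M z ^ K) = U (principal_root M z) ** D (principal_root M z) ** para_conj U (principal_root M z))"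
    by (intro near_circle_conj near_circle_nonzero pull)
  then have near: "near_circle (\<lambda>z.
      U (principal_root M z) ** para_conj (\<lambda>z. U (principal_root M z)) z = mat 1 \<and>
      para_conj (\<lambda>z. U (principal_root M z)) z ** U (principal_root M z) = mat 1 \<and>
      A z = U (principal_root M z) ** D (principal_root M z) ** para_conj (\<lambda>z. U (principal_root M z)) z)"
    by (rule near_circle_mono)
       (simp add: para_conj_principal_root[OF M, of _ U] A root)
  show ?thesis
  proof (intro exI conjI)
    show "puiseux_matrix (\<lambda>z. U (principal_root M z))" "puiseux_matrix (\<lambda>z. D (principal_root M z))"
      using puiseux_matrixI[OF M] U D by blast+
    show "para_unitary (\<lambda>z. U (principal_root M z))"
      unfolding para_unitary_def using near by (rule near_circle_mono) blast
    show "near_circle (\<lambda>z. \<forall>i j. i \<noteq> j \<longrightarrow> D (principal_root M z) $ i $ j = 0)"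
      using near by (rule near_circle_mono) (simp add: diag)
    show "\<forall>z\<in>?S. \<forall>i j. D (principal_root M z) $ i $ j \<in> \<real>"
      using real principal_root_circle[OF M] by blast
    show "near_circle (\<lambda>z. A z = U (principal_root M z) ** D (principal_root M z) **
        para_conj (\<lambda>z. U (principal_root M z)) z)"
      using near by (rule near_circle_mono) blast
  qed
qed

end
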